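(* Let $G$ be a compact group, let $d \in \mathbb{Z}_{>0}$, and let $\rho \colon G \to U(M_d)$ be a (continuous) unitary representation of $G$ on $\mathbb{C}^d$. Then the quasifree action $\beta^{\rho} \colon G \to \mathrm{Aut}(\mathcal{O}_d)$ on the Cuntz algebra $\mathcal{O}_d$ is equivariantly semiprojective.
   Context: For a topological group $G$, a unital $G$-algebra $(G, A, \alpha)$ is a unital C*-algebra $A$ with a continuous action $\alpha \colon G \to \mathrm{Aut}(A)$ (i.e. $g \mapsto \alpha_g(a)$ is norm continuous for every $a \in A$). Ideals are closed and two-sided, homomorphisms are $*$-homomorphisms, and quotients by $G$-invariant ideals carry the induced actions. Equivariantly semiprojective: a unital $G$-algebra $(G, A, \alpha)$ (or the action $\alpha$) is equivariantly semiprojective if whenever $(G, C, \gamma)$ is a unital $G$-algebra, $J_0 \subset J_1 \subset \cdots$ are $G$-invariant ideals in $C$, $J = \overline{\bigcup_{n=0}^{\infty} J_n}$, $\pi_n \colon C/J_n \to C/J$ are the quotient maps, and $\varphi \colon A \to C/J$ is a unital equivariant homomorphism, then there exist $n$ and a unital equivariant homomorphism $\psi \colon A \to C/J_n$ such that $\pi_n \circ \psi = \varphi$. Cuntz algebra: $\mathcal{O}_d$ is the universal unital C*-algebra generated by elements $s_1, \ldots, s_d$ with $s_j^* s_j = 1$ for all $j$ and $\sum_{j=1}^d s_j s_j^* = 1$ (the case $d = 1$ is allowed, and then $\mathcal{O}_1 = C(S^1)$). Quasifree action: writing $\rho(g) = (\rho_{j,k}(g))_{j,k=1}^d \in U(M_d)$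 as a matrix, $\beta^{\rho} \colon G \to \mathrm{Aut}(\mathcal{O}_d)$ is the unique action satisfying $\beta^{\rho}_g(s_k) = \sum_{j=1}^d \rho_{j,k}(g) s_j$ for $k = 1, \ldots, d$ and $g \in G$. *)

theory Defs
  imports "HOL-Analysis.Analysis" "HOL-Algebra.Algebra" "HOL-Algebra.Algebraic_Closure_Type"
begin

section \<open>Unital C*-algebras\<close>

text \<open>
  C*-algebras are carrier-based records on top of the HOL-Algebra hierarchy, because the statement
  speaks about quotients by varying ideals. Scalars live in the complex field, which as a
  HOL-Algebra ring is \<open>ring_of_type_algebra\<close>.
\<close>

record 'a cstar = "(complex, 'a) module" +
  star :: "'a \<Rightarrow> 'a"
  cnorm :: "'a \<Rightarrow> real"

text \<open>
  The value 0 off the carrier only serves to satisfy the unrestricted axioms (nonnegativity and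
  symmetry) of the locale \<^locale>\<open>Metric_space\<close>.
\<close>

definition cdist :: "'a cstar \<Rightarrow> 'a \<Rightarrow> 'a \<Rightarrow> real" where
  "cdist A x y =
     (if x \<in> carrier A \<and> y \<in> carrier A then cnorm A (x \<ominus>\<^bsub>A\<^esub> y) else 0)"

definition norm_topology :: "'a cstar \<Rightarrow> 'a topology" where
  "norm_topology A = Metric_space.mtopology (carrier A) (cdist A)"

text \<open>The zero algebra is admitted as a unital C*-algebra, so that every quotient is one.\<close>

locale unital_cstar_algebra =
  Module.module "ring_of_type_algebra :: complex ring" A + Ring.ring A
  for A :: "'a cstar" (structure) +
  assumes smult_mult_left:
      "\<lbrakk>x \<in> carrier A; y \<in> carrier A\<rbrakk> \<Longrightarrow> (c \<odot> x) \<otimes> y = c \<odot> (x \<otimes> y)"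
    and smult_mult_right:
      "\<lbrakk>x \<in> carrier A; y \<in> carrier A\<rbrakk> \<Longrightarrow> x \<otimes> (c \<odot> y) = c \<odot> (x \<otimes> y)"
    and star_closed: "x \<in> carrier A \<Longrightarrow> star A x \<in> carrier A"
    and star_star: "x \<in> carrier A \<Longrightarrow> star A (star A x) = x"
    and star_add:
      "\<lbrakk>x \<in> carrier A; y \<in> carrier A\<rbrakk> \<Longrightarrow> star A (x \<oplus> y) = star A x \<oplus> star A y"
    and star_smult: "x \<in> carrier A \<Longrightarrow> star A (c \<odot> x) = cnj c \<odot> star A x"
    and star_mult:
      "\<lbrakk>x \<in> carrier A; y \<in> carrier A\<rbrakk> \<Longrightarrow> star A (x \<otimes> y) = star A y \<otimes> star A x"
    and cnorm_nonneg: "x \<in> carrier A \<Longrightarrow> 0 \<le> cnorm A x"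
    and cnorm_eq_0_iff: "x \<in> carrier A \<Longrightarrow> cnorm A x = 0 \<longleftrightarrow> x = \<zero>"
    and cnorm_smult: "x \<in> carrier A \<Longrightarrow> cnorm A (c \<odot> x) = cmod c * cnorm A x"
    and cnorm_triangle:
      "\<lbrakk>x \<in> carrier A; y \<in> carrier A\<rbrakk> \<Longrightarrow> cnorm A (x \<oplus> y) \<le> cnorm A x + cnorm A y"
    and cnorm_mult:
      "\<lbrakk>x \<in> carrier A; y \<in> carrier A\<rbrakk> \<Longrightarrow> cnorm A (x \<otimes> y) \<le> cnorm A x * cnorm A y"
    and cstar_identity: "x \<in> carrier A \<Longrightarrow> cnorm A (star A x \<otimes> x) = (cnorm A x)\<^sup>2"
    and complete: "Metric_space.mcomplete (carrier A) (cdist A)"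

definition unital_star_hom :: "'a cstar \<Rightarrow> 'b cstar \<Rightarrow> ('a \<Rightarrow> 'b) set" where
  "unital_star_hom A B =
     {f \<in> ring_hom A B. \<forall>x\<in>carrier A.
        (\<forall>c. f (c \<odot>\<^bsub>A\<^esub> x) = c \<odot>\<^bsub>B\<^esub> f x) \<and> f (star A x) = star B (f x)}"

definition cstar_aut :: "'a cstar \<Rightarrow> ('a \<Rightarrow> 'a) set" where
  "cstar_aut A = {f \<in> unital_star_hom A A. bij_betw f (carrier A) (carrier A)}"

definition closed_ideal :: "'a set \<Rightarrow> 'a cstar \<Rightarrow> bool" where
  "closed_ideal J A \<longleftrightarrow> ideal J A \<and> closedin (norm_topology A) J"

text \<open>
  Elements of the quotient are the cosets of \<open>J\<close>. In \<open>smult\<close> the summand \<open>J\<close> matters for the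
  scalar 0 only, where the image of a coset is \<open>{0}\<close> rather than \<open>J\<close>.
\<close>

definition cstar_quotient :: "'a cstar \<Rightarrow> 'a set \<Rightarrow> 'a set cstar" where
  "cstar_quotient A J =
     \<lparr>carrier = carrier (A Quot J),
      monoid.mult = monoid.mult (A Quot J),
      monoid.one = \<one>\<^bsub>A Quot J\<^esub>,
      ring.zero = \<zero>\<^bsub>A Quot J\<^esub>,
      ring.add = ring.add (A Quot J),
      module.smult = (\<lambda>c K. set_add A J ((\<lambda>x. c \<odot>\<^bsub>A\<^esub> x) ` K)),
      star = (\<lambda>K. star A ` K),
      cnorm = (\<lambda>K. INF x\<in>K. cnorm A x)\<rparr>"


section \<open>Group actions\<close>

text \<open>
  A topological group is a type of class \<^class>\<open>topological_group_add\<close>. The group law is written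
  additively, but it is not assumed to be commutative; 0 is the neutral element.
\<close>

definition unital_G_algebra ::
  "'a cstar \<Rightarrow> ('g::topological_group_add \<Rightarrow> 'a \<Rightarrow> 'a) \<Rightarrow> bool" where
  "unital_G_algebra A \<alpha> \<longleftrightarrow>
     unital_cstar_algebra A \<and>
     (\<forall>g. \<alpha> g \<in> cstar_aut A) \<and>
     (\<forall>x\<in>carrier A. \<alpha> 0 x = x) \<and>
     (\<forall>g h. \<forall>x\<in>carrier A. \<alpha> (g + h) x = \<alpha> g (\<alpha> h x)) \<and>
     (\<forall>x\<in>carrier A. continuous_map euclidean (norm_topology A) (\<lambda>g. \<alpha> g x))"

definition equivariant_hom ::
  "'a cstar \<Rightarrow> ('g \<Rightarrow> 'a \<Rightarrow> 'a) \<Rightarrow> 'b cstar \<Rightarrow> ('g \<Rightarrow> 'b \<Rightarrow> 'b) \<Rightarrow> ('a \<Rightarrow> 'b) set" where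
  "equivariant_hom A \<alpha> B \<beta> =
     {f \<in> unital_star_hom A B. \<forall>g. \<forall>x\<in>carrier A. f (\<alpha> g x) = \<beta> g (f x)}"

definition invariant_ideal :: "'a set \<Rightarrow> 'a cstar \<Rightarrow> ('g \<Rightarrow> 'a \<Rightarrow> 'a) \<Rightarrow> bool" where
  "invariant_ideal J A \<alpha> \<longleftrightarrow> closed_ideal J A \<and> (\<forall>g. \<alpha> g ` J \<subseteq> J)"

definition quotient_action :: "('g \<Rightarrow> 'a \<Rightarrow> 'a) \<Rightarrow> 'g \<Rightarrow> 'a set \<Rightarrow> 'a set" where
  "quotient_action \<alpha> g K = \<alpha> g ` K"

text \<open>
  HOL cannot quantify over types inside a formula, so the type \<open>'c\<close> that carries the test
  algebras \<open>C\<close> is a parameter; a theorem about \<open>equivariantly_semiprojective TYPE('c)\<close> for a type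
  variable \<open>'c\<close> covers all of them. The map \<open>C/I \<rightarrow> C/J\<close> for ideals \<open>I \<subseteq> J\<close> sends
  a coset \<open>K\<close> of \<open>I\<close> to the coset \<open>J + K\<close> of \<open>J\<close>.
\<close>

definition equivariantly_semiprojective ::
  "'c itself \<Rightarrow> 'a cstar \<Rightarrow> ('g::topological_group_add \<Rightarrow> 'a \<Rightarrow> 'a) \<Rightarrow> bool" where
  "equivariantly_semiprojective (_ :: 'c itself) A \<alpha> \<longleftrightarrow>
     unital_G_algebra A \<alpha> \<and>
     (\<forall>(C :: 'c cstar) \<gamma> (J :: nat \<Rightarrow> 'c set) Jinf \<phi>.
        unital_G_algebra C \<gamma> \<and>
        (\<forall>n. invariant_ideal (J n) C \<gamma>) \<and>
        (\<forall>n. J n \<subseteq> J (Suc n)) \<and>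
        Jinf = norm_topology C closure_of (\<Union>n. J n) \<and>
        \<phi> \<in> equivariant_hom A \<alpha> (cstar_quotient C Jinf) (quotient_action \<gamma>) \<longrightarrow>
        (\<exists>n. \<exists>\<psi> \<in> equivariant_hom A \<alpha> (cstar_quotient C (J n)) (quotient_action \<gamma>).
           \<forall>x\<in>carrier A. set_add C Jinf (\<psi> x) = \<phi> x))"


section \<open>Cuntz algebras and quasifree actions\<close>

text \<open>The number of generators is the (positive) cardinality of the finite index type \<open>'d\<close>.\<close>

definition cuntz_relations :: "'a cstar \<Rightarrow> ('d::finite \<Rightarrow> 'a) \<Rightarrow> bool" where
  "cuntz_relations A s \<longleftrightarrow>
     (\<forall>j. s j \<in> carrier A) \<and>
     (\<forall>j. star A (s j) \<otimes>\<^bsub>A\<^esub> s j = \<one>\<^bsub>A\<^esub>) \<and>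
     (\<Oplus>\<^bsub>A\<^esub>j\<in>UNIV. s j \<otimes>\<^bsub>A\<^esub> star A (s j)) = \<one>\<^bsub>A\<^esub>"

definition unital_cstar_subalgebra :: "'a set \<Rightarrow> 'a cstar \<Rightarrow> bool" where
  "unital_cstar_subalgebra B A \<longleftrightarrow>
     subring B A \<and>
     (\<forall>x\<in>B. (\<forall>c. c \<odot>\<^bsub>A\<^esub> x \<in> B) \<and> star A x \<in> B) \<and>
     closedin (norm_topology A) B"

text \<open>
  The generators \<open>s\<close> exhibit \<open>A\<close> as the universal unital C*-algebra of the Cuntz relations: they
  generate \<open>A\<close>, and any family \<open>t\<close> satisfying the relations is the image of \<open>s\<close> under a unital
  *-homomorphism (unique, since \<open>s\<close> generates). The target algebras range over all unital
  C*-algebras whose carrier is a set of reals. This is no restriction: the C*-subalgebra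
  generated by a finite family \<open>t\<close> in an arbitrary C*-algebra is separable, hence has at most
  the cardinality of the continuum, and is therefore isomorphic to one of these. A type variable
  in this place would make the hypothesis too weak when instantiated by a small type.
\<close>

definition cuntz_algebra :: "'a cstar \<Rightarrow> ('d::finite \<Rightarrow> 'a) \<Rightarrow> bool" where
  "cuntz_algebra A s \<longleftrightarrow>
     unital_cstar_algebra A \<and>
     cuntz_relations A s \<and>
     (\<forall>B. unital_cstar_subalgebra B A \<and> range s \<subseteq> B \<longrightarrow> B = carrier A) \<and>
     (\<forall>(B :: real cstar) t. unital_cstar_algebra B \<and> cuntz_relations B t \<longrightarrow>
        (\<exists>f \<in> unital_star_hom A B. \<forall>j. f (s j) = t j))"

definition unitary_matrix :: "complex ^ 'd ^ 'd \<Rightarrow> bool" where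
  "unitary_matrix U \<longleftrightarrow>
     map_matrix cnj (transpose U) ** U = mat 1 \<and> U ** map_matrix cnj (transpose U) = mat 1"

definition unitary_representation ::
  "('g::topological_group_add \<Rightarrow> complex ^ 'd ^ 'd) \<Rightarrow> bool" where
  "unitary_representation \<rho> \<longleftrightarrow>
     (\<forall>g. unitary_matrix (\<rho> g)) \<and>
     (\<forall>g h. \<rho> (g + h) = \<rho> g ** \<rho> h) \<and>
     continuous_on UNIV \<rho>"

text \<open>
  The \<open>(j,k)\<close> entry of \<open>\<rho> g\<close> is \<open>\<rho> g $ j $ k\<close>. Automorphisms are normalised by
  \<^const>\<open>extensional\<close> since \<open>THE\<close> asks for a unique function on the whole type \<open>'a\<close>.
\<close>

definition quasifree_action ::
  "'a cstar \<Rightarrow> ('d::finite \<Rightarrow> 'a) \<Rightarrow> ('g::topological_group_add \<Rightarrow> complex ^ 'd ^ 'd)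
     \<Rightarrow> 'g \<Rightarrow> 'a \<Rightarrow> 'a" where
  "quasifree_action A s \<rho> =
     (THE \<beta>. unital_G_algebra A \<beta> \<and>
        (\<forall>g. \<beta> g \<in> extensional (carrier A)) \<and>
        (\<forall>g k. \<beta> g (s k) = (\<Oplus>\<^bsub>A\<^esub>j\<in>UNIV. (\<rho> g $ j $ k) \<odot>\<^bsub>A\<^esub> s j)))"

end

theory Submission
  imports Defs
begin

text \<open>
  Lift the images of the generators to \<open>C\<close> and average the lifts over the group, so that they
  transform under the action exactly like the generators. They satisfy the Cuntz relations modulo
  the closure of the union of the ideals, hence up to a small error in some \<open>C / J\<^sub>n\<close>.
  If \<open>v\<close> is the row of their images there, then \<open>a = v v\<^sup>*\<close> is invariant because \<open>\<rho>\<close> is unitary,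
  and the row \<open>a\<^sup>-\<^sup>1\<^sup>/\<^sup>2 v\<close> satisfies the relations exactly and still transforms correctly. The universal property of the Cuntz algebra turns it into the
  required equivariant homomorphism.

  The average is obtained without Haar measure: repeated averaging over finite sets of translates
  lets the oscillation of an orbit tend to 0. The C*-theory needed (quotients are C*-algebras,
  homomorphisms are contractive, the generators have orthogonal ranges) is derived from inverse
  square roots of elements close to 1, without spectral theory.
\<close>

section \<open>Norms, homomorphisms and images of C*-algebras\<close>

text \<open>Only the C*-identity and completeness are assumed, so positivity and functional calculus
  have to be replaced. The replacement rests on one estimate: if \<open>a\<close>, \<open>x\<close>,
  \<open>z\<close> lie within 1/5 of the unit, then
  \<open>((1/2) \<odot> (x \<oplus> z)) \<otimes> a\<close> lies within 1/2 of it. This gives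
  existence of inverse square roots and uniqueness among commuting ones. Uniqueness is then the tool
  for symmetry: whatever fixes \<open>a\<close> fixes its inverse square root, be it the adjoint or
  the group, and in the limit quotient, where \<open>a\<close> becomes the unit, so does the root.
  The Cuntz relations as stated do not mention orthogonality of the ranges. It is needed twice: a
  row rotated by a unitary matrix consists of isometries only if the cross terms vanish, and the
  off-diagonal errors of the lifts are small only for the same reason. The usual positivity argument
  gives way to the fact that the unit is an extreme point of the self-adjoint part of the unit ball.
  The given universal property reaches only algebras carried by sets of reals, while the quotients
  here live on arbitrary types; a countability argument bridges the gap.\<close>

lemma ring_of_type_algebra_simps [simp]:
  "carrier (ring_of_type_algebra :: complex ring) = UNIV"
  "x \<otimes>\<^bsub>(ring_of_type_algebra :: complex ring)\<^esub> y = x * y"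
  "x \<oplus>\<^bsub>(ring_of_type_algebra :: complex ring)\<^esub> y = x + y"
  "\<one>\<^bsub>(ring_of_type_algebra :: complex ring)\<^esub> = 1"
  "\<zero>\<^bsub>(ring_of_type_algebra :: complex ring)\<^esub> = 0"
  by (auto simp: ring_of_type_algebra_def)

text \<open>Split off from C*-algebras because the sequential form of completeness is applied below
  to structures that are not yet known to be C*-algebras.\<close>

locale normed_group = abelian_group A for A :: "'a cstar" (structure) +
  assumes norm_ge_0: "x \<in> carrier A \<Longrightarrow> 0 \<le> cnorm A x"
    and norm_eq_0: "x \<in> carrier A \<Longrightarrow> cnorm A x = 0 \<longleftrightarrow> x = \<zero>"
    and norm_uminus: "x \<in> carrier A \<Longrightarrow> cnorm A (\<ominus> x) = cnorm A x"
    and norm_add: "\<lbrakk>x \<in> carrier A; y \<in> carrier A\<rbrakk> \<Longrightarrow> cnorm A (x \<oplus> y) \<le> cnorm A x + cnorm A y"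
begin

lemma norm_zero [simp]: "cnorm A \<zero> = 0"
  using norm_eq_0 by blast

lemma minus_add_cancel: "\<lbrakk>x \<in> carrier A; y \<in> carrier A\<rbrakk> \<Longrightarrow> (x \<ominus> y) \<oplus> y = x"
  by (simp add: a_minus_def a_assoc l_neg)

lemma minus_eq_zero_iff: "\<lbrakk>x \<in> carrier A; y \<in> carrier A\<rbrakk> \<Longrightarrow> x \<ominus> y = \<zero> \<longleftrightarrow> x = y"
  by (metis minus_add_cancel a_minus_def l_zero r_neg)

lemma minus_triangle_eq:
  "\<lbrakk>x \<in> carrier A; y \<in> carrier A; z \<in> carrier A\<rbrakk> \<Longrightarrow> (x \<ominus> y) \<oplus> (y \<ominus> z) = x \<ominus> z"
  by (simp add: a_minus_def a_ac r_neg1 r_neg2)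

lemma norm_minus_commute:
  assumes "x \<in> carrier A" "y \<in> carrier A"
  shows "cnorm A (x \<ominus> y) = cnorm A (y \<ominus> x)"
proof -
  have "\<ominus> (x \<ominus> y) = y \<ominus> x"
    using assms by (simp add: a_minus_def minus_add a_comm)
  then show ?thesis
    using norm_uminus[of "x \<ominus> y"] assms by simp
qed

lemma norm_minus: 
  "\<lbrakk>x \<in> carrier A; y \<in> carrier A\<rbrakk> \<Longrightarrow> cnorm A (x \<ominus> y) \<le> cnorm A x + cnorm A y"
  using norm_add[of x "\<ominus> y"] by (simp add: a_minus_def norm_uminus)

lemma norm_triangle_minus:
  "\<lbrakk>x \<in> carrier A; y \<in> carrier A; z \<in> carrier A\<rbrakk>
    \<Longrightarrow> cnorm A (x \<ominus> z) \<le> cnorm A (x \<ominus> y) + cnorm A (y \<ominus> z)"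
  using norm_add[of "x \<ominus> y" "y \<ominus> z"] by (simp add: minus_triangle_eq)

lemma norm_le_minus_add:
  "\<lbrakk>x \<in> carrier A; y \<in> carrier A\<rbrakk> \<Longrightarrow> cnorm A x \<le> cnorm A (x \<ominus> y) + cnorm A y"
  using norm_add[of "x \<ominus> y" y] by (simp add: minus_add_cancel)

sublocale Metric_space "carrier A" "cdist A"
proof
  fix x y z
  show "0 \<le> cdist A x y"
    by (simp add: cdist_def norm_ge_0)
  show "cdist A x y = cdist A y x"
    by (simp add: cdist_def norm_minus_commute)
  assume xy: "x \<in> carrier A" "y \<in> carrier A"
  then show "cdist A x y = 0 \<longleftrightarrow> x = y"
    by (simp add: cdist_def norm_eq_0 minus_eq_zero_iff)
  assume "z \<in> carrier A"
  with xy show "cdist A x z \<le> cdist A x y + cdist A y z"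
    by (simp add: cdist_def norm_triangle_minus)
qed

lemma cdist_eq: "\<lbrakk>x \<in> carrier A; y \<in> carrier A\<rbrakk> \<Longrightarrow> cdist A x y = cnorm A (x \<ominus> y)"
  by (simp add: cdist_def)

lemma closure_of_iff:
  assumes "S \<subseteq> carrier A"
  shows "x \<in> norm_topology A closure_of S \<longleftrightarrow>
    x \<in> carrier A \<and> (\<forall>e>0. \<exists>y\<in>S. cnorm A (x \<ominus> y) < e)"
proof -
  have "y \<in> mball x e \<longleftrightarrow> cnorm A (x \<ominus> y) < e" if "x \<in> carrier A" "y \<in> S" for y e
    using assms that by (auto simp: cdist_eq subset_iff)
  then show ?thesis
    unfolding norm_topology_def metric_closure_of by blast
qed

lemma closedin_iff:
  "closedin (norm_topology A) S \<longleftrightarrow>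
    S \<subseteq> carrier A \<and> (\<forall>x\<in>carrier A. (\<forall>e>0. \<exists>y\<in>S. cnorm A (x \<ominus> y) < e) \<longrightarrow> x \<in> S)"
proof (cases "S \<subseteq> carrier A")
  case True
  then have "closedin (norm_topology A) S \<longleftrightarrow> norm_topology A closure_of S \<subseteq> S"
    using closure_of_subset_eq[of S "norm_topology A"] by (simp add: norm_topology_def)
  then show ?thesis
    using True by (simp add: subset_iff closure_of_iff[OF True] Ball_def imp_conjL)
next
  case False
  then show ?thesis
    using closedin_subset[of "norm_topology A" S] by (auto simp: norm_topology_def)
qed

lemma mcomplete_iff:
  "mcomplete \<longleftrightarrow> (\<forall>u. (\<forall>n::nat. u n \<in> carrier A) \<and>
      (\<forall>e>0. \<exists>N. \<forall>m\<ge>N. \<forall>n\<ge>N. cnorm A (u m \<ominus> u n) < e) \<longrightarrow>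
      (\<exists>x\<in>carrier A. (\<lambda>n. cnorm A (u n \<ominus> x)) \<longlonglongrightarrow> 0))"
proof -
  have *: "range u \<subseteq> carrier A \<longleftrightarrow> (\<forall>n. u n \<in> carrier A)" for u :: "nat \<Rightarrow> 'a"
    by auto
  have C: "MCauchy u \<longleftrightarrow> (\<forall>n. u n \<in> carrier A) \<and>
      (\<forall>e>0. \<exists>N. \<forall>m\<ge>N. \<forall>n\<ge>N. cnorm A (u m \<ominus> u n) < e)" for u
    unfolding MCauchy_def * by (auto simp: cdist_eq)
  have L: "limitin mtopology u x sequentially \<longleftrightarrow>
      x \<in> carrier A \<and> (\<lambda>n. cnorm A (u n \<ominus> x)) \<longlonglongrightarrow> 0" if "\<forall>n. u n \<in> carrier A" for u x
    using that by (auto simp: limitin_metric_dist_null cdist_eq)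
  show ?thesis
    unfolding mcomplete_def C by (intro all_cong1 imp_cong refl) (simp add: L Bex_def)
qed

lemma continuous_map_norm_topology_iff:
  fixes f :: "'x::topological_space \<Rightarrow> 'a"
  shows "continuous_map euclidean (norm_topology A) f \<longleftrightarrow>
    (\<forall>x. f x \<in> carrier A) \<and>
    (\<forall>x. \<forall>e>0. \<exists>U. open U \<and> x \<in> U \<and> (\<forall>y\<in>U. cnorm A (f y \<ominus> f x) < e))"
proof (cases "\<forall>x. f x \<in> carrier A")
  case True
  then have "cnorm A (f y \<ominus> f x) = cdist A (f x) (f y)" for x y
    by (simp add: cdist_eq norm_minus_commute)
  with True show ?thesis
    unfolding norm_topology_def continuous_map_to_metric
    by (auto simp: in_mball)
next
  case False
  then show ?thesis
    using continuous_map_image_subset_topspace[of euclidean "norm_topology A" f]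
    by (auto simp: norm_topology_def)
qed

end

context unital_cstar_algebra
begin

lemmas smult_left_distrib = smult_l_distr[simplified]
lemmas smult_right_distrib = smult_r_distr[simplified]
lemmas smult_smult = smult_assoc1[simplified, symmetric]
lemmas one_smult = smult_one[simplified]

lemma zero_smult [simp]: "x \<in> carrier A \<Longrightarrow> 0 \<odot> x = \<zero>"
  using smult_left_distrib[of x 0 0] by simp

lemma smult_zero [simp]: "c \<odot> \<zero> = \<zero>"
  using smult_right_distrib[of \<zero> \<zero> c] by simp

lemma uminus_eq_smult: "x \<in> carrier A \<Longrightarrow> \<ominus> x = (-1) \<odot> x"
  using smult_left_distrib[of x 1 "-1"] by (simp add: one_smult minus_equality a_comm)

lemma smult_uminus: "x \<in> carrier A \<Longrightarrow> c \<odot> (\<ominus> x) = \<ominus> (c \<odot> x)"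
  by (simp add: uminus_eq_smult smult_smult)

lemma uminus_smult: "x \<in> carrier A \<Longrightarrow> (-c) \<odot> x = \<ominus> (c \<odot> x)"
  by (simp add: uminus_eq_smult smult_smult)

lemma smult_minus: "\<lbrakk>x \<in> carrier A; y \<in> carrier A\<rbrakk> \<Longrightarrow> c \<odot> (x \<ominus> y) = c \<odot> x \<ominus> c \<odot> y"
  by (simp add: a_minus_def smult_right_distrib smult_uminus)

lemma diff_smult: "x \<in> carrier A \<Longrightarrow> (c - d) \<odot> x = c \<odot> x \<ominus> d \<odot> x"
  using smult_left_distrib[of x c "-d"] by (simp add: a_minus_def uminus_smult)

lemma star_zero [simp]: "star A \<zero> = \<zero>"
  using star_smult[of \<zero> 0] star_closed by simp

lemma star_uminus: "x \<in> carrier A \<Longrightarrow> star A (\<ominus> x) = \<ominus> star A x"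
  by (simp add: uminus_eq_smult star_smult star_closed)

lemma star_minus: "\<lbrakk>x \<in> carrier A; y \<in> carrier A\<rbrakk> \<Longrightarrow> star A (x \<ominus> y) = star A x \<ominus> star A y"
  by (simp add: a_minus_def star_add star_uminus star_closed)

lemma star_one [simp]: "star A \<one> = \<one>"
proof -
  have "\<one> = star A (star A \<one> \<otimes> \<one>)"
    by (simp add: star_star star_closed)
  also have "\<dots> = star A \<one>"
    by (subst star_mult) (simp_all add: star_closed star_star)
  finally show ?thesis by simp
qed

lemmas star_simps = star_closed star_star star_add star_smult star_mult star_uminus star_minus

sublocale normed_group A
proof unfold_locales
  fix x assume x: "x \<in> carrier A"
  then show "0 \<le> cnorm A x" "cnorm A x = 0 \<longleftrightarrow> x = \<zero>"
    by (simp_all add: cnorm_nonneg cnorm_eq_0_iff)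
  show "cnorm A (\<ominus> x) = cnorm A x"
    using x by (simp add: uminus_eq_smult cnorm_smult)
  fix y assume "y \<in> carrier A"
  with x show "cnorm A (x \<oplus> y) \<le> cnorm A x + cnorm A y"
    by (rule cnorm_triangle)
qed

text \<open>The C*-identity and submultiplicativity give one inequality for every element; applied
  to the adjoint it becomes the other.\<close>

lemma norm_star: 
  assumes "x \<in> carrier A"
  shows "cnorm A (star A x) = cnorm A x"
proof -
  have le: "cnorm A y \<le> cnorm A (star A y)" if y: "y \<in> carrier A" for y
  proof (cases "cnorm A y = 0")
    case False
    have "cnorm A y * cnorm A y \<le> cnorm A (star A y) * cnorm A y"
      using cstar_identity[OF y] cnorm_mult[of "star A y" y] y
      by (simp add: star_closed power2_eq_square)
    then show ?thesis
      using False cnorm_nonneg[OF y] by simp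
  qed (use cnorm_nonneg[of "star A y"] y star_closed in simp)
  show ?thesis
    using le[OF assms] le[of "star A x"] assms by (simp add: star_closed star_star)
qed

text \<open>The norm of the unit equals its own square. Only an inequality holds in general, since
  the norm is 0 in the zero algebra.\<close>

lemma norm_one_le: "cnorm A \<one> \<le> 1"
proof -
  have "cnorm A \<one> = (cnorm A \<one>)\<^sup>2"
    using cstar_identity[of \<one>] by simp
  then show ?thesis
    by (cases "cnorm A \<one> = 0") (simp_all add: power2_eq_square)
qed

lemma norm_self_adjoint_power2:
  "\<lbrakk>x \<in> carrier A; star A x = x\<rbrakk> \<Longrightarrow> cnorm A (x \<otimes> x) = (cnorm A x)\<^sup>2"
  using cstar_identity[of x] by metis

lemma complete_seq:
  assumes "\<And>n::nat. u n \<in> carrier A"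
    and "\<And>e. e > 0 \<Longrightarrow> \<exists>N. \<forall>m\<ge>N. \<forall>n\<ge>N. cnorm A (u m \<ominus> u n) < e"
  shows "\<exists>x\<in>carrier A. (\<lambda>n. cnorm A (u n \<ominus> x)) \<longlonglongrightarrow> 0"
proof -
  have "(\<forall>n. u n \<in> carrier A) \<and> (\<forall>e>0. \<exists>N. \<forall>m\<ge>N. \<forall>n\<ge>N. cnorm A (u m \<ominus> u n) < e)"
    using assms by simp
  with mcomplete_iff[THEN iffD1, OF complete] show ?thesis
    by (elim allE[of _ u] impE)
qed

lemma norm_isometry_le_one:
  assumes "x \<in> carrier A" "star A x \<otimes> x = \<one>"
  shows "cnorm A x \<le> 1"
proof (rule power2_le_imp_le)
  show "(cnorm A x)\<^sup>2 \<le> 1\<^sup>2"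
    using cstar_identity[of x] assms norm_one_le by simp
qed simp

end

section \<open>Unital star-homomorphisms and transport of structure\<close>

locale star_hom = A: unital_cstar_algebra A + B: unital_cstar_algebra B
  for A :: "'a cstar" and B :: "'b cstar" +
  fixes f :: "'a \<Rightarrow> 'b"
  assumes star_hom: "f \<in> unital_star_hom A B"
begin

lemma hom_closed [simp]: "x \<in> carrier A \<Longrightarrow> f x \<in> carrier B"
  and hom_add: "\<lbrakk>x \<in> carrier A; y \<in> carrier A\<rbrakk> \<Longrightarrow> f (x \<oplus>\<^bsub>A\<^esub> y) = f x \<oplus>\<^bsub>B\<^esub> f y"
  and hom_mult: "\<lbrakk>x \<in> carrier A; y \<in> carrier A\<rbrakk> \<Longrightarrow> f (x \<otimes>\<^bsub>A\<^esub> y) = f x \<otimes>\<^bsub>B\<^esub> f y"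
  and hom_one [simp]: "f \<one>\<^bsub>A\<^esub> = \<one>\<^bsub>B\<^esub>"
  and hom_smult: "x \<in> carrier A \<Longrightarrow> f (c \<odot>\<^bsub>A\<^esub> x) = c \<odot>\<^bsub>B\<^esub> f x"
  and hom_star: "x \<in> carrier A \<Longrightarrow> f (star A x) = star B (f x)"
  using star_hom
  by (auto simp: unital_star_hom_def ring_hom_add ring_hom_mult ring_hom_one ring_hom_closed)

lemma hom_zero [simp]: "f \<zero>\<^bsub>A\<^esub> = \<zero>\<^bsub>B\<^esub>"
  using hom_smult[of "\<one>\<^bsub>A\<^esub>" 0] by simp

lemma hom_uminus: "x \<in> carrier A \<Longrightarrow> f (\<ominus>\<^bsub>A\<^esub> x) = \<ominus>\<^bsub>B\<^esub> f x"
  by (simp add: A.uminus_eq_smult B.uminus_eq_smult hom_smult)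

lemma hom_minus: "\<lbrakk>x \<in> carrier A; y \<in> carrier A\<rbrakk> \<Longrightarrow> f (x \<ominus>\<^bsub>A\<^esub> y) = f x \<ominus>\<^bsub>B\<^esub> f y"
  by (simp add: a_minus_def hom_add hom_uminus)

lemma hom_finsum:
  assumes "finite F" "\<And>i. i \<in> F \<Longrightarrow> g i \<in> carrier A"
  shows "f (\<Oplus>\<^bsub>A\<^esub>i\<in>F. g i) = (\<Oplus>\<^bsub>B\<^esub>i\<in>F. f (g i))"
  using assms
proof (induction F)
  case (insert i F)
  then have "f (\<Oplus>\<^bsub>A\<^esub>i\<in>insert i F. g i) = f (g i \<oplus>\<^bsub>A\<^esub> (\<Oplus>\<^bsub>A\<^esub>i\<in>F. g i))"
    by (subst A.finsum_insert) auto
  also have "\<dots> = f (g i) \<oplus>\<^bsub>B\<^esub> (\<Oplus>\<^bsub>B\<^esub>i\<in>F. f (g i))"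
    using insert by (subst hom_add) (auto intro: A.finsum_closed)
  also have "\<dots> = (\<Oplus>\<^bsub>B\<^esub>i\<in>insert i F. f (g i))"
    using insert by (subst B.finsum_insert) auto
  finally show ?case .
qed simp

end

lemma unital_star_homI:
  assumes "\<And>x. x \<in> carrier A \<Longrightarrow> f x \<in> carrier B"
    and "\<And>x y. \<lbrakk>x \<in> carrier A; y \<in> carrier A\<rbrakk> \<Longrightarrow> f (x \<oplus>\<^bsub>A\<^esub> y) = f x \<oplus>\<^bsub>B\<^esub> f y"
    and "\<And>x y. \<lbrakk>x \<in> carrier A; y \<in> carrier A\<rbrakk> \<Longrightarrow> f (x \<otimes>\<^bsub>A\<^esub> y) = f x \<otimes>\<^bsub>B\<^esub> f y"
    and "f \<one>\<^bsub>A\<^esub> = \<one>\<^bsub>B\<^esub>"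
    and "\<And>x c. x \<in> carrier A \<Longrightarrow> f (c \<odot>\<^bsub>A\<^esub> x) = c \<odot>\<^bsub>B\<^esub> f x"
    and "\<And>x. x \<in> carrier A \<Longrightarrow> f (star A x) = star B (f x)"
  shows "f \<in> unital_star_hom A B"
  using assms by (auto simp: unital_star_hom_def ring_hom_def)

lemma unital_star_hom_compose:
  assumes "unital_cstar_algebra A" "f \<in> unital_star_hom A B" "g \<in> unital_star_hom B C"
  shows "(\<lambda>x. g (f x)) \<in> unital_star_hom A C"
  using assms by (auto simp: unital_star_hom_def ring_hom_def Pi_iff)

lemma unital_star_hom_id: "(\<lambda>x. x) \<in> unital_star_hom A A"
  by (auto simp: unital_star_hom_def ring_hom_def)

text \<open>All algebraic laws descend along \<open>q\<close>; only the norm and completeness have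
  to be supplied. No relation between the norms of \<open>A\<close> and \<open>B\<close> is assumed,
  so the lemma serves both for the coset map onto a quotient and for an injective relabelling of a
  subalgebra by real numbers.\<close>

lemma unital_cstar_algebra_image:
  fixes A :: "'a cstar" and B :: "'b cstar"
  assumes A: "unital_cstar_algebra A"
    and S: "subring S A" "\<And>x c. x \<in> S \<Longrightarrow> c \<odot>\<^bsub>A\<^esub> x \<in> S" "\<And>x. x \<in> S \<Longrightarrow> star A x \<in> S"
    and q: "q ` S = carrier B"
    and add: "\<And>x y. \<lbrakk>x \<in> S; y \<in> S\<rbrakk> \<Longrightarrow> q x \<oplus>\<^bsub>B\<^esub> q y = q (x \<oplus>\<^bsub>A\<^esub> y)"
    and mult: "\<And>x y. \<lbrakk>x \<in> S; y \<in> S\<rbrakk> \<Longrightarrow> q x \<otimes>\<^bsub>B\<^esub> q y = q (x \<otimes>\<^bsub>A\<^esub> y)"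
    and zero: "\<zero>\<^bsub>B\<^esub> = q \<zero>\<^bsub>A\<^esub>"
    and one: "\<one>\<^bsub>B\<^esub> = q \<one>\<^bsub>A\<^esub>"
    and smult: "\<And>x c. x \<in> S \<Longrightarrow> c \<odot>\<^bsub>B\<^esub> q x = q (c \<odot>\<^bsub>A\<^esub> x)"
    and star: "\<And>x. x \<in> S \<Longrightarrow> star B (q x) = q (star A x)"
    and norm_nonneg: "\<And>x. x \<in> S \<Longrightarrow> 0 \<le> cnorm B (q x)"
    and norm_zero: "\<And>x. x \<in> S \<Longrightarrow> cnorm B (q x) = 0 \<Longrightarrow> q x = q \<zero>\<^bsub>A\<^esub>"
    and norm_smult: "\<And>x c. x \<in> S \<Longrightarrow> cnorm B (q (c \<odot>\<^bsub>A\<^esub> x)) = cmod c * cnorm B (q x)"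
    and norm_add: "\<And>x y. \<lbrakk>x \<in> S; y \<in> S\<rbrakk> \<Longrightarrow> cnorm B (q (x \<oplus>\<^bsub>A\<^esub> y)) \<le> cnorm B (q x) + cnorm B (q y)"
    and norm_mult: "\<And>x y. \<lbrakk>x \<in> S; y \<in> S\<rbrakk> \<Longrightarrow> cnorm B (q (x \<otimes>\<^bsub>A\<^esub> y)) \<le> cnorm B (q x) * cnorm B (q y)"
    and norm_star: "\<And>x. x \<in> S \<Longrightarrow> cnorm B (q (star A x \<otimes>\<^bsub>A\<^esub> x)) = (cnorm B (q x))\<^sup>2"
    and complete: "\<And>u :: nat \<Rightarrow> 'a. (\<And>n. u n \<in> S) \<Longrightarrow>
      (\<And>e. e > 0 \<Longrightarrow> \<exists>N. \<forall>m\<ge>N. \<forall>n\<ge>N. cnorm B (q (u m \<ominus>\<^bsub>A\<^esub> u n)) < e) \<Longrightarrow>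
      \<exists>x\<in>S. (\<lambda>n. cnorm B (q (u n \<ominus>\<^bsub>A\<^esub> x))) \<longlonglongrightarrow> 0"
  shows "unital_cstar_algebra B"
proof -
  interpret A: unital_cstar_algebra A by fact
  have SA: "S \<subseteq> carrier A"
    using S(1) by (simp add: subringE)
  note cl = subringE(2,3,5,6,7)[OF S(1)] S(2,3)
  have SD: "x \<in> carrier A" if "x \<in> S" for x
    using that SA by blast
  have diff: "x \<ominus>\<^bsub>A\<^esub> y \<in> S" if "x \<in> S" "y \<in> S" for x y
    using cl that by (simp add: a_minus_def)
  have ex: "\<exists>x\<in>S. b = q x" if "b \<in> carrier B" for b
    using that q by auto
  have inB: "q x \<in> carrier B" if "x \<in> S" for x
    using that q by auto
  have ab: "abelian_group B"
  proof (rule abelian_groupI)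
    fix x y z
    assume "x \<in> carrier B" "y \<in> carrier B" "z \<in> carrier B"
    then obtain x' y' z' where [simp]: "x = q x'" "y = q y'" "z = q z'"
      and "x' \<in> S" "y' \<in> S" "z' \<in> S"
      using ex by meson
    then show "x \<oplus>\<^bsub>B\<^esub> y \<oplus>\<^bsub>B\<^esub> z = x \<oplus>\<^bsub>B\<^esub> (y \<oplus>\<^bsub>B\<^esub> z)" "x \<oplus>\<^bsub>B\<^esub> y = y \<oplus>\<^bsub>B\<^esub> x"
        "x \<oplus>\<^bsub>B\<^esub> y \<in> carrier B"
      by (simp_all add: add cl SD A.a_ac inB)
  next
    show "\<zero>\<^bsub>B\<^esub> \<in> carrier B"
      by (simp add: zero inB cl)
    fix x assume "x \<in> carrier B"
    then obtain x' where [simp]: "x = q x'" and x': "x' \<in> S"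
      using ex by meson
    show "\<zero>\<^bsub>B\<^esub> \<oplus>\<^bsub>B\<^esub> x = x"
      using x' by (simp add: zero add cl SD)
    show "\<exists>y\<in>carrier B. y \<oplus>\<^bsub>B\<^esub> x = \<zero>\<^bsub>B\<^esub>"
      by (rule bexI[of _ "q (\<ominus>\<^bsub>A\<^esub> x')"]) (use x' in \<open>simp_all add: zero add cl SD inB A.l_neg\<close>)
  qed
  have rB: "ring B"
  proof (rule ringI[OF ab])
    show "Group.monoid B"
    proof (rule monoidI)
      fix x y z
      assume "x \<in> carrier B" "y \<in> carrier B" "z \<in> carrier B"
      then obtain x' y' z' where [simp]: "x = q x'" "y = q y'" "z = q z'"
        and "x' \<in> S" "y' \<in> S" "z' \<in> S"
        using ex by meson
      then show "x \<otimes>\<^bsub>B\<^esub> y \<otimes>\<^bsub>B\<^esub> z = x \<otimes>\<^bsub>B\<^esub> (y \<otimes>\<^bsub>B\<^esub> z)" "x \<otimes>\<^bsub>B\<^esub> y \<in> carrier B"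
          "\<one>\<^bsub>B\<^esub> \<otimes>\<^bsub>B\<^esub> x = x" "x \<otimes>\<^bsub>B\<^esub> \<one>\<^bsub>B\<^esub> = x"
        by (simp_all add: mult one cl SD A.m_assoc inB)
    qed (simp add: one inB cl)
    fix x y z
    assume "x \<in> carrier B" "y \<in> carrier B" "z \<in> carrier B"
    then obtain x' y' z' where [simp]: "x = q x'" "y = q y'" "z = q z'"
      and "x' \<in> S" "y' \<in> S" "z' \<in> S"
      using ex by meson
    then show "(x \<oplus>\<^bsub>B\<^esub> y) \<otimes>\<^bsub>B\<^esub> z = x \<otimes>\<^bsub>B\<^esub> z \<oplus>\<^bsub>B\<^esub> y \<otimes>\<^bsub>B\<^esub> z"
        "z \<otimes>\<^bsub>B\<^esub> (x \<oplus>\<^bsub>B\<^esub> y) = z \<otimes>\<^bsub>B\<^esub> x \<oplus>\<^bsub>B\<^esub> z \<otimes>\<^bsub>B\<^esub> y"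
      by (simp_all add: add mult cl SD A.l_distr A.r_distr)
  qed
  have mB: "Module.module (ring_of_type_algebra :: complex ring) B"
  proof (rule moduleI[OF cring_from_type_algebra ab], goal_cases)
    case (1 c x) then show ?case using ex[of x] by (auto simp: smult cl inB)
  next
    case (2 a b x) then show ?case
      using ex[of x] by (auto simp: smult add cl SD A.smult_left_distrib)
  next
    case (3 a x y) then show ?case
      using ex[of x] ex[of y] by (auto simp: smult add cl SD A.smult_right_distrib)
  next
    case (4 a b x) then show ?case
      using ex[of x] by (auto simp: smult cl SD A.smult_smult)
  next
    case (5 x) then show ?case
      using ex[of x] by (auto simp: smult cl SD A.one_smult)
  qed
  interpret B: ring B by fact
  have uminus: "\<ominus>\<^bsub>B\<^esub> q x = q (\<ominus>\<^bsub>A\<^esub> x)" if "x \<in> S" for x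
    using that by (intro B.minus_equality) (simp_all add: add zero cl SD inB A.l_neg)
  have minus: "q x \<ominus>\<^bsub>B\<^esub> q y = q (x \<ominus>\<^bsub>A\<^esub> y)" if "x \<in> S" "y \<in> S" for x y
    using that by (simp add: a_minus_def uminus add cl)
  have zero_norm: "cnorm B (q \<zero>\<^bsub>A\<^esub>) = 0"
    using norm_smult[of "\<zero>\<^bsub>A\<^esub>" 0] by (simp add: cl)
  have nB: "normed_group B"
  proof unfold_locales
    fix x assume "x \<in> carrier B"
    then obtain x' where [simp]: "x = q x'" and x': "x' \<in> S"
      using ex by meson
    show "0 \<le> cnorm B x"
      using x' by (simp add: norm_nonneg)
    show "cnorm B x = 0 \<longleftrightarrow> x = \<zero>\<^bsub>B\<^esub>"
      using norm_zero[OF x'] zero_norm zero by auto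
    show "cnorm B (\<ominus>\<^bsub>B\<^esub> x) = cnorm B x"
      using norm_smult[OF x', of "-1"] x' by (simp add: uminus A.uminus_eq_smult SD)
    fix y assume "y \<in> carrier B"
    then obtain y' where [simp]: "y = q y'" and y': "y' \<in> S"
      using ex by meson
    show "cnorm B (x \<oplus>\<^bsub>B\<^esub> y) \<le> cnorm B x + cnorm B y"
      using x' y' by (simp add: add norm_add)
  qed
  have cB: "Metric_space.mcomplete (carrier B) (cdist B)"
    unfolding normed_group.mcomplete_iff[OF nB]
  proof (intro allI impI, elim conjE)
    fix u :: "nat \<Rightarrow> 'b" assume u: "\<forall>n. u n \<in> carrier B"
      and cauchy: "\<forall>e>0. \<exists>N. \<forall>m\<ge>N. \<forall>n\<ge>N. cnorm B (u m \<ominus>\<^bsub>B\<^esub> u n) < e"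
    from u have "\<forall>n::nat. \<exists>x\<in>S. u n = q x"
      using ex by blast
    then obtain v where v: "\<And>n. v n \<in> S" "\<And>n. u n = q (v n)"
      by metis
    then obtain x where "x \<in> S" "(\<lambda>n. cnorm B (q (v n \<ominus>\<^bsub>A\<^esub> x))) \<longlonglongrightarrow> 0"
      using complete[of v] cauchy by (auto simp: minus)
    then show "\<exists>x\<in>carrier B. (\<lambda>n. cnorm B (u n \<ominus>\<^bsub>B\<^esub> x)) \<longlonglongrightarrow> 0"
      using v by (intro bexI[of _ "q x"]) (auto simp: minus inB)
  qed
  interpret nB: normed_group B by fact
  show ?thesis
  proof (intro unital_cstar_algebra.intro mB rB unital_cstar_algebra_axioms.intro cB, goal_cases)
    case (1 x y c) then show ?case
      using ex[of x] ex[of y] by (auto simp: smult mult cl SD A.smult_mult_left)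
  next
    case (2 x y c) then show ?case
      using ex[of x] ex[of y] by (auto simp: smult mult cl SD A.smult_mult_right)
  next
    case (3 x) then show ?case using ex[of x] by (auto simp: star cl inB)
  next
    case (4 x) then show ?case using ex[of x] by (auto simp: star cl SD A.star_star)
  next
    case (5 x y) then show ?case
      using ex[of x] ex[of y] by (auto simp: star add cl SD A.star_add)
  next
    case (6 x c) then show ?case
      using ex[of x] by (auto simp: star smult cl SD A.star_smult)
  next
    case (7 x y) then show ?case
      using ex[of x] ex[of y] by (auto simp: star mult cl SD A.star_mult)
  next
    case (8 x) then show ?case by (rule nB.norm_ge_0)
  next
    case (9 x) then show ?case by (rule nB.norm_eq_0)
  next
    case (10 x c) then show ?case
      using ex[of x] by (auto simp: smult norm_smult)
  next
    case (11 x y) then show ?case by (rule nB.norm_add)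
  next
    case (12 x y) then show ?case
      using ex[of x] ex[of y] by (auto simp: mult norm_mult)
  next
    case (13 x) then show ?case
      using ex[of x] by (auto simp: star mult cl norm_star)
  qed
qed

section \<open>Inverse square roots and continuity of homomorphisms\<close>

text \<open>The factor \<open>c\<close> allows estimates such as \<open>2 * e\<close> to be used as
  they arise; dividing by \<open>\<bar>c\<bar> + 1\<close> treats every sign of \<open>c\<close> at
  once.\<close>

lemma (in normed_group) eq_if_norm_small:
  assumes "x \<in> carrier A" "y \<in> carrier A" "\<And>e. e > 0 \<Longrightarrow> cnorm A (x \<ominus> y) \<le> c * e"
  shows "x = y"
proof -
  have "cnorm A (x \<ominus> y) \<le> 0"
  proof (rule field_le_epsilon)
    fix e :: real assume "e > 0"
    then have "cnorm A (x \<ominus> y) \<le> c * (e / (\<bar>c\<bar> + 1))"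
      by (intro assms) simp
    also have "\<dots> \<le> (\<bar>c\<bar> + 1) * (e / (\<bar>c\<bar> + 1))"
      using \<open>e > 0\<close> by (intro mult_right_mono) auto
    finally show "cnorm A (x \<ominus> y) \<le> 0 + e" by simp
  qed
  then have "cnorm A (x \<ominus> y) = 0"
    using norm_ge_0[of "x \<ominus> y"] assms by simp
  then show ?thesis
    using assms by (simp add: norm_eq_0 minus_eq_zero_iff)
qed

text \<open>Ordered rewriting with commutativity can leave \<open>x\<close> and \<open>- x\<close> several
  summands apart, where the library's cancellation rules do not see them.\<close>

lemma (in normed_group) far_cancel:
  shows "\<lbrakk>x \<in> carrier A; y \<in> carrier A\<rbrakk> \<Longrightarrow> x \<oplus> (y \<oplus> \<ominus> x) = y"
    and "\<lbrakk>x \<in> carrier A; y \<in> carrier A; z \<in> carrier A\<rbrakk> \<Longrightarrow> x \<oplus> (y \<oplus> (\<ominus> x \<oplus> z)) = y \<oplus> z"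
    and "\<lbrakk>x \<in> carrier A; y \<in> carrier A; z \<in> carrier A\<rbrakk> \<Longrightarrow> x \<oplus> (y \<oplus> (z \<oplus> \<ominus> x)) = y \<oplus> z"
    and "\<lbrakk>x \<in> carrier A; y \<in> carrier A; z \<in> carrier A; w \<in> carrier A\<rbrakk> \<Longrightarrow> x \<oplus> (y \<oplus> (z \<oplus> (\<ominus> x \<oplus> w))) = y \<oplus> (z \<oplus> w)"
    and "\<lbrakk>x \<in> carrier A; y \<in> carrier A; z \<in> carrier A; w \<in> carrier A\<rbrakk> \<Longrightarrow> x \<oplus> (y \<oplus> (z \<oplus> (w \<oplus> \<ominus> x))) = y \<oplus> (z \<oplus> w)"
    and "\<lbrakk>x \<in> carrier A; y \<in> carrier A; z \<in> carrier A; w \<in> carrier A; v \<in> carrier A\<rbrakk> \<Longrightarrow> x \<oplus> (y \<oplus> (z \<oplus> (w \<oplus> (\<ominus> x \<oplus> v)))) = y \<oplus> (z \<oplus> (w \<oplus> v))"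
    and "\<lbrakk>x \<in> carrier A; y \<in> carrier A\<rbrakk> \<Longrightarrow> \<ominus> x \<oplus> (y \<oplus> x) = y"
    and "\<lbrakk>x \<in> carrier A; y \<in> carrier A; z \<in> carrier A\<rbrakk> \<Longrightarrow> \<ominus> x \<oplus> (y \<oplus> (x \<oplus> z)) = y \<oplus> z"
    and "\<lbrakk>x \<in> carrier A; y \<in> carrier A; z \<in> carrier A\<rbrakk> \<Longrightarrow> \<ominus> x \<oplus> (y \<oplus> (z \<oplus> x)) = y \<oplus> z"
    and "\<lbrakk>x \<in> carrier A; y \<in> carrier A; z \<in> carrier A; w \<in> carrier A\<rbrakk> \<Longrightarrow> \<ominus> x \<oplus> (y \<oplus> (z \<oplus> (x \<oplus> w))) = y \<oplus> (z \<oplus> w)"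
    and "\<lbrakk>x \<in> carrier A; y \<in> carrier A; z \<in> carrier A; w \<in> carrier A\<rbrakk> \<Longrightarrow> \<ominus> x \<oplus> (y \<oplus> (z \<oplus> (w \<oplus> x))) = y \<oplus> (z \<oplus> w)"
    and "\<lbrakk>x \<in> carrier A; y \<in> carrier A; z \<in> carrier A; w \<in> carrier A; v \<in> carrier A\<rbrakk> \<Longrightarrow> \<ominus> x \<oplus> (y \<oplus> (z \<oplus> (w \<oplus> (x \<oplus> v)))) = y \<oplus> (z \<oplus> (w \<oplus> v))"
proof -
  have 1: "x \<oplus> (p \<oplus> (\<ominus> x \<oplus> q)) = p \<oplus> q" "\<ominus> x \<oplus> (p \<oplus> (x \<oplus> q)) = p \<oplus> q"
    if "x \<in> carrier A" "p \<in> carrier A" "q \<in> carrier A" for x p q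
    using that by (metis a_lcomm a_inv_closed a_closed r_neg2, metis a_lcomm a_inv_closed a_closed r_neg1)
  have 2: "x \<oplus> (p \<oplus> \<ominus> x) = p" "\<ominus> x \<oplus> (p \<oplus> x) = p" if "x \<in> carrier A" "p \<in> carrier A" for x p
    using 1[of x p "\<zero>"] that by simp_all
  show "x \<oplus> (y \<oplus> \<ominus> x) = y" if "x \<in> carrier A" "y \<in> carrier A"
    using 2[of x y] that by (simp add: a_assoc)
  show "x \<oplus> (y \<oplus> (\<ominus> x \<oplus> z)) = y \<oplus> z" if "x \<in> carrier A" "y \<in> carrier A" "z \<in> carrier A"
    using 1[of x y z] that by (simp add: a_assoc)
  show "x \<oplus> (y \<oplus> (z \<oplus> \<ominus> x)) = y \<oplus> z" if "x \<in> carrier A" "y \<in> carrier A" "z \<in> carrier A"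
    using 2[of x "y \<oplus> z"] that by (simp add: a_assoc)
  show "x \<oplus> (y \<oplus> (z \<oplus> (\<ominus> x \<oplus> w))) = y \<oplus> (z \<oplus> w)" if "x \<in> carrier A" "y \<in> carrier A" "z \<in> carrier A" "w \<in> carrier A"
    using 1[of x "y \<oplus> z" w] that by (simp add: a_assoc)
  show "x \<oplus> (y \<oplus> (z \<oplus> (w \<oplus> \<ominus> x))) = y \<oplus> (z \<oplus> w)" if "x \<in> carrier A" "y \<in> carrier A" "z \<in> carrier A" "w \<in> carrier A"
    using 2[of x "y \<oplus> (z \<oplus> w)"] that by (simp add: a_assoc)
  show "x \<oplus> (y \<oplus> (z \<oplus> (w \<oplus> (\<ominus> x \<oplus> v)))) = y \<oplus> (z \<oplus> (w \<oplus> v))" if "x \<in> carrier A" "y \<in> carrier A" "z \<in> carrier A" "w \<in> carrier A" "v \<in> carrier A"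
    using 1[of x "y \<oplus> (z \<oplus> w)" v] that by (simp add: a_assoc)
  show "\<ominus> x \<oplus> (y \<oplus> x) = y" if "x \<in> carrier A" "y \<in> carrier A"
    using 2[of x y] that by (simp add: a_assoc)
  show "\<ominus> x \<oplus> (y \<oplus> (x \<oplus> z)) = y \<oplus> z" if "x \<in> carrier A" "y \<in> carrier A" "z \<in> carrier A"
    using 1[of x y z] that by (simp add: a_assoc)
  show "\<ominus> x \<oplus> (y \<oplus> (z \<oplus> x)) = y \<oplus> z" if "x \<in> carrier A" "y \<in> carrier A" "z \<in> carrier A"
    using 2[of x "y \<oplus> z"] that by (simp add: a_assoc)
  show "\<ominus> x \<oplus> (y \<oplus> (z \<oplus> (x \<oplus> w))) = y \<oplus> (z \<oplus> w)" if "x \<in> carrier A" "y \<in> carrier A" "z \<in> carrier A" "w \<in> carrier A"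
    using 1[of x "y \<oplus> z" w] that by (simp add: a_assoc)
  show "\<ominus> x \<oplus> (y \<oplus> (z \<oplus> (w \<oplus> x))) = y \<oplus> (z \<oplus> w)" if "x \<in> carrier A" "y \<in> carrier A" "z \<in> carrier A" "w \<in> carrier A"
    using 2[of x "y \<oplus> (z \<oplus> w)"] that by (simp add: a_assoc)
  show "\<ominus> x \<oplus> (y \<oplus> (z \<oplus> (w \<oplus> (x \<oplus> v)))) = y \<oplus> (z \<oplus> (w \<oplus> v))" if "x \<in> carrier A" "y \<in> carrier A" "z \<in> carrier A" "w \<in> carrier A" "v \<in> carrier A"
    using 1[of x "y \<oplus> (z \<oplus> w)" v] that by (simp add: a_assoc)
qed

section \<open>Inverse square roots near the unit\<close>

context unital_cstar_algebra
begin

lemmas noncomm_simps = ring_simprules far_cancel smult_mult_left smult_mult_right smult_right_distrib smult_uminus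

lemma norm_le_near_one:
  assumes "a \<in> carrier A" "cnorm A (a \<ominus> \<one>) \<le> e"
  shows "cnorm A a \<le> 1 + e"
  using norm_le_minus_add[of a \<one>] norm_one_le assms by simp

text \<open>With \<open>m\<close> the midpoint of \<open>x\<close> and \<open>z\<close>, the
  deviation is \<open>(\<one> \<ominus> a) \<oplus> (\<one> \<ominus> m) \<otimes> a\<close>, of
  norm at most 1/5 + 1/5 * 6/5 = 11/25. The bound 1/2 is the contraction constant for existence and
  the absorption constant for uniqueness.\<close>

lemma norm_mult_near_one:
  assumes "a \<in> carrier A" "x \<in> carrier A" "z \<in> carrier A"
    and "cnorm A (a \<ominus> \<one>) \<le> 1/5" "cnorm A (x \<ominus> \<one>) \<le> 1/5" "cnorm A (z \<ominus> \<one>) \<le> 1/5"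
  shows "cnorm A (\<one> \<ominus> ((1/2) \<odot> (x \<oplus> z)) \<otimes> a) \<le> 1/2"
proof -
  define m where "m = (1/2) \<odot> (x \<oplus> z)"
  have m: "m \<in> carrier A" using assms by (simp add: m_def)
  have one: "\<one> = (1/2) \<odot> (\<one> \<oplus> \<one>)"
    using smult_left_distrib[of \<one> "1/2" "1/2"] by (simp add: smult_right_distrib one_smult)
  have "m \<ominus> \<one> = (1/2) \<odot> ((x \<ominus> \<one>) \<oplus> (z \<ominus> \<one>))"
  proof -
    have "m \<ominus> \<one> = (1/2) \<odot> (x \<oplus> z) \<ominus> (1/2) \<odot> (\<one> \<oplus> \<one>)"
      using one by (simp add: m_def)
    also have "\<dots> = (1/2) \<odot> ((x \<oplus> z) \<ominus> (\<one> \<oplus> \<one>))"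
      using assms by (simp add: smult_minus)
    also have "(x \<oplus> z) \<ominus> (\<one> \<oplus> \<one>) = (x \<ominus> \<one>) \<oplus> (z \<ominus> \<one>)"
      using assms by (simp add: noncomm_simps)
    finally show ?thesis .
  qed
  then have "cnorm A (m \<ominus> \<one>) \<le> 1/2 * (1/5 + 1/5)"
    using norm_add[of "x \<ominus> \<one>" "z \<ominus> \<one>"] assms by (simp add: cnorm_smult)
  then have m1: "cnorm A (\<one> \<ominus> m) \<le> 1/5"
    using m by (simp add: norm_minus_commute)
  have "cnorm A ((\<one> \<ominus> m) \<otimes> a) \<le> 1/5 * (1 + 1/5)"
    using cnorm_mult[of "\<one> \<ominus> m" a] m1 norm_le_near_one[OF assms(1,4)] m assms
    by (smt (verit, best) mult_mono norm_ge_0 minus_closed one_closed)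
  moreover have "\<one> \<ominus> m \<otimes> a = (\<one> \<ominus> a) \<oplus> (\<one> \<ominus> m) \<otimes> a"
    using m assms by (simp add: noncomm_simps)
  moreover have "cnorm A (\<one> \<ominus> a) \<le> 1/5"
    using assms by (simp add: norm_minus_commute)
  ultimately show ?thesis
    using norm_add[of "\<one> \<ominus> a" "(\<one> \<ominus> m) \<otimes> a"] m assms by (simp add: m_def)
qed

text \<open>Commutation turns the difference of the squares into
  \<open>d \<otimes> (x \<oplus> z)\<close> with \<open>d = x \<ominus> z\<close>. Hence
  \<open>d\<close> is annihilated by an element \<open>r\<close> within 1/2 of the unit, so
  \<open>d = d \<otimes> (\<one> \<ominus> r)\<close> has at most half of its own norm.\<close>

lemma inverse_sqrt_unique:
  assumes "a \<in> carrier A" "x \<in> carrier A" "z \<in> carrier A"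
    and "cnorm A (a \<ominus> \<one>) \<le> 1/5" "cnorm A (x \<ominus> \<one>) \<le> 1/5" "cnorm A (z \<ominus> \<one>) \<le> 1/5"
    and "x \<otimes> x \<otimes> a = \<one>" "z \<otimes> z \<otimes> a = \<one>" and comm: "x \<otimes> z = z \<otimes> x"
  shows "x = z"
proof -
  define d where "d = x \<ominus> z"
  have d: "d \<in> carrier A" using assms by (simp add: d_def)
  define r where "r = ((1/2) \<odot> (x \<oplus> z)) \<otimes> a"
  have r: "r \<in> carrier A" using assms by (simp add: r_def)
  have "d \<otimes> r = (1/2) \<odot> ((d \<otimes> (x \<oplus> z)) \<otimes> a)"
    using assms d by (simp add: r_def smult_mult_left smult_mult_right m_assoc)
  also have "d \<otimes> (x \<oplus> z) = x \<otimes> x \<ominus> z \<otimes> z"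
    using assms by (simp add: d_def ring_simprules)
  also have "(x \<otimes> x \<ominus> z \<otimes> z) \<otimes> a = x \<otimes> x \<otimes> a \<ominus> z \<otimes> z \<otimes> a"
    using assms(1-3) by (simp add: a_minus_def l_distr l_minus)
  also have "\<dots> = \<zero>"
    using assms by (simp add: r_neg a_minus_def)
  finally have "d \<otimes> r = \<zero>" by simp
  then have "d = d \<otimes> (\<one> \<ominus> r)"
    using d r by (simp add: a_minus_def r_distr r_minus)
  then have "cnorm A d \<le> cnorm A d * (1/2)"
    using cnorm_mult[of d "\<one> \<ominus> r"] norm_mult_near_one[OF assms(1-6)] d r norm_ge_0[OF d]
    by (smt (verit, best) mult_left_mono minus_closed one_closed r_def)
  then have "cnorm A d = 0"
    using norm_ge_0[OF d] by simp
  then show ?thesis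
    using assms by (simp add: d_def norm_eq_0 minus_eq_zero_iff)
qed

text \<open>The inverse square root is the fixed point of the contraction
  \<open>x \<mapsto> x + (1 - x\<^sup>2 a)/2\<close> on the ball of radius 1/5 around 1 in the bicommutant of \<open>a\<close>.\<close>

lemma inverse_sqrt_exists:
  assumes a: "a \<in> carrier A" and a1: "cnorm A (a \<ominus> \<one>) \<le> 1/5"
  shows "\<exists>x\<in>carrier A. cnorm A (x \<ominus> \<one>) \<le> 1/5 \<and> x \<otimes> x \<otimes> a = \<one> \<and>
    (\<forall>z\<in>carrier A. z \<otimes> a = a \<otimes> z \<longrightarrow> z \<otimes> x = x \<otimes> z)"
proof -
  define S where "S = {x\<in>carrier A. cnorm A (x \<ominus> \<one>) \<le> 1/5 \<and>
      (\<forall>z\<in>carrier A. z \<otimes> a = a \<otimes> z \<longrightarrow> z \<otimes> x = x \<otimes> z)}"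
  define F where "F x = x \<oplus> (1/2) \<odot> (\<one> \<ominus> x \<otimes> x \<otimes> a)" for x
  have SA: "S \<subseteq> carrier A" and S1: "\<one> \<in> S"
    by (auto simp: S_def a_minus_def r_neg)
  have Fc: "F x \<in> carrier A" if "x \<in> carrier A" for x
    using that a by (simp add: F_def)
  have SD: "z \<otimes> x = x \<otimes> z" if "x \<in> S" "z \<in> carrier A" "z \<otimes> a = a \<otimes> z" for x z
    using that unfolding S_def by blast
  have Sn: "cnorm A (x \<ominus> \<one>) \<le> 1/5" if "x \<in> S" for x
    using that unfolding S_def by blast
  have SI: "x \<in> S" if "x \<in> carrier A" "cnorm A (x \<ominus> \<one>) \<le> 1/5"
    "\<And>z. z \<in> carrier A \<Longrightarrow> z \<otimes> a = a \<otimes> z \<Longrightarrow> z \<otimes> x = x \<otimes> z" for x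
    using that unfolding S_def by blast
  have comm: "x \<otimes> z = z \<otimes> x" if "x \<in> S" "z \<in> S" for x z
    using SD[of z x] SD[of x a] that SA a by auto
  \<comment> \<open>The difference of two values factors through \<open>x \<ominus> z\<close> only
    because \<open>x\<close> and \<open>z\<close> commute; this is why the fixed point is sought in
    the bicommutant.\<close>
  have FF: "F x \<ominus> F z = (x \<ominus> z) \<otimes> (\<one> \<ominus> ((1/2) \<odot> (x \<oplus> z)) \<otimes> a)" if "x \<in> S" "z \<in> S" for x z
  proof -
    have xz: "x \<in> carrier A" "z \<in> carrier A" using that SA by auto
    define u where "u = (x \<otimes> x \<ominus> z \<otimes> z) \<otimes> a"
    have u: "u \<in> carrier A" using xz a by (simp add: u_def)
    have "u = (x \<ominus> z) \<otimes> (x \<oplus> z) \<otimes> a"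
      using xz a comm[OF that] by (simp add: u_def ring_simprules)
    then have "(x \<ominus> z) \<otimes> ((x \<oplus> z) \<otimes> a) = u"
      using xz a by (simp add: m_assoc)
    moreover have "p \<otimes> (\<one> \<ominus> (1/2) \<odot> q) = p \<ominus> (1/2) \<odot> (p \<otimes> q)"
      if "p \<in> carrier A" "q \<in> carrier A" for p q
      using that by (simp add: a_minus_def r_distr r_minus smult_mult_right)
    ultimately have "(x \<ominus> z) \<otimes> (\<one> \<ominus> ((1/2) \<odot> (x \<oplus> z)) \<otimes> a) = (x \<ominus> z) \<ominus> (1/2) \<odot> u"
      using xz a by (simp add: smult_mult_left)
    moreover have "F x \<ominus> F z = (x \<ominus> z) \<oplus> (1/2) \<odot> ((\<one> \<ominus> x \<otimes> x \<otimes> a) \<ominus> (\<one> \<ominus> z \<otimes> z \<otimes> a))"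
      using xz a by (simp add: F_def a_minus_def minus_add a_ac smult_right_distrib smult_uminus)
    moreover have "(\<one> \<ominus> x \<otimes> x \<otimes> a) \<ominus> (\<one> \<ominus> z \<otimes> z \<otimes> a) = \<ominus> u"
      using xz a by (simp add: u_def ring_simprules)
    ultimately show ?thesis
      using u xz by (simp add: a_minus_def smult_uminus)
  qed
  have contr: "cnorm A (F x \<ominus> F z) \<le> 1/2 * cnorm A (x \<ominus> z)" if "x \<in> S" "z \<in> S" for x z
  proof -
    have xz: "x \<in> carrier A" "z \<in> carrier A" using that SA by auto
    have "cnorm A (\<one> \<ominus> ((1/2) \<odot> (x \<oplus> z)) \<otimes> a) \<le> 1/2"
      using xz that a a1 Sn by (intro norm_mult_near_one) auto
    then show ?thesis
      using cnorm_mult[of "x \<ominus> z" "\<one> \<ominus> ((1/2) \<odot> (x \<oplus> z)) \<otimes> a"] xz a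
        mult_left_mono[of "cnorm A (\<one> \<ominus> ((1/2) \<odot> (x \<oplus> z)) \<otimes> a)" "1/2" "cnorm A (x \<ominus> z)"]
      by (simp add: FF[OF that] norm_ge_0)
  qed
  have F1: "cnorm A (F \<one> \<ominus> \<one>) \<le> 1/10"
  proof -
    have "F \<one> \<ominus> \<one> = (1/2) \<odot> (\<one> \<ominus> a)"
      using a by (simp add: F_def a_minus_def a_ac r_neg1 r_neg2 r_neg)
    then show ?thesis
      using a a1 by (simp add: cnorm_smult norm_minus_commute)
  qed
  \<comment> \<open>The radius is preserved: \<open>F x\<close> is within 1/2 * 1/5 of
    \<open>F \<one>\<close>, which is within 1/10 of \<open>\<one>\<close>, and both together give
    1/5.\<close>
  have FS: "F x \<in> S" if x: "x \<in> S" for x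
  proof -
    have xc: "x \<in> carrier A" using x SA by auto
    have "cnorm A (F x \<ominus> \<one>) \<le> cnorm A (F x \<ominus> F \<one>) + cnorm A (F \<one> \<ominus> \<one>)"
      by (intro norm_triangle_minus) (simp_all add: Fc xc)
    also have "\<dots> \<le> 1/2 * (1/5) + 1/10"
      using contr[OF x S1] Sn[OF x] F1 by simp
    finally have n: "cnorm A (F x \<ominus> \<one>) \<le> 1/5" by simp
    have "z \<otimes> F x = F x \<otimes> z" if z: "z \<in> carrier A" "z \<otimes> a = a \<otimes> z" for z
    proof -
      have zx: "z \<otimes> x = x \<otimes> z" using SD x z by blast
      have "z \<otimes> (x \<otimes> x \<otimes> a) = x \<otimes> x \<otimes> a \<otimes> z"
        using zx z xc a by (metis m_assoc m_closed)
      then show ?thesis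
        using zx z xc a
        by (simp add: F_def a_minus_def l_distr r_distr smult_mult_left smult_mult_right l_minus r_minus)
    qed
    then show ?thesis using n xc by (intro SI) (simp_all add: Fc)
  qed
  \<comment> \<open>Both conditions defining \<open>S\<close> survive norm limits, so
    \<open>S\<close> is complete and Banach's fixed point theorem applies on it.\<close>
  have clS: "closedin (norm_topology A) S"
    unfolding closedin_iff
  proof (intro conjI ballI impI)
    fix x assume x: "x \<in> carrier A" and "\<forall>e>0. \<exists>y\<in>S. cnorm A (x \<ominus> y) < e"
    then have ap: "\<exists>y\<in>S. cnorm A (x \<ominus> y) < e" if "e > 0" for e using that by blast
    have "cnorm A (x \<ominus> \<one>) \<le> 1/5"
    proof (rule field_le_epsilon)
      fix e :: real assume "e > 0"
      then obtain y where y: "y \<in> S" "cnorm A (x \<ominus> y) < e" using ap by blast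
      then show "cnorm A (x \<ominus> \<one>) \<le> 1/5 + e"
        using norm_triangle_minus[of x y \<one>] x Sn[of y] SA by auto
    qed
    moreover have "z \<otimes> x = x \<otimes> z" if z: "z \<in> carrier A" "z \<otimes> a = a \<otimes> z" for z
    proof (rule eq_if_norm_small)
      show "z \<otimes> x \<in> carrier A" "x \<otimes> z \<in> carrier A" using x z by auto
      fix e :: real assume "e > 0"
      then obtain y where y: "y \<in> S" "cnorm A (x \<ominus> y) < e" using ap by blast
      then have yc: "y \<in> carrier A" and yz: "z \<otimes> y = y \<otimes> z" using z SA SD by auto
      have "z \<otimes> x \<ominus> x \<otimes> z = z \<otimes> (x \<ominus> y) \<ominus> (x \<ominus> y) \<otimes> z"
        using x z yc yz by (simp add: noncomm_simps)
      then have "cnorm A (z \<otimes> x \<ominus> x \<otimes> z) \<le> cnorm A (z \<otimes> (x \<ominus> y)) + cnorm A ((x \<ominus> y) \<otimes> z)"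
        using norm_minus[of "z \<otimes> (x \<ominus> y)" "(x \<ominus> y) \<otimes> z"] x yc z(1) by simp
      also have "\<dots> \<le> cnorm A z * cnorm A (x \<ominus> y) + cnorm A (x \<ominus> y) * cnorm A z"
        using x yc z(1) by (intro add_mono cnorm_mult) simp_all
      also have "\<dots> \<le> cnorm A z * e + e * cnorm A z"
        using y norm_ge_0[OF z(1)] \<open>e > 0\<close> norm_ge_0[of "x \<ominus> y"] x yc
        by (intro add_mono mult_mono) auto
      finally show "cnorm A (z \<otimes> x \<ominus> x \<otimes> z) \<le> (2 * cnorm A z) * e"
        by (simp add: mult.commute)
    qed
    ultimately show "x \<in> S" using x by (intro SI) simp_all
  qed (use SA in auto)
  interpret sub: Submetric "carrier A" "cdist A" S
    using SA by unfold_locales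
  have "sub.sub.mcomplete"
    using clS complete by (simp add: sub.closedin_mcomplete_imp_mcomplete norm_topology_def)
  moreover have "cdist A (F x) (F z) \<le> 1/2 * cdist A x z" if "x \<in> S" "z \<in> S" for x z
    using contr[OF that] that SA FS by (simp add: cdist_eq subset_iff)
  ultimately obtain x where "x \<in> S" "F x = x"
    using sub.sub.Banach_fixedpoint_thm[of F "1/2"] S1 FS by auto
  moreover from this have xc: "x \<in> carrier A" using SA by auto
  moreover have "x \<otimes> x \<otimes> a = \<one>"
  proof -
    let ?h = "\<one> \<ominus> x \<otimes> x \<otimes> a"
    have "x \<oplus> (1/2) \<odot> ?h = x \<oplus> \<zero>"
      using \<open>F x = x\<close> xc by (simp add: F_def)
    then have "(1/2) \<odot> ?h = \<zero>"
      using add.l_cancel[of x "(1/2) \<odot> ?h" \<zero>] xc a by simp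
    then have "2 \<odot> ((1/2) \<odot> ?h) = \<zero>" by simp
    then have "?h = \<zero>"
      using xc a by (simp add: smult_smult one_smult)
    then show ?thesis
      using xc a by (simp add: minus_eq_zero_iff)
  qed
  ultimately show ?thesis
    using Sn SD by (intro bexI[of _ x]) blast+
qed


text \<open>The adjoint of \<open>x\<close> is another inverse square root of \<open>a\<close>,
  equally close to the unit, and commutes with \<open>x\<close> because \<open>x\<close> lies in the
  bicommutant of \<open>a\<close>. Uniqueness identifies the two.\<close>

lemma inverse_sqrt_self_adjoint:
  assumes a: "a \<in> carrier A" and sa: "star A a = a" and a1: "cnorm A (a \<ominus> \<one>) \<le> 1/5"
  shows "\<exists>x\<in>carrier A. star A x = x \<and> cnorm A (x \<ominus> \<one>) \<le> 1/5 \<and> x \<otimes> x \<otimes> a = \<one> \<and>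
    (\<forall>z\<in>carrier A. z \<otimes> a = a \<otimes> z \<longrightarrow> z \<otimes> x = x \<otimes> z)"
proof -
  obtain x where x: "x \<in> carrier A" "cnorm A (x \<ominus> \<one>) \<le> 1/5" "x \<otimes> x \<otimes> a = \<one>"
    and bicomm: "\<And>z. z \<in> carrier A \<Longrightarrow> z \<otimes> a = a \<otimes> z \<Longrightarrow> z \<otimes> x = x \<otimes> z"
    using inverse_sqrt_exists[OF a a1] by blast
  have ax: "a \<otimes> x = x \<otimes> a" using bicomm[OF a] by simp
  have sxa: "star A x \<otimes> a = a \<otimes> star A x"
    using arg_cong[OF ax, of "star A"] a x sa by (simp add: star_mult)
  have sx: "star A x = x"
  proof (rule inverse_sqrt_unique[OF a _ x(1) a1 _ x(2) _ x(3)])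
    show "star A x \<in> carrier A" using x by (simp add: star_closed)
    show "cnorm A (star A x \<ominus> \<one>) \<le> 1/5"
      using norm_star[of "x \<ominus> \<one>"] x by (simp add: star_minus)
    show "star A x \<otimes> x = x \<otimes> star A x"
      using bicomm sxa x by (simp add: star_closed)
    have "star A (x \<otimes> x \<otimes> a) = a \<otimes> (star A x \<otimes> star A x)"
      using x(1) a sa by (simp add: star_mult star_closed)
    also have "\<dots> = star A x \<otimes> star A x \<otimes> a"
      using sxa x(1) a by (metis m_assoc star_closed)
    finally show "star A x \<otimes> star A x \<otimes> a = \<one>"
      using x by simp
  qed
  show ?thesis
    using x sx bicomm by (intro bexI[of _ x]) blast+
qed

text \<open>Put \<open>a = \<one> \<ominus> j \<otimes> j\<close> and let \<open>x\<close> be its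
  inverse square root; then \<open>a \<otimes> x\<close> is a square root of \<open>a\<close>. The
  bound 1/5 on the squared norm of \<open>j\<close> is the radius within which inverse square roots
  are available.\<close>

lemma unitary_extension:
  assumes j: "j \<in> carrier A" "star A j = j" and n: "(cnorm A j)\<^sup>2 \<le> 1/5"
  shows "\<exists>k\<in>carrier A. star A k = k \<and> j \<otimes> k = k \<otimes> j \<and> j \<otimes> j \<oplus> k \<otimes> k = \<one>"
proof -
  define a where "a = \<one> \<ominus> j \<otimes> j"
  have a: "a \<in> carrier A" and sa: "star A a = a"
    using j by (simp_all add: a_def star_simps)
  have "a \<ominus> \<one> = \<ominus> (j \<otimes> j)"
    using j by (simp add: a_def noncomm_simps)
  then have a1: "cnorm A (a \<ominus> \<one>) \<le> 1/5"
    using n j by (simp add: norm_uminus norm_self_adjoint_power2)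
  obtain x where x: "x \<in> carrier A" "x \<otimes> x \<otimes> a = \<one>" and sx: "star A x = x"
    and bicomm: "\<And>z. z \<in> carrier A \<Longrightarrow> z \<otimes> a = a \<otimes> z \<Longrightarrow> z \<otimes> x = x \<otimes> z"
    using inverse_sqrt_self_adjoint[OF a sa a1] by blast
  have ax: "a \<otimes> x = x \<otimes> a" using bicomm[OF a] by simp
  have ja: "j \<otimes> a = a \<otimes> j"
    using j by (simp add: a_def noncomm_simps)
  have jx: "j \<otimes> x = x \<otimes> j" using bicomm j ja by simp
  show ?thesis
  proof (intro bexI[of _ "a \<otimes> x"] conjI)
    show "star A (a \<otimes> x) = a \<otimes> x"
      using a x by (simp add: star_mult sx sa ax)
    show "j \<otimes> (a \<otimes> x) = a \<otimes> x \<otimes> j"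
      using a x j ja jx by (metis m_assoc)
    have "(a \<otimes> x) \<otimes> (a \<otimes> x) = a \<otimes> (x \<otimes> x \<otimes> a)"
      using a x(1) ax by (metis m_assoc m_closed)
    then have "(a \<otimes> x) \<otimes> (a \<otimes> x) = a" using x a by simp
    then show "j \<otimes> j \<oplus> (a \<otimes> x) \<otimes> (a \<otimes> x) = \<one>"
      using j by (simp add: a_def noncomm_simps)
  qed (use a x in simp)
qed

lemma unitary_from_self_adjoint:
  assumes j: "j \<in> carrier A" "star A j = j" and k: "k \<in> carrier A" "star A k = k"
    and "j \<otimes> k = k \<otimes> j" "j \<otimes> j \<oplus> k \<otimes> k = \<one>"
  shows "star A (j \<oplus> \<i> \<odot> k) \<otimes> (j \<oplus> \<i> \<odot> k) = \<one>"
proof -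
  have "star A (j \<oplus> \<i> \<odot> k) = j \<ominus> \<i> \<odot> k"
    using j k by (simp add: star_simps uminus_smult a_minus_def)
  moreover have "(j \<ominus> \<i> \<odot> k) \<otimes> (j \<oplus> \<i> \<odot> k) = j \<otimes> j \<oplus> k \<otimes> k"
    using assms(1-5) by (simp add: noncomm_simps smult_smult uminus_smult one_smult)
  ultimately show ?thesis using assms by simp
qed

text \<open>Stands in for an order argument. The element
  \<open>w = j \<oplus> \<i> \<odot> k\<close> is an isometry, so its imaginary part
  \<open>k\<close> is a contraction, and \<open>\<one> \<ominus> j \<otimes> j\<close> is the square
  of \<open>k\<close>.\<close>

lemma norm_one_minus_square:
  assumes j: "j \<in> carrier A" "star A j = j" and n: "(cnorm A j)\<^sup>2 \<le> 1/5"
  shows "cnorm A (\<one> \<ominus> j \<otimes> j) \<le> 1"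
proof -
  obtain k where k: "k \<in> carrier A" "star A k = k" "j \<otimes> k = k \<otimes> j" "j \<otimes> j \<oplus> k \<otimes> k = \<one>"
    using unitary_extension[OF assms] by blast
  define w where "w = j \<oplus> \<i> \<odot> k"
  have w: "w \<in> carrier A" and sw: "star A w = j \<ominus> \<i> \<odot> k"
    using j k by (simp_all add: w_def star_simps uminus_smult a_minus_def)
  have "cnorm A w \<le> 1"
    using unitary_from_self_adjoint[OF j k] w by (intro norm_isometry_le_one) (simp_all add: w_def)
  moreover have "k = (-\<i>/2) \<odot> (w \<ominus> star A w)"
  proof -
    have "w \<ominus> star A w = \<i> \<odot> k \<oplus> \<i> \<odot> k"
      using j k unfolding sw by (simp add: w_def noncomm_simps)
    also have "\<dots> = (2*\<i>) \<odot> k"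
      using smult_left_distrib[OF k(1), of \<i> \<i>] by simp
    finally show ?thesis
      using k by (simp add: smult_smult one_smult)
  qed
  ultimately have "cnorm A k \<le> 1/2 * (1 + 1)"
    using norm_minus[of w "star A w"] w by (simp add: cnorm_smult norm_star star_closed norm_divide)
  moreover have "\<one> \<ominus> j \<otimes> j = k \<otimes> k"
    using j k(1) by (subst k(4)[symmetric]) (simp add: noncomm_simps)
  ultimately show ?thesis
    using norm_self_adjoint_power2[OF k(1,2)] k by (simp add: power_le_one norm_ge_0)
qed

end

section \<open>Contractivity of unital star-homomorphisms\<close>

context star_hom
begin

text \<open>A small self-adjoint element is the real part of an isometry, and a unital homomorphism
  sends isometries to isometries, hence to contractions. This gives boundedness without the spectral
  radius.\<close>

lemma hom_bounded_small:
  assumes j: "j \<in> carrier A" "star A j = j" and n: "(cnorm A j)\<^sup>2 \<le> 1/5"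
  shows "cnorm B (f j) \<le> 1"
proof -
  obtain k where k: "k \<in> carrier A" "star A k = k" "j \<otimes>\<^bsub>A\<^esub> k = k \<otimes>\<^bsub>A\<^esub> j"
      "j \<otimes>\<^bsub>A\<^esub> j \<oplus>\<^bsub>A\<^esub> k \<otimes>\<^bsub>A\<^esub> k = \<one>\<^bsub>A\<^esub>"
    using A.unitary_extension[OF assms] by blast
  define w where "w = j \<oplus>\<^bsub>A\<^esub> \<i> \<odot>\<^bsub>A\<^esub> k"
  have w: "w \<in> carrier A" and sw: "star A w = j \<ominus>\<^bsub>A\<^esub> \<i> \<odot>\<^bsub>A\<^esub> k"
    using j k by (simp_all add: w_def A.star_simps A.uminus_smult a_minus_def)
  have "star A w \<otimes>\<^bsub>A\<^esub> w = \<one>\<^bsub>A\<^esub>"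
    using A.unitary_from_self_adjoint[OF j k] by (simp add: w_def)
  then have "star B (f w) \<otimes>\<^bsub>B\<^esub> f w = \<one>\<^bsub>B\<^esub>"
    using w by (simp flip: hom_star hom_mult add: A.star_closed)
  then have fw: "cnorm B (f w) \<le> 1"
    using w by (intro B.norm_isometry_le_one) simp_all
  have "w \<oplus>\<^bsub>A\<^esub> star A w = j \<oplus>\<^bsub>A\<^esub> j"
    using j k unfolding sw by (simp add: w_def A.noncomm_simps)
  also have "\<dots> = 2 \<odot>\<^bsub>A\<^esub> j"
    using A.smult_left_distrib[OF j(1), of 1 1] j by (simp add: A.one_smult)
  finally have "j = (1/2) \<odot>\<^bsub>A\<^esub> (w \<oplus>\<^bsub>A\<^esub> star A w)"
    using j by (simp add: A.smult_smult A.one_smult)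
  then have "f j = (1/2) \<odot>\<^bsub>B\<^esub> (f w \<oplus>\<^bsub>B\<^esub> star B (f w))"
    using w by (simp add: hom_smult hom_add hom_star A.star_closed)
  then have "cnorm B (f j) \<le> 1/2 * (1 + 1)"
    using B.norm_add[of "f w" "star B (f w)"] w fw
    by (simp add: B.cnorm_smult B.norm_star B.star_closed)
  then show ?thesis by simp
qed

lemma hom_bounded_self_adjoint:
  assumes x: "x \<in> carrier A" "star A x = x"
  shows "cnorm B (f x) \<le> 3 * cnorm A x"
proof (cases "cnorm A x = 0")
  case True
  then show ?thesis using x by (simp add: A.norm_eq_0)
next
  case False
  then have pos: "cnorm A x > 0" using A.norm_ge_0[OF x(1)] by simp
  \<comment> \<open>Scales \<open>x\<close> to norm 1/3, whose square 1/9 is below the admissible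
    1/5; the constant 3 is the price.\<close>
  define c where "c = 1 / (3 * cnorm A x)"
  have c: "c > 0" "c * cnorm A x = 1/3" using pos by (simp_all add: c_def)
  have n: "cnorm A (c \<odot>\<^bsub>A\<^esub> x) = 1/3"
    using x c by (simp add: A.cnorm_smult)
  have "cnorm B (f (c \<odot>\<^bsub>A\<^esub> x)) \<le> 1"
    using x by (intro hom_bounded_small) (simp_all add: A.star_smult n power2_eq_square)
  then have "c * cnorm B (f x) \<le> 1"
    using x c by (simp add: hom_smult B.cnorm_smult)
  then show ?thesis
    using pos by (simp add: c_def field_simps)
qed

text \<open>Squaring a self-adjoint element squares its norm on both sides, so the exponent doubles
  while the constant 3 stays put.\<close>

lemma hom_power_bound:
  "\<lbrakk>x \<in> carrier A; star A x = x\<rbrakk> \<Longrightarrow> cnorm B (f x) ^ (2^n) \<le> 3 * cnorm A x ^ (2^n)"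
proof (induction n arbitrary: x)
  case 0
  then show ?case using hom_bounded_self_adjoint by simp
next
  case (Suc n)
  then have "cnorm B (f (x \<otimes>\<^bsub>A\<^esub> x)) ^ (2^n) \<le> 3 * cnorm A (x \<otimes>\<^bsub>A\<^esub> x) ^ (2^n)"
    by (intro Suc.IH) (simp_all add: A.star_mult)
  moreover have "cnorm B (f (x \<otimes>\<^bsub>A\<^esub> x)) = (cnorm B (f x))\<^sup>2"
    using Suc.prems hom_star[of x] by (simp add: hom_mult B.norm_self_adjoint_power2)
  ultimately show ?case
    using Suc.prems by (simp add: A.norm_self_adjoint_power2 flip: power_mult)
qed

text \<open>If the ratio of the two norms exceeded 1, its powers would outgrow the uniform bound 3
  of \<open>hom_power_bound\<close>.\<close>

lemma hom_contractive_self_adjoint: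
  assumes x: "x \<in> carrier A" "star A x = x"
  shows "cnorm B (f x) \<le> cnorm A x"
proof (cases "cnorm A x = 0")
  case True
  then show ?thesis using x by (simp add: A.norm_eq_0)
next
  case False
  then have pos: "cnorm A x > 0" using A.norm_ge_0[OF x(1)] by simp
  show ?thesis
  proof (rule ccontr)
    assume "\<not> ?thesis"
    then have r: "1 < cnorm B (f x) / cnorm A x" using pos by simp
    then obtain n where "3 < (cnorm B (f x) / cnorm A x) ^ n"
      using real_arch_pow by blast
    also have "\<dots> \<le> (cnorm B (f x) / cnorm A x) ^ (2 ^ n)"
      using r by (intro power_increasing) (auto intro: less_imp_le)
    also have "\<dots> \<le> 3"
      using hom_power_bound[OF x, of n] pos by (simp add: power_divide divide_le_eq)
    finally show False by simp
  qed
qed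

lemma hom_contractive:
  assumes x: "x \<in> carrier A"
  shows "cnorm B (f x) \<le> cnorm A x"
proof (rule power2_le_imp_le)
  have "(cnorm B (f x))\<^sup>2 = cnorm B (f (star A x \<otimes>\<^bsub>A\<^esub> x))"
    using x B.cstar_identity[of "f x"] by (simp add: hom_mult hom_star A.star_closed)
  also have "\<dots> \<le> cnorm A (star A x \<otimes>\<^bsub>A\<^esub> x)"
    using x by (intro hom_contractive_self_adjoint) (simp_all add: A.star_simps)
  also have "\<dots> = (cnorm A x)\<^sup>2"
    using x by (rule A.cstar_identity)
  finally show "(cnorm B (f x))\<^sup>2 \<le> (cnorm A x)\<^sup>2" .
qed (use x A.norm_ge_0 in simp)

lemma hom_dist: "\<lbrakk>x \<in> carrier A; y \<in> carrier A\<rbrakk> \<Longrightarrow> cnorm B (f x \<ominus>\<^bsub>B\<^esub> f y) \<le> cnorm A (x \<ominus>\<^bsub>A\<^esub> y)"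
  using hom_contractive[of "x \<ominus>\<^bsub>A\<^esub> y"] by (simp add: hom_minus)

end

text \<open>The set where both maps agree is a unital star-subalgebra, norm closed because
  homomorphisms are contractive.\<close>

lemma star_hom_eqI:
  assumes f: "star_hom A B f" and g: "star_hom A B g"
    and gen: "\<And>S. unital_cstar_subalgebra S A \<Longrightarrow> range s \<subseteq> S \<Longrightarrow> S = carrier A"
    and s: "\<And>j. s j \<in> carrier A" "\<And>j. f (s j) = g (s j)"
    and x: "x \<in> carrier A"
  shows "f x = g x"
proof -
  interpret f: star_hom A B f by fact
  interpret g: star_hom A B g by fact
  define S where "S = {x \<in> carrier A. f x = g x}"
  have "unital_cstar_subalgebra S A"
    unfolding unital_cstar_subalgebra_def
  proof (intro conjI ballI allI)
    show "subring S A"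
      by (rule f.A.subringI)
        (auto simp: S_def f.hom_uminus g.hom_uminus f.hom_add g.hom_add f.hom_mult g.hom_mult)
    show "closedin (norm_topology A) S"
      unfolding f.A.closedin_iff
    proof (intro conjI ballI impI)
      fix x assume x: "x \<in> carrier A" and ap: "\<forall>e>0. \<exists>y\<in>S. cnorm A (x \<ominus>\<^bsub>A\<^esub> y) < e"
      have "f x = g x"
      proof (rule f.B.eq_if_norm_small)
        fix e :: real assume "e > 0"
        then obtain y where y: "y \<in> carrier A" "f y = g y" "cnorm A (x \<ominus>\<^bsub>A\<^esub> y) < e"
          using ap by (auto simp: S_def)
        then have "cnorm B (f x \<ominus>\<^bsub>B\<^esub> g x) \<le> cnorm B (f x \<ominus>\<^bsub>B\<^esub> f y) + cnorm B (g x \<ominus>\<^bsub>B\<^esub> g y)"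
          using f.B.norm_triangle_minus[of "f x" "f y" "g x"] x
          by (simp add: f.B.norm_minus_commute[of "g x" "g y"])
        then show "cnorm B (f x \<ominus>\<^bsub>B\<^esub> g x) \<le> 2 * e"
          using f.hom_dist[OF x y(1)] g.hom_dist[OF x y(1)] y(3) by simp
      qed (use x in auto)
      then show "x \<in> S" using x by (simp add: S_def)
    qed (auto simp: S_def)
  qed (auto simp: S_def f.hom_smult g.hom_smult f.hom_star g.hom_star f.A.star_closed)
  then have "S = carrier A"
    using s by (intro gen) (auto simp: S_def)
  then show ?thesis using x by (auto simp: S_def)
qed

section \<open>Quotients by closed ideals\<close>

text \<open>The witness is the mean of the first \<open>n\<close> powers of \<open>a = 1 - h\<^sup>2\<close>, where \<open>h\<close> is a small multiple
  of \<open>j\<close>: then \<open>h\<^sup>2 u\<close> telescopes to \<open>(1 - a\<^sup>n) / n\<close>, and \<open>a\<close> is a contraction.\<close>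

lemma (in unital_cstar_algebra) ideal_approximate_unit:
  assumes "ideal I A" and j: "j \<in> I" "star A j = j" and "e > 0"
  shows "\<exists>u\<in>carrier A. star A u = u \<and> cnorm A u \<le> 1 \<and> \<one> \<ominus> u \<in> I \<and> cnorm A (j \<otimes> u) \<le> e"
proof -
  interpret I: ideal I A by fact
  have jc: "j \<in> carrier A" using j I.a_subset by auto
  have I_smult: "c \<odot> x \<in> I" if "x \<in> I" for x c
  proof -
    have "c \<odot> x = (c \<odot> \<one>) \<otimes> x"
      using that I.a_subset by (simp add: smult_mult_left subset_iff)
    then show ?thesis using that by (simp add: I.I_l_closed)
  qed
  \<comment> \<open>Brings the norm of \<open>h\<close> down to at most 1/3, so that
    \<open>a\<close> below is a contraction by \<open>norm_one_minus_square\<close>.\<close>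
  define c where "c = 1 / (3 * (cnorm A j + 1))"
  have c: "c > 0" using norm_ge_0[OF jc] by (simp add: c_def)
  define h where "h = c \<odot> j"
  have h: "h \<in> carrier A" "star A h = h" "h \<in> I"
    using jc j I_smult by (simp_all add: h_def star_smult)
  have "cnorm A h \<le> 1/3"
    using jc c norm_ge_0[OF jc] by (simp add: h_def cnorm_smult) (simp add: c_def field_simps)
  then have "(cnorm A h)\<^sup>2 \<le> (1/3)\<^sup>2"
    using norm_ge_0 h by (intro power_mono) auto
  then have h8: "(cnorm A h)\<^sup>2 \<le> 1/5"
    by (simp add: power2_eq_square)
  define a where "a = \<one> \<ominus> h \<otimes> h"
  have a: "a \<in> carrier A" "star A a = a" using h by (simp_all add: a_def star_simps)
  have na: "cnorm A a \<le> 1"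
    using norm_one_minus_square[OF h(1,2) h8] by (simp add: a_def)
  have ah: "a \<otimes> (h \<otimes> h) = h \<otimes> h \<otimes> a" using h by (simp add: a_def noncomm_simps)
  \<comment> \<open>\<open>T n\<close> is the sum of the powers of \<open>a\<close> with exponents
    below \<open>n\<close>, and \<open>p n\<close> further down is the power with exponent
    \<open>n\<close>.\<close>
  define T where "T = rec_nat \<zero> (\<lambda>n t. \<one> \<oplus> a \<otimes> t)"
  have T: "T 0 = \<zero>" "\<And>n. T (Suc n) = \<one> \<oplus> a \<otimes> T n" by (simp_all add: T_def)
  have Tc [simp]: "T n \<in> carrier A" for n
    by (induction n) (use a in \<open>simp_all add: T\<close>)
  have Ta: "T n \<otimes> a = a \<otimes> T n" for n
    by (induction n) (use a in \<open>simp_all add: T l_distr r_distr m_assoc\<close>)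
  have sT: "star A (T n) = T n" for n
    by (induction n) (use a in \<open>simp_all add: T star_add star_mult Ta\<close>)
  have nT: "cnorm A (T n) \<le> n" for n
  proof (induction n)
    case (Suc n)
    have "cnorm A (a \<otimes> T n) \<le> cnorm A a * cnorm A (T n)"
      using a by (intro cnorm_mult) auto
    also have "\<dots> \<le> 1 * real n"
      using Suc na norm_ge_0 a by (intro mult_mono) auto
    finally show ?case
      using norm_add[of \<one> "a \<otimes> T n"] norm_one_le a by (simp add: T)
  qed (simp add: T)
  define p where "p = rec_nat \<one> (\<lambda>n t. a \<otimes> t)"
  have p: "p 0 = \<one>" "\<And>n. p (Suc n) = a \<otimes> p n" by (simp_all add: p_def)
  have pc [simp]: "p n \<in> carrier A" for n
    by (induction n) (use a in \<open>simp_all add: p\<close>)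
  have np: "cnorm A (p n) \<le> 1" for n
  proof (induction n)
    case (Suc n)
    have "cnorm A (a \<otimes> p n) \<le> cnorm A a * cnorm A (p n)"
      using a by (intro cnorm_mult) auto
    also have "\<dots> \<le> 1 * 1"
      using Suc na norm_ge_0 a by (intro mult_mono) auto
    finally show ?case by (simp add: p)
  qed (simp add: p norm_one_le)
  \<comment> \<open>The geometric sum telescopes because \<open>h \<otimes> h\<close> is
    \<open>\<one> \<ominus> a\<close>.\<close>
  have hT: "h \<otimes> h \<otimes> T n = \<one> \<ominus> p n" for n
  proof (induction n)
    case (Suc n)
    have "h \<otimes> h \<otimes> T (Suc n) = h \<otimes> h \<oplus> (h \<otimes> h \<otimes> a) \<otimes> T n"
      using h(1) a by (simp add: T r_distr m_assoc)
    also have "(h \<otimes> h \<otimes> a) \<otimes> T n = a \<otimes> (h \<otimes> h \<otimes> T n)"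
      using h(1) a by (simp add: m_assoc flip: ah)
    also have "\<dots> = a \<ominus> a \<otimes> p n"
      using a unfolding Suc by (simp add: a_minus_def r_distr r_minus)
    also have "h \<otimes> h \<oplus> (a \<ominus> a \<otimes> p n) = (h \<otimes> h \<oplus> a) \<ominus> a \<otimes> p n"
      using a h by (simp add: a_minus_def a_assoc)
    also have "h \<otimes> h \<oplus> a = \<one>"
      using h by (simp add: a_def noncomm_simps)
    finally show ?case by (simp add: p)
  qed (use h in \<open>simp add: T p a_minus_def r_neg\<close>)
  \<comment> \<open>Modulo \<open>I\<close> the element \<open>a\<close> is the unit, so
    \<open>T n\<close> is congruent to \<open>n\<close> times the unit and its mean \<open>u\<close>
    to the unit itself.\<close>
  have TI: "of_nat n \<odot> \<one> \<ominus> T n \<in> I" for n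
  proof (induction n)
    case (Suc n)
    have "of_nat (Suc n) \<odot> \<one> \<ominus> T (Suc n) = (of_nat n \<odot> \<one> \<ominus> T n) \<oplus> h \<otimes> (h \<otimes> T n)"
      using h(1) by (simp add: T a_def smult_left_distrib one_smult noncomm_simps)
    moreover have "h \<otimes> (h \<otimes> T n) \<in> I"
      using h by (intro I.I_r_closed) auto
    ultimately show ?case using Suc by (simp add: I.a_closed)
  qed (simp add: T a_minus_def I.zero_closed)
  \<comment> \<open>Makes 2/n at most the square of \<open>c * e\<close>. The square comes from the
    C*-identity for \<open>h \<otimes> u\<close>, whose squared norm is at most that of
    \<open>h \<otimes> h \<otimes> u\<close>; the factor \<open>c\<close> from passing between
    \<open>h\<close> and \<open>j\<close>.\<close>
  obtain n :: nat where n: "real n > 2 / (c * e)\<^sup>2"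
    using reals_Archimedean2 by blast
  have n0: "n > 0"
    using n c \<open>e > 0\<close> by (metis divide_pos_pos gr0I less_asym mult_pos_pos of_nat_0 zero_less_numeral zero_less_power)
  define u where "u = (1 / of_nat n) \<odot> T n"
  have uc: "u \<in> carrier A" and su: "star A u = u"
    by (simp_all add: u_def star_smult sT)
  have nu: "cnorm A u \<le> 1"
    using nT[of n] n0 by (simp add: u_def cnorm_smult norm_divide)
  have uI: "\<one> \<ominus> u \<in> I"
  proof -
    have "\<one> \<ominus> u = (1 / of_nat n) \<odot> (of_nat n \<odot> \<one> \<ominus> T n)"
      using n0 by (simp add: u_def smult_minus smult_smult one_smult)
    then show ?thesis using TI I_smult by simp
  qed
  have "(cnorm A (h \<otimes> u))\<^sup>2 = cnorm A (u \<otimes> (h \<otimes> h \<otimes> u))"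
    using cstar_identity[of "h \<otimes> u"] h uc su by (simp add: star_mult m_assoc)
  also have "\<dots> \<le> cnorm A u * cnorm A (h \<otimes> h \<otimes> u)"
    using h uc by (intro cnorm_mult) auto
  also have "\<dots> \<le> 1 * cnorm A (h \<otimes> h \<otimes> u)"
    using h uc nu norm_ge_0 by (intro mult_right_mono) auto
  also have "h \<otimes> h \<otimes> u = (1 / of_nat n) \<odot> (\<one> \<ominus> p n)"
    using h by (simp add: u_def smult_mult_right hT)
  also have "1 * cnorm A \<dots> \<le> 1 / n * 2"
    using norm_minus[of \<one> "p n"] norm_one_le np[of n] n0
    by (simp add: cnorm_smult norm_divide divide_right_mono)
  also have "\<dots> \<le> (c * e)\<^sup>2"
    using n n0 c \<open>e > 0\<close> by (simp add: field_simps)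
  finally have "cnorm A (h \<otimes> u) \<le> c * e"
    by (rule power2_le_imp_le) (use c \<open>e > 0\<close> in simp)
  moreover have "cnorm A (h \<otimes> u) = c * cnorm A (j \<otimes> u)"
    using jc uc c by (simp add: h_def smult_mult_left cnorm_smult)
  ultimately have "cnorm A (j \<otimes> u) \<le> e" using c by simp
  then show ?thesis using uc su nu uI by blast
qed

lemma (in unital_cstar_algebra) geometric_limit:
  fixes w :: "nat \<Rightarrow> 'a"
  assumes w: "\<And>k. w k \<in> carrier A" and step: "\<And>k. cnorm A (w (Suc k) \<ominus> w k) \<le> (1/2)^k"
  shows "\<exists>x\<in>carrier A. (\<lambda>n. cnorm A (w n \<ominus> x)) \<longlonglongrightarrow> 0"
proof -
  have far: "cnorm A (w (k + p) \<ominus> w k) \<le> 2 * (1/2)^k - 2 * (1/2)^(k+p)" for k p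
  proof (induction p)
    case (Suc p)
    have "cnorm A (w (k + Suc p) \<ominus> w k) \<le> cnorm A (w (Suc (k + p)) \<ominus> w (k + p)) + cnorm A (w (k + p) \<ominus> w k)"
      using norm_triangle_minus[of "w (Suc (k+p))" "w (k+p)" "w k"] w by simp
    also have "\<dots> \<le> (1/2)^(k+p) + (2 * (1/2)^k - 2 * (1/2)^(k+p))"
      using Suc step[of "k+p"] by linarith
    finally show ?case by simp
  qed (simp add: w a_minus_def r_neg)
  have far2: "cnorm A (w m \<ominus> w k) \<le> 2 * (1/2)^k" if "m \<ge> k" for m k
  proof -
    have "cnorm A (w m \<ominus> w k) \<le> 2 * (1/2)^k - 2 * (1/2)^m"
      using far[of k "m - k"] that by simp
    also have "\<dots> \<le> 2 * (1/2)^k" by simp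
    finally show ?thesis .
  qed
  have small: "\<exists>k. (1/2::real)^k < e" if "e > 0" for e
    using real_arch_pow_inv[of e "1/2"] that by auto
  show "\<exists>x\<in>carrier A. (\<lambda>n. cnorm A (w n \<ominus> x)) \<longlonglongrightarrow> 0"
  proof (rule complete_seq)
    fix e :: real assume "e > 0"
    then obtain k where k: "(1/2::real)^k < e/4" using small[of "e/4"] by auto
    have "cnorm A (w m \<ominus> w n) < e" if "m \<ge> k" "n \<ge> k" for m n
      using norm_triangle_minus[of "w m" "w k" "w n"] far2[of k m] far2[of k n] that w
        norm_minus_commute[of "w k" "w n"] k by simp
    then show "\<exists>N. \<forall>m\<ge>N. \<forall>n\<ge>N. cnorm A (w m \<ominus> w n) < e" by blast
  qed (rule w)
qed

section \<open>Cosets and the quotient norm\<close>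

locale cstar_ideal = unital_cstar_algebra A for A :: "'a cstar" (structure) +
  fixes I :: "'a set"
  assumes closed_ideal: "closed_ideal I A"
begin

sublocale ideal I A
  using closed_ideal by (simp add: closed_ideal_def)

abbreviation Q where "Q \<equiv> cstar_quotient A I"

lemma I_carrier: "x \<in> I \<Longrightarrow> x \<in> carrier A"
  using a_subset by blast

lemma I_smult: "x \<in> I \<Longrightarrow> c \<odot> x \<in> I"
  using I_l_closed[of x "c \<odot> \<one>"] I_carrier[of x] by (simp add: smult_mult_left)

lemma I_uminus: "x \<in> I \<Longrightarrow> \<ominus> x \<in> I"
  using I_smult[of x "-1"] I_carrier[of x] by (simp add: uminus_eq_smult)

lemma I_closed:
  assumes "x \<in> carrier A" "\<And>e. e > 0 \<Longrightarrow> \<exists>y\<in>I. cnorm A (x \<ominus> y) < e"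
  shows "x \<in> I"
  using closed_ideal assms by (simp add: closed_ideal_def closedin_iff)

text \<open>Closure under the adjoint is not part of the definition of an ideal. Although
  \<open>x\<close> itself need not be self-adjoint, \<open>star A x \<otimes> x\<close> is, and lies
  in \<open>I\<close>, so there is \<open>u\<close> congruent to the unit with
  \<open>star A x \<otimes> x \<otimes> u\<close> small. Then \<open>x \<otimes> u\<close> is small,
  hence so is its adjoint \<open>u \<otimes> star A x\<close>, and
  \<open>(\<one> \<ominus> u) \<otimes> star A x\<close> is an element of \<open>I\<close>
  approximating \<open>star A x\<close>.\<close>

lemma I_star:
  assumes x: "x \<in> I"
  shows "star A x \<in> I"
proof (rule I_closed)
  have xc: "x \<in> carrier A" using I_carrier x .
  then show sx: "star A x \<in> carrier A" by (rule star_closed)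
  fix e :: real assume "e > 0"
  obtain u where u: "u \<in> carrier A" "star A u = u" "cnorm A u \<le> 1" "\<one> \<ominus> u \<in> I"
    and le: "cnorm A (star A x \<otimes> x \<otimes> u) \<le> (e/2)\<^sup>2"
    using ideal_approximate_unit[OF ideal_axioms, of "star A x \<otimes> x" "(e/2)\<^sup>2"] \<open>e > 0\<close> xc x
    by (auto simp: star_simps I_l_closed)
  have "(cnorm A (x \<otimes> u))\<^sup>2 = cnorm A (u \<otimes> (star A x \<otimes> x \<otimes> u))"
    using cstar_identity[of "x \<otimes> u"] xc u(1,2) by (simp add: star_simps m_assoc)
  also have "\<dots> \<le> cnorm A u * cnorm A (star A x \<otimes> x \<otimes> u)"
    using xc sx u by (intro cnorm_mult) auto
  also have "\<dots> \<le> 1 * (e/2)\<^sup>2"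
    using xc sx u le norm_ge_0 by (intro mult_mono) auto
  finally have "(cnorm A (x \<otimes> u))\<^sup>2 \<le> (e/2)\<^sup>2" by simp
  then have "cnorm A (x \<otimes> u) \<le> e/2"
    by (rule power2_le_imp_le) (use \<open>e > 0\<close> in simp)
  moreover have "cnorm A (u \<otimes> star A x) = cnorm A (x \<otimes> u)"
    using norm_star[of "x \<otimes> u"] xc u by (simp add: star_mult)
  moreover have "star A x \<ominus> (\<one> \<ominus> u) \<otimes> star A x = u \<otimes> star A x"
    using sx u(1) by (simp add: noncomm_simps)
  ultimately have "cnorm A (star A x \<ominus> (\<one> \<ominus> u) \<otimes> star A x) < e"
    using \<open>e > 0\<close> by simp
  moreover have "(\<one> \<ominus> u) \<otimes> star A x \<in> I"
    using u sx by (intro I_r_closed) auto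
  ultimately show "\<exists>y\<in>I. cnorm A (star A x \<ominus> y) < e" by blast
qed

lemma mem_coset_iff:
  assumes "x \<in> carrier A"
  shows "y \<in> I +> x \<longleftrightarrow> y \<in> carrier A \<and> y \<ominus> x \<in> I"
proof
  assume "y \<in> I +> x"
  then obtain i where "i \<in> I" "y = i \<oplus> x" by (auto simp: a_r_coset_def')
  then show "y \<in> carrier A \<and> y \<ominus> x \<in> I"
    using assms I_carrier by (simp add: a_minus_def a_assoc r_neg)
next
  assume "y \<in> carrier A \<and> y \<ominus> x \<in> I"
  then show "y \<in> I +> x"
    using assms by (auto simp: a_r_coset_def' minus_add_cancel intro!: bexI[of _ "y \<ominus> x"])
qed

lemma coset_self: "x \<in> carrier A \<Longrightarrow> x \<in> I +> x"
  by (simp add: mem_coset_iff a_minus_def r_neg)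

lemma coset_eq_iff:
  assumes "x \<in> carrier A" "y \<in> carrier A"
  shows "I +> x = I +> y \<longleftrightarrow> x \<ominus> y \<in> I"
proof
  assume "I +> x = I +> y"
  then show "x \<ominus> y \<in> I" using coset_self[of x] assms by (simp add: mem_coset_iff)
next
  assume "x \<ominus> y \<in> I"
  then have "x \<in> I +> y" using assms by (simp add: mem_coset_iff)
  then show "I +> x = I +> y" using assms by (metis a_repr_independence')
qed

lemma coset_zero: "I +> \<zero> = I"
  using a_subset by (simp add: a_coset_add_zero)

lemma coset_zero_iff: "x \<in> carrier A \<Longrightarrow> I +> x = I \<longleftrightarrow> x \<in> I"
  using coset_eq_iff[of x \<zero>] by (simp add: coset_zero a_minus_def)

lemma Q_carrier: "carrier Q = (\<lambda>x. I +> x) ` carrier A"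
  by (auto simp: cstar_quotient_def FactRing_def A_RCOSETS_def')

lemma Q_add: "\<lbrakk>x \<in> carrier A; y \<in> carrier A\<rbrakk> \<Longrightarrow> (I +> x) \<oplus>\<^bsub>Q\<^esub> (I +> y) = I +> (x \<oplus> y)"
  using ring_hom_add[OF rcos_ring_hom] by (simp add: cstar_quotient_def)

lemma Q_mult: "\<lbrakk>x \<in> carrier A; y \<in> carrier A\<rbrakk> \<Longrightarrow> (I +> x) \<otimes>\<^bsub>Q\<^esub> (I +> y) = I +> (x \<otimes> y)"
  using ring_hom_mult[OF rcos_ring_hom] by (simp add: cstar_quotient_def)

lemma Q_one: "\<one>\<^bsub>Q\<^esub> = I +> \<one>"
  using ring_hom_one[OF rcos_ring_hom] by (simp add: cstar_quotient_def)

lemma Q_zero: "\<zero>\<^bsub>Q\<^esub> = I +> \<zero>"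
  by (simp add: cstar_quotient_def FactRing_def coset_zero)

lemma Q_smult:
  assumes x: "x \<in> carrier A"
  shows "c \<odot>\<^bsub>Q\<^esub> (I +> x) = I +> (c \<odot> x)"
proof -
  have "set_add A I ((\<odot>) c ` (I +> x)) = I +> (c \<odot> x)"
  proof (intro equalityI subsetI)
    fix y assume "y \<in> set_add A I ((\<odot>) c ` (I +> x))"
    then obtain i i' where i: "i \<in> I" "i' \<in> I" "y = i \<oplus> c \<odot> (i' \<oplus> x)"
      by (auto simp: set_add_def' a_r_coset_def')
    then have "y = (i \<oplus> c \<odot> i') \<oplus> c \<odot> x"
      using x I_carrier by (simp add: smult_right_distrib a_assoc)
    moreover have "i \<oplus> c \<odot> i' \<in> I" using i I_smult by (simp add: a_closed)
    ultimately show "y \<in> I +> (c \<odot> x)" by (auto simp: a_r_coset_def')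
  next
    fix y assume "y \<in> I +> (c \<odot> x)"
    then obtain i where "i \<in> I" "y = i \<oplus> c \<odot> x" by (auto simp: a_r_coset_def')
    then show "y \<in> set_add A I ((\<odot>) c ` (I +> x))"
      using coset_self[OF x] by (auto simp: set_add_def')
  qed
  then show ?thesis by (simp add: cstar_quotient_def)
qed

lemma Q_star:
  assumes x: "x \<in> carrier A"
  shows "star Q (I +> x) = I +> star A x"
proof -
  have "star A ` (I +> x) = I +> star A x"
  proof (intro equalityI subsetI)
    fix y assume "y \<in> star A ` (I +> x)"
    then obtain z where z: "z \<in> carrier A" "z \<ominus> x \<in> I" "y = star A z"
      using x by (auto simp: mem_coset_iff)
    then show "y \<in> I +> star A x"
      using x I_star[of "z \<ominus> x"] by (simp add: mem_coset_iff star_simps)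
  next
    fix y assume "y \<in> I +> star A x"
    then have y: "y \<in> carrier A" "y \<ominus> star A x \<in> I"
      using x by (simp_all add: mem_coset_iff star_closed)
    then have "star A y \<in> I +> x"
      using x I_star[of "y \<ominus> star A x"] by (simp add: mem_coset_iff star_simps)
    then show "y \<in> star A ` (I +> x)"
      using y by (intro image_eqI[of _ _ "star A y"]) (simp_all add: star_star)
  qed
  then show ?thesis by (simp add: cstar_quotient_def)
qed

lemma Q_norm: "cnorm Q (I +> x) = (INF y\<in>I +> x. cnorm A y)"
  by (simp add: cstar_quotient_def)

lemma Q_norm_le:
  assumes "x \<in> carrier A" "y \<in> I +> x"
  shows "cnorm Q (I +> x) \<le> cnorm A y"
  unfolding Q_norm
proof (rule cINF_lower)
  show "bdd_below (cnorm A ` (I +> x))"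
    using assms(1) by (intro bdd_belowI[of _ 0]) (auto simp: mem_coset_iff norm_ge_0)
qed fact

lemma Q_norm_approx:
  assumes "x \<in> carrier A" "e > 0"
  shows "\<exists>y\<in>I +> x. cnorm A y < cnorm Q (I +> x) + e"
proof (rule ccontr)
  assume "\<not> ?thesis"
  then have "cnorm Q (I +> x) + e \<le> cnorm Q (I +> x)"
    using coset_self[OF assms(1)] unfolding Q_norm
    by (intro cINF_greatest) (auto simp: not_less Q_norm)
  then show False using assms by simp
qed

lemma Q_norm_nonneg: "x \<in> carrier A \<Longrightarrow> 0 \<le> cnorm Q (I +> x)"
  unfolding Q_norm using coset_self[of x]
  by (intro cINF_greatest) (auto simp: mem_coset_iff norm_ge_0)

text \<open>A coset of norm 0 has members of arbitrarily small norm, so \<open>x\<close> is a limit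
  of elements of the closed ideal.\<close>

lemma Q_norm_zero:
  assumes "x \<in> carrier A" "cnorm Q (I +> x) = 0"
  shows "x \<in> I"
proof (rule I_closed)
  fix e :: real assume "e > 0"
  then obtain y where y: "y \<in> I +> x" "cnorm A y < e"
    using Q_norm_approx[OF assms(1)] assms(2) by auto
  then have yc: "y \<in> carrier A" "y \<ominus> x \<in> I" using assms(1) by (auto simp: mem_coset_iff)
  have "x \<ominus> (\<ominus> (y \<ominus> x)) = y"
    using yc assms(1) by (simp add: noncomm_simps)
  then show "\<exists>y\<in>I. cnorm A (x \<ominus> y) < e"
    using y yc I_uminus[of "y \<ominus> x"] by metis
qed fact

lemma Q_norm_add:
  assumes "x \<in> carrier A" "y \<in> carrier A"
  shows "cnorm Q (I +> (x \<oplus> y)) \<le> cnorm Q (I +> x) + cnorm Q (I +> y)"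
proof (rule field_le_epsilon)
  fix e :: real assume "e > 0"
  then obtain x' y' where x': "x' \<in> I +> x" "cnorm A x' < cnorm Q (I +> x) + e/2"
    and y': "y' \<in> I +> y" "cnorm A y' < cnorm Q (I +> y) + e/2"
    using Q_norm_approx[OF assms(1), of "e/2"] Q_norm_approx[OF assms(2), of "e/2"] by auto
  then have c: "x' \<in> carrier A" "y' \<in> carrier A" "x' \<ominus> x \<in> I" "y' \<ominus> y \<in> I"
    using assms by (auto simp: mem_coset_iff)
  have "(x' \<oplus> y') \<ominus> (x \<oplus> y) = (x' \<ominus> x) \<oplus> (y' \<ominus> y)"
    using c assms by (simp add: noncomm_simps)
  then have "x' \<oplus> y' \<in> I +> (x \<oplus> y)"
    using c assms by (simp add: mem_coset_iff a_closed)
  then have "cnorm Q (I +> (x \<oplus> y)) \<le> cnorm A (x' \<oplus> y')"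
    using assms by (intro Q_norm_le) auto
  then show "cnorm Q (I +> (x \<oplus> y)) \<le> cnorm Q (I +> x) + cnorm Q (I +> y) + e"
    using norm_add[OF c(1,2)] x' y' by simp
qed

lemma Q_norm_mult:
  assumes "x \<in> carrier A" "y \<in> carrier A"
  shows "cnorm Q (I +> (x \<otimes> y)) \<le> cnorm Q (I +> x) * cnorm Q (I +> y)"
proof -
  let ?a = "cnorm Q (I +> x)" and ?b = "cnorm Q (I +> y)"
  have nn: "0 \<le> ?a" "0 \<le> ?b" using assms by (simp_all add: Q_norm_nonneg)
  have *: "cnorm Q (I +> (x \<otimes> y)) \<le> (?a + e) * (?b + e)" if e: "e > 0" for e
  proof -
    obtain x' y' where x': "x' \<in> I +> x" "cnorm A x' < ?a + e"
      and y': "y' \<in> I +> y" "cnorm A y' < ?b + e"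
      using Q_norm_approx[OF assms(1) e] Q_norm_approx[OF assms(2) e] by auto
    then have c: "x' \<in> carrier A" "y' \<in> carrier A" "x' \<ominus> x \<in> I" "y' \<ominus> y \<in> I"
      using assms by (auto simp: mem_coset_iff)
    have "(x' \<otimes> y') \<ominus> (x \<otimes> y) = (x' \<ominus> x) \<otimes> y' \<oplus> x \<otimes> (y' \<ominus> y)"
      using c assms by (simp add: noncomm_simps)
    then have "x' \<otimes> y' \<in> I +> (x \<otimes> y)"
      using c assms by (simp add: mem_coset_iff a_closed I_r_closed I_l_closed)
    then have "cnorm Q (I +> (x \<otimes> y)) \<le> cnorm A (x' \<otimes> y')"
      using assms by (intro Q_norm_le) auto
    also have "\<dots> \<le> cnorm A x' * cnorm A y'" using c by (intro cnorm_mult)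
    also have "\<dots> \<le> (?a + e) * (?b + e)"
      using x' y' c nn that norm_ge_0 by (intro mult_mono) auto
    finally show ?thesis .
  qed
  have "((\<lambda>e. (?a + e) * (?b + e)) \<longlongrightarrow> (?a + 0) * (?b + 0)) (at_right 0)"
    by (intro tendsto_intros)
  moreover have "\<forall>\<^sub>F e in at_right (0::real). cnorm Q (I +> (x \<otimes> y)) \<le> (?a + e) * (?b + e)"
    using * by (intro eventually_at_right_less[THEN eventually_mono])
  ultimately show ?thesis
    using tendsto_lowerbound[of _ _ "at_right (0::real)"] by fastforce
qed

text \<open>A scalar acts as multiplication by a multiple of the unit, so submultiplicativity
  suffices. For nonzero scalars the reverse estimate follows by applying this one to the inverse
  scalar.\<close>

lemma Q_norm_smult_le:
  assumes "x \<in> carrier A"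
  shows "cnorm Q (I +> (c \<odot> x)) \<le> cmod c * cnorm Q (I +> x)"
proof -
  have "c \<odot> x = (c \<odot> \<one>) \<otimes> x" using assms by (simp add: smult_mult_left)
  then have "cnorm Q (I +> (c \<odot> x)) \<le> cnorm Q (I +> (c \<odot> \<one>)) * cnorm Q (I +> x)"
    using Q_norm_mult[of "c \<odot> \<one>" x] assms by simp
  also have "cnorm Q (I +> (c \<odot> \<one>)) \<le> cmod c * 1"
    using Q_norm_le[of "c \<odot> \<one>" "c \<odot> \<one>"] norm_one_le
    by (simp add: coset_self cnorm_smult) (meson mult_left_le norm_ge_zero order_trans)
  finally show ?thesis
    using Q_norm_nonneg[OF assms] by (simp add: mult_right_mono)
qed

lemma Q_norm_smult:
  assumes x: "x \<in> carrier A"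
  shows "cnorm Q (I +> (c \<odot> x)) = cmod c * cnorm Q (I +> x)"
proof (cases "c = 0")
  case True
  then show ?thesis using Q_norm_smult_le[OF x, of 0] Q_norm_nonneg[of "c \<odot> x"] x by simp
next
  case False
  have "cnorm Q (I +> x) \<le> cmod (1/c) * cnorm Q (I +> (c \<odot> x))"
    using Q_norm_smult_le[of "c \<odot> x" "1/c"] x False by (simp add: smult_smult one_smult)
  then have "cmod c * cnorm Q (I +> x) \<le> cnorm Q (I +> (c \<odot> x))"
    using False by (simp add: norm_divide field_simps)
  then show ?thesis using Q_norm_smult_le[OF x, of c] by simp
qed

lemma Q_norm_star_le:
  assumes x: "x \<in> carrier A"
  shows "cnorm Q (I +> star A x) \<le> cnorm Q (I +> x)"
proof (rule field_le_epsilon)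
  fix e :: real assume "e > 0"
  then obtain y where y: "y \<in> I +> x" "cnorm A y < cnorm Q (I +> x) + e"
    using Q_norm_approx[OF x] by auto
  then have "star A y \<in> I +> star A x"
    using x I_star[of "y \<ominus> x"] by (simp add: mem_coset_iff star_simps)
  then show "cnorm Q (I +> star A x) \<le> cnorm Q (I +> x) + e"
    using Q_norm_le[of "star A x" "star A y"] y x
    by (simp add: star_closed norm_star mem_coset_iff)
qed

text \<open>For the hard inequality a nearly minimal member \<open>y\<close> of the coset of
  \<open>?h\<close> is replaced by its real part \<open>z\<close>, which stays in the coset since
  \<open>I\<close> is closed under adjoints. Then \<open>j = z \<ominus> ?h\<close> is self-adjoint
  in \<open>I\<close>, and a contraction \<open>u\<close> congruent to the unit makes
  \<open>j \<otimes> u\<close> small. As \<open>x \<otimes> u\<close> represents the coset of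
  \<open>x\<close>, the squared quotient norm is at most the norm of
  \<open>u \<otimes> (?h \<otimes> u)\<close>, which differs by little from
  \<open>u \<otimes> (z \<otimes> u)\<close>.\<close>

lemma Q_norm_cstar:
  assumes x: "x \<in> carrier A"
  shows "cnorm Q (I +> (star A x \<otimes> x)) = (cnorm Q (I +> x))\<^sup>2"
proof (rule antisym)
  have "cnorm Q (I +> (star A x \<otimes> x)) \<le> cnorm Q (I +> star A x) * cnorm Q (I +> x)"
    using x by (intro Q_norm_mult star_closed)
  also have "\<dots> \<le> cnorm Q (I +> x) * cnorm Q (I +> x)"
    using x by (intro mult_right_mono Q_norm_star_le Q_norm_nonneg)
  finally show "cnorm Q (I +> (star A x \<otimes> x)) \<le> (cnorm Q (I +> x))\<^sup>2"
    by (simp add: power2_eq_square)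
next
  let ?h = "star A x \<otimes> x"
  have h: "?h \<in> carrier A" "star A ?h = ?h" using x by (simp_all add: star_simps)
  show "(cnorm Q (I +> x))\<^sup>2 \<le> cnorm Q (I +> ?h)"
  proof (rule field_le_epsilon)
    fix e :: real assume "e > 0"
    then obtain y where y: "y \<in> I +> ?h" and ny: "cnorm A y < cnorm Q (I +> ?h) + e/2"
      using Q_norm_approx[OF h(1), of "e/2"] by auto
    have yc: "y \<in> carrier A" "y \<ominus> ?h \<in> I" using y h by (auto simp: mem_coset_iff)
    define z where "z = (1/2) \<odot> (y \<oplus> star A y)"
    have z: "z \<in> carrier A" "star A z = z"
      using yc by (simp_all add: z_def star_simps a_comm)
    have nz: "cnorm A z \<le> cnorm A y"
      using norm_add[of y "star A y"] yc by (simp add: z_def cnorm_smult norm_star star_closed)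
    define j where "j = z \<ominus> ?h"
    have "j = (1/2) \<odot> ((y \<ominus> ?h) \<oplus> star A (y \<ominus> ?h))"
    proof -
      have "(y \<ominus> ?h) \<oplus> star A (y \<ominus> ?h) = (y \<oplus> star A y) \<ominus> (?h \<oplus> ?h)"
        using yc h unfolding star_minus[OF yc(1) h(1)] h(2)
        by (simp add: noncomm_simps star_closed)
      moreover have "?h = (1/2) \<odot> (?h \<oplus> ?h)"
        using smult_left_distrib[OF h(1), of "1/2" "1/2"] h(1)
        by (simp add: smult_right_distrib one_smult)
      ultimately show ?thesis
        using yc h(1) by (simp add: j_def z_def smult_minus star_closed)
    qed
    then have j: "j \<in> I" using yc I_star by (simp add: I_smult a_closed)
    have jc: "j \<in> carrier A" "star A j = j"
      using z h by (simp_all add: j_def star_minus)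
    obtain u where u: "u \<in> carrier A" "star A u = u" "cnorm A u \<le> 1" "\<one> \<ominus> u \<in> I"
      and le: "cnorm A (j \<otimes> u) \<le> e/2"
      using ideal_approximate_unit[OF ideal_axioms j jc(2), of "e/2"] \<open>e > 0\<close> by auto
    have "x \<otimes> u \<ominus> x = \<ominus> (x \<otimes> (\<one> \<ominus> u))"
      using x u(1) by (simp add: noncomm_simps)
    then have "x \<otimes> u \<in> I +> x"
      using x u by (simp add: mem_coset_iff I_uminus I_l_closed)
    then have "(cnorm Q (I +> x))\<^sup>2 \<le> (cnorm A (x \<otimes> u))\<^sup>2"
      using x by (intro power_mono Q_norm_le Q_norm_nonneg)
    also have "\<dots> = cnorm A (u \<otimes> (?h \<otimes> u))"
      using cstar_identity[of "x \<otimes> u"] x u(1,2) by (simp add: star_simps m_assoc)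
    also have "u \<otimes> (?h \<otimes> u) = u \<otimes> (z \<otimes> u) \<ominus> u \<otimes> (j \<otimes> u)"
    proof -
      have "?h = z \<ominus> j" using z(1) h(1) by (simp add: j_def noncomm_simps)
      then show ?thesis
        using z(1) jc(1) u(1) by (simp add: a_minus_def l_distr r_distr l_minus r_minus)
    qed
    also have "cnorm A \<dots> \<le> cnorm A (u \<otimes> (z \<otimes> u)) + cnorm A (u \<otimes> (j \<otimes> u))"
      using z jc u by (intro norm_minus) auto
    also have "\<dots> \<le> cnorm A u * (cnorm A z * cnorm A u) + cnorm A u * cnorm A (j \<otimes> u)"
      using z jc u norm_ge_0
      by (intro add_mono order_trans[OF cnorm_mult] mult_left_mono cnorm_mult) auto
    also have "\<dots> \<le> 1 * (cnorm A y * 1) + 1 * (e/2)"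
      using nz z(1) jc(1) u(1,3) yc(1) le norm_ge_0 by (intro add_mono mult_mono) auto
    finally show "(cnorm Q (I +> x))\<^sup>2 \<le> cnorm Q (I +> ?h) + e"
      using ny by simp
  qed
qed

text \<open>A subsequence with geometrically small steps is lifted one term at a time, each step to
  a representative of nearly minimal norm; the lifts converge in \<open>A\<close>, and the coset of
  their limit is the limit of the whole sequence.\<close>

lemma Q_complete:
  fixes v :: "nat \<Rightarrow> 'a"
  assumes v: "\<And>n. v n \<in> carrier A"
    and cauchy: "\<And>e. e > 0 \<Longrightarrow> \<exists>N. \<forall>m\<ge>N. \<forall>n\<ge>N. cnorm Q (I +> (v m \<ominus> v n)) < e"
  shows "\<exists>x\<in>carrier A. (\<lambda>n. cnorm Q (I +> (v n \<ominus> x))) \<longlonglongrightarrow> 0"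
proof -
  have "\<forall>k::nat. \<exists>N. \<forall>m\<ge>N. \<forall>n\<ge>N. cnorm Q (I +> (v m \<ominus> v n)) < (1/2)^k"
    using cauchy by simp
  then obtain N where N: "\<And>k m n. N k \<le> m \<Longrightarrow> N k \<le> n \<Longrightarrow> cnorm Q (I +> (v m \<ominus> v n)) < (1/2)^k"
    by metis
  \<comment> \<open>Partial sums make the indices increase, so that both \<open>r k\<close> and
    \<open>r (Suc k)\<close> lie beyond the threshold \<open>N k\<close>.\<close>
  define r where "r k = (\<Sum>i\<le>k. N i)" for k
  have r: "N k \<le> r k" "N k \<le> r (Suc k)" for k
    by (auto simp: r_def intro: member_le_sum) (meson member_le_sum finite_atMost atMost_iff le_SucI order_refl trans_le_add1 zero_le)
  have "\<exists>w. \<forall>k. w k \<in> I +> v (r k) \<and> cnorm A (w (Suc k) \<ominus> w k) < (1/2)^k"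
  proof (rule dependent_nat_choice)
    show "\<exists>x. x \<in> I +> v (r 0)" using coset_self v by blast
    fix x k assume x: "x \<in> I +> v (r k)"
    then have xc: "x \<in> carrier A" "x \<ominus> v (r k) \<in> I" using v by (auto simp: mem_coset_iff)
    let ?d = "v (r (Suc k)) \<ominus> v (r k)"
    have "cnorm Q (I +> ?d) < (1/2)^k" using r N by blast
    \<comment> \<open>The slack between the quotient norm and (1/2)^k is positive and can be spent
      on choosing the representative.\<close>
    then obtain d where d: "d \<in> I +> ?d" "cnorm A d < (1/2)^k"
      using Q_norm_approx[of ?d "(1/2)^k - cnorm Q (I +> ?d)"] v by auto
    then have dc: "d \<in> carrier A" "d \<ominus> ?d \<in> I" using v by (auto simp: mem_coset_iff)
    have "(x \<oplus> d) \<ominus> v (r (Suc k)) = (x \<ominus> v (r k)) \<oplus> (d \<ominus> ?d)"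
      using xc dc v by (simp add: noncomm_simps)
    then have "x \<oplus> d \<in> I +> v (r (Suc k))"
      using xc dc v by (simp add: mem_coset_iff a_closed)
    moreover have "(x \<oplus> d) \<ominus> x = d" using xc dc by (simp add: noncomm_simps)
    ultimately show "\<exists>y. y \<in> I +> v (r (Suc k)) \<and> cnorm A (y \<ominus> x) < (1/2)^k"
      using d by (intro exI[of _ "x \<oplus> d"]) simp
  qed
  then obtain w where w: "\<And>k. w k \<in> I +> v (r k)" and step: "\<And>k. cnorm A (w (Suc k) \<ominus> w k) < (1/2)^k"
    by blast
  have wc: "w k \<in> carrier A" "w k \<ominus> v (r k) \<in> I" for k
    using w v by (auto simp: mem_coset_iff)
  have small: "\<exists>k. (1/2::real)^k < e" if "e > 0" for e
    using real_arch_pow_inv[of e "1/2"] that by auto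
  have "\<exists>x\<in>carrier A. (\<lambda>n. cnorm A (w n \<ominus> x)) \<longlonglongrightarrow> 0"
    using wc(1) step by (intro geometric_limit) (auto intro: less_imp_le)
  then obtain x where x: "x \<in> carrier A" "(\<lambda>n. cnorm A (w n \<ominus> x)) \<longlonglongrightarrow> 0" by blast
  have "\<exists>n0. \<forall>n\<ge>n0. cnorm Q (I +> (v n \<ominus> x)) < e" if e: "e > 0" for e
  proof -
    obtain k1 where k1: "(1/2::real)^k1 < e/2" using small[of "e/2"] e by auto
    obtain k2 where "\<forall>n\<ge>k2. norm (cnorm A (w n \<ominus> x) - 0) < e/2"
      using LIMSEQ_D[OF x(2), of "e/2"] e by auto
    then have k2: "cnorm A (w n \<ominus> x) < e/2" if "n \<ge> k2" for n
      using that by (metis abs_ge_self diff_zero order_le_less_trans real_norm_def)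
    define k where "k = max k1 k2"
    have k: "(1/2::real)^k < e/2" "cnorm A (w k \<ominus> x) < e/2"
      using k1 k2[of k] order_le_less_trans[OF power_decreasing[of k1 k "1/2::real"] k1]
      by (simp_all add: k_def)
    have "cnorm Q (I +> (v n \<ominus> x)) < e" if "n \<ge> N k" for n
    proof -
      have "(w k \<ominus> x) \<ominus> (v (r k) \<ominus> x) = w k \<ominus> v (r k)"
        using wc v x by (simp add: noncomm_simps)
      then have "w k \<ominus> x \<in> I +> (v (r k) \<ominus> x)"
        using wc v x by (simp add: mem_coset_iff)
      then have "cnorm Q (I +> (v (r k) \<ominus> x)) < e/2"
        using Q_norm_le[of "v (r k) \<ominus> x"] v x k by fastforce
      moreover have "cnorm Q (I +> (v n \<ominus> v (r k))) < e/2"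
        using N[of k n "r k"] r that k by simp
      moreover have "(v n \<ominus> v (r k)) \<oplus> (v (r k) \<ominus> x) = v n \<ominus> x"
        using v x by (simp add: minus_triangle_eq)
      ultimately show ?thesis
        using Q_norm_add[of "v n \<ominus> v (r k)" "v (r k) \<ominus> x"] v x by simp
    qed
    then show ?thesis by blast
  qed
  then have "(\<lambda>n. cnorm Q (I +> (v n \<ominus> x))) \<longlonglongrightarrow> 0"
    using v x by (intro LIMSEQ_I) (simp add: Q_norm_nonneg)
  then show ?thesis using x by blast
qed

theorem unital_cstar_algebra_Q: "unital_cstar_algebra Q"
proof (rule unital_cstar_algebra_image[where q = "\<lambda>x. I +> x" and S = "carrier A", OF unital_cstar_algebra_axioms])
  show "subring (carrier A) A" by (rule carrier_is_subring)
  show "I +> x = I +> \<zero>" if "x \<in> carrier A" "cnorm Q (I +> x) = 0" for x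
    using Q_norm_zero[OF that] that by (simp add: coset_zero coset_zero_iff)
qed (simp_all add: star_closed Q_carrier Q_add Q_mult Q_zero Q_one Q_smult Q_star Q_norm_nonneg
      Q_norm_smult Q_norm_add Q_norm_mult Q_norm_cstar Q_complete)

lemma coset_star_hom: "(\<lambda>x. I +> x) \<in> unital_star_hom A Q"
  by (rule unital_star_homI) (simp_all add: Q_carrier Q_add Q_mult Q_one Q_smult Q_star)

end

section \<open>The universal property for arbitrary targets\<close>

text \<open>Scalars are restricted to the Gaussian rationals in order to make the type countable.\<close>

datatype 'd star_poly = Gen 'd | Const rat rat
  | Add "'d star_poly" "'d star_poly" | Mult "'d star_poly" "'d star_poly" | Star "'d star_poly"

instance star_poly :: (countable) countable
  by countable_datatype

lemma complex_approx_rat: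
  fixes c :: complex
  assumes "e > 0"
  shows "\<exists>p q. cmod (c - Complex (of_rat p) (of_rat q)) < e"
proof -
  obtain p where p: "Re c - e/2 < of_rat p" "of_rat p < Re c"
    using of_rat_dense[of "Re c - e/2" "Re c"] assms by auto
  obtain q where q: "Im c - e/2 < of_rat q" "of_rat q < Im c"
    using of_rat_dense[of "Im c - e/2" "Im c"] assms by auto
  have "cmod (c - Complex (of_rat p) (of_rat q)) \<le> \<bar>Re c - of_rat p\<bar> + \<bar>Im c - of_rat q\<bar>"
    using cmod_le[of "c - Complex (of_rat p) (of_rat q)"] by simp
  also have "\<dots> < e" using p q by simp
  finally show ?thesis by blast
qed

section \<open>Star polynomials and generated C*-subalgebras\<close>

context unital_cstar_algebra
begin

primrec star_eval :: "('d \<Rightarrow> 'a) \<Rightarrow> 'd star_poly \<Rightarrow> 'a" where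
  "star_eval t (Gen j) = t j"
| "star_eval t (Const p q) = Complex (of_rat p) (of_rat q) \<odot> \<one>"
| "star_eval t (Add a b) = star_eval t a \<oplus> star_eval t b"
| "star_eval t (Mult a b) = star_eval t a \<otimes> star_eval t b"
| "star_eval t (Star a) = star A (star_eval t a)"

lemma star_eval_closed:
  assumes "\<And>j. t j \<in> carrier A"
  shows "star_eval t p \<in> carrier A"
  by (induction p) (use assms in \<open>simp_all add: star_closed\<close>)

text \<open>Written as the closure of the values of star polynomials, of which there are countably
  many for a countable index type, rather than as an intersection of subalgebras: this countable
  dense set is what bounds the cardinality.\<close>

definition generated_subalgebra :: "('d \<Rightarrow> 'a) \<Rightarrow> 'a set" where
  "generated_subalgebra t = norm_topology A closure_of range (star_eval t)"

context
  fixes t :: "'d \<Rightarrow> 'a"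
  assumes t: "\<And>j. t j \<in> carrier A"
begin

lemma mem_generated_iff:
  "x \<in> generated_subalgebra t \<longleftrightarrow>
    x \<in> carrier A \<and> (\<forall>e>0. \<exists>p. cnorm A (x \<ominus> star_eval t p) < e)"
  unfolding generated_subalgebra_def
  by (subst closure_of_iff) (use star_eval_closed[of t, OF t] in auto)

lemma star_eval_generated: "star_eval t p \<in> generated_subalgebra t"
  unfolding mem_generated_iff using star_eval_closed[of t, OF t]
  by (auto simp: a_minus_def r_neg intro!: exI[of _ p])

lemma generated_add:
  assumes "x \<in> generated_subalgebra t" "y \<in> generated_subalgebra t"
  shows "x \<oplus> y \<in> generated_subalgebra t"
  unfolding mem_generated_iff
proof (intro conjI allI impI)
  have c: "x \<in> carrier A" "y \<in> carrier A" using assms by (auto simp: mem_generated_iff)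
  then show "x \<oplus> y \<in> carrier A" by simp
  fix e :: real assume "e > 0"
  then obtain p q where pq: "cnorm A (x \<ominus> star_eval t p) < e/2" "cnorm A (y \<ominus> star_eval t q) < e/2"
    using assms unfolding mem_generated_iff by (metis half_gt_zero)
  note pc = star_eval_closed[of t, OF t, of p] star_eval_closed[of t, OF t, of q]
  have "(x \<oplus> y) \<ominus> star_eval t (Add p q) = (x \<ominus> star_eval t p) \<oplus> (y \<ominus> star_eval t q)"
    using c pc by (simp add: noncomm_simps)
  then have "cnorm A ((x \<oplus> y) \<ominus> star_eval t (Add p q)) < e"
    using norm_add[of "x \<ominus> star_eval t p" "y \<ominus> star_eval t q"] c pc pq by simp
  then show "\<exists>p. cnorm A ((x \<oplus> y) \<ominus> star_eval t p) < e" by blast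
qed

lemma generated_mult:
  assumes "x \<in> generated_subalgebra t" "y \<in> generated_subalgebra t"
  shows "x \<otimes> y \<in> generated_subalgebra t"
  unfolding mem_generated_iff
proof (intro conjI allI impI)
  have c: "x \<in> carrier A" "y \<in> carrier A" using assms by (auto simp: mem_generated_iff)
  then show "x \<otimes> y \<in> carrier A" by simp
  fix e :: real assume e: "e > 0"
  \<comment> \<open>The minimum with 1 bounds the norm of the approximant of \<open>y\<close> by
    \<open>cnorm A y + 1\<close>; the summand 2 instead of 1 in the denominator leaves room for a
    strict inequality.\<close>
  define d where "d = min 1 (e / (cnorm A x + cnorm A y + 2))"
  have nn: "0 \<le> cnorm A x" "0 \<le> cnorm A y" using c by (simp_all add: norm_ge_0)
  then have d: "d > 0" "d \<le> 1"
    using e by (auto simp: d_def)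
  have "d \<le> e / (cnorm A x + cnorm A y + 2)" by (simp add: d_def)
  then have de: "d * (cnorm A x + cnorm A y + 2) \<le> e"
    using nn by (simp add: pos_le_divide_eq)
  obtain p q where pq: "cnorm A (x \<ominus> star_eval t p) < d" "cnorm A (y \<ominus> star_eval t q) < d"
    using assms d(1) unfolding mem_generated_iff by meson
  let ?x = "star_eval t p" and ?y = "star_eval t q"
  note pc = star_eval_closed[of t, OF t, of p] star_eval_closed[of t, OF t, of q]
  have ny: "cnorm A ?y \<le> cnorm A y + 1"
    using norm_le_minus_add[OF pc(2) c(2)] pq(2) d(2) c pc by (simp add: norm_minus_commute)
  have "(x \<otimes> y) \<ominus> star_eval t (Mult p q) = x \<otimes> (y \<ominus> ?y) \<oplus> (x \<ominus> ?x) \<otimes> ?y"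
    using c pc by (simp add: noncomm_simps)
  then have "cnorm A ((x \<otimes> y) \<ominus> star_eval t (Mult p q)) \<le> cnorm A (x \<otimes> (y \<ominus> ?y)) + cnorm A ((x \<ominus> ?x) \<otimes> ?y)"
    using norm_add[of "x \<otimes> (y \<ominus> ?y)" "(x \<ominus> ?x) \<otimes> ?y"] c pc by simp
  also have "\<dots> \<le> cnorm A x * cnorm A (y \<ominus> ?y) + cnorm A (x \<ominus> ?x) * cnorm A ?y"
    using c pc by (intro add_mono cnorm_mult) auto
  also have "\<dots> \<le> cnorm A x * d + d * (cnorm A y + 1)"
    using pq ny nn c pc d(1) by (intro add_mono mult_mono) (auto simp: norm_ge_0)
  also have "\<dots> < d * (cnorm A x + cnorm A y + 2)"
    using d(1) by (simp add: algebra_simps)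
  finally have "cnorm A ((x \<otimes> y) \<ominus> star_eval t (Mult p q)) < e" using de by simp
  then show "\<exists>p. cnorm A ((x \<otimes> y) \<ominus> star_eval t p) < e" by blast
qed

lemma generated_star:
  assumes "x \<in> generated_subalgebra t"
  shows "star A x \<in> generated_subalgebra t"
  unfolding mem_generated_iff
proof (intro conjI allI impI)
  have c: "x \<in> carrier A" using assms by (auto simp: mem_generated_iff)
  then show "star A x \<in> carrier A" by (rule star_closed)
  fix e :: real assume "e > 0"
  then obtain p where "cnorm A (x \<ominus> star_eval t p) < e"
    using assms unfolding mem_generated_iff by meson
  then have "cnorm A (star A x \<ominus> star_eval t (Star p)) < e"
    using norm_star[of "x \<ominus> star_eval t p"] c star_eval_closed[of t, OF t] by (simp add: star_minus)
  then show "\<exists>p. cnorm A (star A x \<ominus> star_eval t p) < e" by blast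
qed

text \<open>The polynomials contain only Gaussian rational constants; every other scalar enters
  through the closure.\<close>

lemma generated_smult_one: "c \<odot> \<one> \<in> generated_subalgebra t"
  unfolding mem_generated_iff
proof (intro conjI allI impI)
  fix e :: real assume "e > 0"
  then obtain p q where pq: "cmod (c - Complex (of_rat p) (of_rat q)) < e"
    using complex_approx_rat by blast
  have "cnorm A (c \<odot> \<one> \<ominus> star_eval t (Const p q)) = cmod (c - Complex (of_rat p) (of_rat q)) * cnorm A \<one>"
    by (simp flip: diff_smult add: cnorm_smult)
  also have "\<dots> \<le> cmod (c - Complex (of_rat p) (of_rat q)) * 1"
    using norm_one_le by (intro mult_left_mono) auto
  finally have "cnorm A (c \<odot> \<one> \<ominus> star_eval t (Const p q)) < e" using pq by simp
  then show "\<exists>p. cnorm A (c \<odot> \<one> \<ominus> star_eval t p) < e" by blast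
qed simp

lemma generated_smult:
  assumes "x \<in> generated_subalgebra t"
  shows "c \<odot> x \<in> generated_subalgebra t"
  using generated_mult[OF generated_smult_one assms, of c] assms
  by (simp add: smult_mult_left mem_generated_iff[of x])

lemma unital_cstar_subalgebra_generated: "unital_cstar_subalgebra (generated_subalgebra t) A"
  unfolding unital_cstar_subalgebra_def
proof (intro conjI ballI allI)
  show "subring (generated_subalgebra t) A"
  proof (rule subringI)
    show "generated_subalgebra t \<subseteq> carrier A" by (auto simp: mem_generated_iff)
    show "\<one> \<in> generated_subalgebra t" using generated_smult_one[of 1] by (simp add: one_smult)
    fix x assume x: "x \<in> generated_subalgebra t"
    then show "\<ominus> x \<in> generated_subalgebra t"
      using generated_smult[OF x, of "-1"] by (simp add: uminus_eq_smult mem_generated_iff[of x])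
  qed (simp_all add: generated_mult generated_add)
  show "closedin (norm_topology A) (generated_subalgebra t)"
    unfolding generated_subalgebra_def by (rule closedin_closure_of)
qed (simp_all add: generated_smult generated_star)

end

text \<open>A point is coded by the set of pairs \<open>(m, k)\<close> for which it lies within
  1/(k+1) of the \<open>m\<close>-th polynomial value. Density of these values makes the code
  injective, and sets of naturals are equinumerous with the reals.\<close>

lemma generated_subalgebra_real_embedding:
  fixes t :: "'d::countable \<Rightarrow> 'a"
  assumes t: "\<And>j. t j \<in> carrier A"
  shows "\<exists>i :: 'a \<Rightarrow> real. inj_on i (generated_subalgebra t)"
proof -
  define e where "e n = star_eval t (from_nat n)" for n :: nat
  have ec: "e n \<in> carrier A" for n using star_eval_closed[of t, OF t] by (simp add: e_def)
  define N where "N x = {n. cnorm A (x \<ominus> e (fst (prod_decode n))) < 1 / real (Suc (snd (prod_decode n)))}" for x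
  have N: "prod_encode (m, k) \<in> N x \<longleftrightarrow> cnorm A (x \<ominus> e m) < 1 / real (Suc k)" for m k x
    by (simp add: N_def)
  have "inj_on N (generated_subalgebra t)"
  proof (rule inj_onI)
    fix x y assume x: "x \<in> generated_subalgebra t" and y: "y \<in> generated_subalgebra t" and eq: "N x = N y"
    have c: "x \<in> carrier A" "y \<in> carrier A" using x y by (simp_all add: mem_generated_iff[of t, OF t])
    show "x = y"
    proof (rule eq_if_norm_small[OF c])
      fix d :: real assume "d > 0"
      then obtain k where k: "1 / real (Suc k) < d"
        using reals_Archimedean[of d] by (auto simp: inverse_eq_divide)
      have "(0::real) < 1 / real (Suc k)" by simp
      then obtain p where "cnorm A (x \<ominus> star_eval t p) < 1 / real (Suc k)"
        using x unfolding mem_generated_iff[of t, OF t] by meson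
      moreover have "star_eval t p = e (to_nat p)" by (simp add: e_def)
      ultimately have "cnorm A (x \<ominus> e (to_nat p)) < 1 / real (Suc k)" by simp
      moreover from this have "cnorm A (y \<ominus> e (to_nat p)) < 1 / real (Suc k)"
        using N[of _ k] eq by blast
      ultimately show "cnorm A (x \<ominus> y) \<le> 2 * d"
        using norm_triangle_minus[OF c(1) ec c(2), of "to_nat p"] norm_minus_commute[OF ec c(2), of "to_nat p"] k
        by linarith
    qed
  qed
  moreover obtain g :: "nat set \<Rightarrow> real" where "bij g"
    using nat_sets_eqpoll_reals unfolding eqpoll_def by blast
  ultimately have "inj_on (g \<circ> N) (generated_subalgebra t)"
    by (intro comp_inj_on) (auto intro: inj_on_subset bij_is_inj)
  then show ?thesis by blast
qed

text \<open>The C*-subalgebra generated by \<open>t\<close> is relabelled by real numbers through an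
  injection \<open>i\<close>, and \<open>f\<close>, the inverse of \<open>i\<close>, embeds the copy
  back into \<open>A\<close>. This makes the real-carrier universal property applicable to every
  target.\<close>

lemma real_copy:
  fixes t :: "'d::finite \<Rightarrow> 'a"
  assumes t: "\<And>j. t j \<in> carrier A"
  shows "\<exists>(B :: real cstar) f. unital_cstar_algebra B \<and> f \<in> unital_star_hom B A \<and>
    inj_on f (carrier B) \<and> range t \<subseteq> f ` carrier B"
proof -
  define D where "D = generated_subalgebra t"
  obtain i :: "'a \<Rightarrow> real" where i: "inj_on i D"
    using generated_subalgebra_real_embedding[of t, OF t] unfolding D_def by blast
  have sub: "subring D A" and clD: "closedin (norm_topology A) D"
    using unital_cstar_subalgebra_generated[of t, OF t] by (simp_all add: unital_cstar_subalgebra_def D_def)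
  note Dcl = subringE(2,3,5,6,7)[OF sub]
  have Dsm: "c \<odot> x \<in> D" "star A x \<in> D" if "x \<in> D" for x c
    using that generated_smult[of t, OF t] generated_star[of t, OF t] by (simp_all add: D_def)
  have Dc: "x \<in> carrier A" if "x \<in> D" for x using that subringE(1)[OF sub] by auto
  have Dm: "x \<ominus> y \<in> D" if "x \<in> D" "y \<in> D" for x y using that Dcl by (simp add: a_minus_def)
  define f where "f = inv_into D i"
  have f: "f (i x) = x" if "x \<in> D" for x using that i by (simp add: f_def)
  define B :: "real cstar" where "B = \<lparr>carrier = i ` D,
    monoid.mult = (\<lambda>a b. i (f a \<otimes> f b)), monoid.one = i \<one>,
    ring.zero = i \<zero>, ring.add = (\<lambda>a b. i (f a \<oplus> f b)),
    module.smult = (\<lambda>c a. i (c \<odot> f a)), star = (\<lambda>a. i (star A (f a))), cnorm = (\<lambda>a. cnorm A (f a))\<rparr>"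
  have B: "unital_cstar_algebra B"
  proof (rule unital_cstar_algebra_image[OF unital_cstar_algebra_axioms sub, where q = i])
    fix v :: "nat \<Rightarrow> 'a" assume v: "\<And>n. v n \<in> D"
      and "\<And>e. e > 0 \<Longrightarrow> \<exists>N. \<forall>m\<ge>N. \<forall>n\<ge>N. cnorm B (i (v m \<ominus> v n)) < e"
    then have cauchy: "\<exists>N. \<forall>m\<ge>N. \<forall>n\<ge>N. cnorm A (v m \<ominus> v n) < e" if "e > 0" for e
      using that by (simp add: B_def f Dm)
    obtain x where x: "x \<in> carrier A" "(\<lambda>n. cnorm A (v n \<ominus> x)) \<longlonglongrightarrow> 0"
      using complete_seq[of v] cauchy v Dc by blast
    \<comment> \<open>The limit found in \<open>A\<close> is approximated by the sequence itself,
      hence belongs to the closed set \<open>D\<close>; this gives completeness of the copy.\<close>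
    have "\<exists>y\<in>D. cnorm A (x \<ominus> y) < e" if e: "e > 0" for e
    proof -
      obtain n where "norm (cnorm A (v n \<ominus> x) - 0) < e"
        using LIMSEQ_D[OF x(2) e] by blast
      then have "cnorm A (x \<ominus> v n) < e"
        using norm_minus_commute[of x "v n"] x v Dc by simp
      then show ?thesis using v by blast
    qed
    then have "x \<in> D" using clD x by (simp add: closedin_iff)
    then show "\<exists>x\<in>D. (\<lambda>n. cnorm B (i (v n \<ominus> x))) \<longlonglongrightarrow> 0"
      using x v by (intro bexI[of _ x]) (simp_all add: B_def f Dm)
  next
    show "i x = i \<zero>" if "x \<in> D" "cnorm B (i x) = 0" for x
      using that Dc by (simp add: B_def f norm_eq_0)
  qed (simp_all add: B_def f Dcl Dsm Dc norm_ge_0 cnorm_smult norm_add cnorm_mult cstar_identity)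
  moreover have "f \<in> unital_star_hom B A"
    by (rule unital_star_homI) (auto simp: B_def f Dcl Dsm Dc)
  moreover have "inj_on f (carrier B)"
    by (auto simp: B_def f inj_on_def)
  moreover have "t j \<in> f ` carrier B" for j
  proof -
    have "t j \<in> D" using star_eval_generated[of t, OF t, of "Gen j"] by (simp add: D_def)
    then show ?thesis using f[of "t j"] by (auto simp: B_def image_iff intro!: bexI[of _ "t j"])
  qed
  ultimately show ?thesis by blast
qed

end

text \<open>The family \<open>t\<close> is pulled back along the injective homomorphism from a real
  copy. Injectivity transfers the Cuntz relations to the preimages, so the universal property
  applies there, and composing returns to \<open>B\<close>.\<close>

lemma cuntz_universal:
  fixes A :: "'a cstar" and B :: "'b cstar" and s :: "'d::finite \<Rightarrow> 'a"
  assumes A: "cuntz_algebra A s" and B: "unital_cstar_algebra B" and t: "cuntz_relations B t"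
  shows "\<exists>f. star_hom A B f \<and> (\<forall>j. f (s j) = t j)"
proof -
  interpret B: unital_cstar_algebra B by fact
  have tc: "t j \<in> carrier B" for j using t by (simp add: cuntz_relations_def)
  obtain R :: "real cstar" and h where R: "unital_cstar_algebra R" and h: "h \<in> unital_star_hom R B"
    and inj: "inj_on h (carrier R)" and ran: "range t \<subseteq> h ` carrier R"
    using B.real_copy[of t, OF tc] by blast
  interpret h: star_hom R B h
    by (intro star_hom.intro star_hom_axioms.intro R B h)
  have "\<forall>j. \<exists>r\<in>carrier R. h r = t j"
  proof
    fix j
    have "t j \<in> h ` carrier R" using ran by blast
    then show "\<exists>r\<in>carrier R. h r = t j" by force
  qed
  then obtain r where r: "\<And>j. r j \<in> carrier R" "\<And>j. h (r j) = t j" by metis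
  have hI: "x = y" if "h x = h y" "x \<in> carrier R" "y \<in> carrier R" for x y
    using that inj by (auto dest: inj_onD)
  have "cuntz_relations R r"
    unfolding cuntz_relations_def
  proof (intro conjI allI)
    fix j
    show "r j \<in> carrier R" by (rule r)
    show "star R (r j) \<otimes>\<^bsub>R\<^esub> r j = \<one>\<^bsub>R\<^esub>"
      using t r by (intro hI) (simp_all add: h.hom_mult h.hom_star h.A.star_closed cuntz_relations_def)
  next
    show "(\<Oplus>\<^bsub>R\<^esub>j\<in>UNIV. r j \<otimes>\<^bsub>R\<^esub> star R (r j)) = \<one>\<^bsub>R\<^esub>"
    proof (rule hI)
      show "h (\<Oplus>\<^bsub>R\<^esub>j\<in>UNIV. r j \<otimes>\<^bsub>R\<^esub> star R (r j)) = h \<one>\<^bsub>R\<^esub>"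
        using t r by (subst h.hom_finsum) (simp_all add: h.hom_mult h.hom_star h.A.star_closed cuntz_relations_def)
    qed (use r h.A.star_closed in \<open>auto intro!: h.A.finsum_closed\<close>)
  qed
  then obtain f where f: "f \<in> unital_star_hom A R" "\<And>j. f (s j) = r j"
    using A R unfolding cuntz_algebra_def by blast
  have Ac: "unital_cstar_algebra A" using A by (simp add: cuntz_algebra_def)
  show ?thesis
    by (rule exI[of _ "\<lambda>x. h (f x)"])
      (use unital_star_hom_compose[OF Ac f(1) h] Ac B f r in \<open>auto intro!: star_hom.intro star_hom_axioms.intro\<close>)
qed

section \<open>Averaging over a compact group\<close>

context unital_cstar_algebra
begin

lemma norm_finsum_le:
  assumes "finite F" "\<And>i. i \<in> F \<Longrightarrow> x i \<in> carrier A"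
  shows "cnorm A (\<Oplus>i\<in>F. x i) \<le> (\<Sum>i\<in>F. cnorm A (x i))"
  using assms
proof (induction F)
  case (insert i F)
  then have "(\<Oplus>i\<in>F. x i) \<in> carrier A" by (intro finsum_closed) auto
  then show ?case
    using insert norm_add[of "x i" "\<Oplus>i\<in>F. x i"] by (subst finsum_insert) auto
qed simp

lemma smult_finsum:
  assumes "finite F" "\<And>i. i \<in> F \<Longrightarrow> x i \<in> carrier A"
  shows "c \<odot> (\<Oplus>i\<in>F. x i) = (\<Oplus>i\<in>F. c \<odot> x i)"
  using assms
proof (induction F)
  case (insert i F)
  then have "(\<Oplus>i\<in>F. x i) \<in> carrier A" by (intro finsum_closed) auto
  moreover have "(\<Oplus>i\<in>insert i F. c \<odot> x i) = c \<odot> x i \<oplus> (\<Oplus>i\<in>F. c \<odot> x i)"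
    using insert by (subst finsum_insert) auto
  ultimately show ?case
    using insert by (subst finsum_insert) (auto simp: smult_right_distrib)
qed simp

lemma finsum_minus:
  assumes "finite F" "\<And>i. i \<in> F \<Longrightarrow> x i \<in> carrier A" "\<And>i. i \<in> F \<Longrightarrow> y i \<in> carrier A"
  shows "(\<Oplus>i\<in>F. x i) \<ominus> (\<Oplus>i\<in>F. y i) = (\<Oplus>i\<in>F. x i \<ominus> y i)"
proof -
  have "(\<Oplus>i\<in>F. x i \<ominus> y i) = (\<Oplus>i\<in>F. x i) \<oplus> (\<Oplus>i\<in>F. (-1) \<odot> y i)"
    using assms by (subst finsum_addf[symmetric]) (auto simp: a_minus_def uminus_eq_smult intro!: finsum_cong)
  also have "(\<Oplus>i\<in>F. (-1) \<odot> y i) = \<ominus> (\<Oplus>i\<in>F. y i)"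
    using assms by (subst uminus_eq_smult) (auto simp: smult_finsum intro!: finsum_closed)
  finally show ?thesis by (simp add: a_minus_def)
qed

lemma finsum_constant_smult:
  assumes "finite F" "y \<in> carrier A"
  shows "(\<Oplus>i\<in>F. y) = of_nat (card F) \<odot> y"
  using assms by (induction F) (simp_all add: smult_left_distrib one_smult)

definition mean :: "'i set \<Rightarrow> ('i \<Rightarrow> 'a) \<Rightarrow> 'a" where
  "mean H x = (1 / of_nat (card H)) \<odot> (\<Oplus>h\<in>H. x h)"

lemma mean_closed [simp]: "(\<And>h. h \<in> H \<Longrightarrow> x h \<in> carrier A) \<Longrightarrow> mean H x \<in> carrier A"
  by (auto simp: mean_def intro!: finsum_closed)

lemma mean_minus:
  assumes "finite H" "\<And>h. h \<in> H \<Longrightarrow> x h \<in> carrier A" "\<And>h. h \<in> H \<Longrightarrow> y h \<in> carrier A"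
  shows "mean H x \<ominus> mean H y = mean H (\<lambda>h. x h \<ominus> y h)"
proof -
  have "(\<Oplus>h\<in>H. x h) \<in> carrier A" "(\<Oplus>h\<in>H. y h) \<in> carrier A"
    using assms by (auto intro!: finsum_closed)
  then show ?thesis
    using assms by (simp add: mean_def flip: smult_minus finsum_minus)
qed

lemma mean_const: "\<lbrakk>finite H; H \<noteq> {}; y \<in> carrier A\<rbrakk> \<Longrightarrow> mean H (\<lambda>h. y) = y"
  by (simp add: mean_def finsum_constant_smult smult_smult one_smult)

lemma norm_mean_le:
  assumes "finite H" "\<And>h. h \<in> H \<Longrightarrow> x h \<in> carrier A" "\<And>h. h \<in> H \<Longrightarrow> cnorm A (x h) \<le> d h"
  shows "cnorm A (mean H x) \<le> (\<Sum>h\<in>H. d h) / card H"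
proof -
  have "cnorm A (mean H x) = cnorm A (\<Oplus>h\<in>H. x h) / card H"
    using assms by (simp add: mean_def cnorm_smult finsum_closed Pi_iff norm_divide)
  also have "\<dots> \<le> (\<Sum>h\<in>H. d h) / card H"
    using assms by (intro divide_right_mono order_trans[OF norm_finsum_le sum_mono]) auto
  finally show ?thesis .
qed

lemma norm_mean_minus_le:
  assumes "finite H" "H \<noteq> {}" "\<And>h. h \<in> H \<Longrightarrow> x h \<in> carrier A" "y \<in> carrier A"
    and "\<And>h. h \<in> H \<Longrightarrow> cnorm A (x h \<ominus> y) \<le> d h"
  shows "cnorm A (mean H x \<ominus> y) \<le> (\<Sum>h\<in>H. d h) / card H"
proof -
  have "mean H x \<ominus> y = mean H (\<lambda>h. x h \<ominus> y)"
    using mean_minus[of H x "\<lambda>h. y"] assms by (simp add: mean_const)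
  then show ?thesis
    using norm_mean_le[of H "\<lambda>h. x h \<ominus> y" d] assms by simp
qed

lemma norm_mean_minus_le_const:
  assumes "finite H" "H \<noteq> {}" "\<And>h. h \<in> H \<Longrightarrow> x h \<in> carrier A" "y \<in> carrier A"
    and "\<And>h. h \<in> H \<Longrightarrow> cnorm A (x h \<ominus> y) \<le> D"
  shows "cnorm A (mean H x \<ominus> y) \<le> D"
  using norm_mean_minus_le[of H x y "\<lambda>_. D"] assms by simp

text \<open>Translation is on the right because the equivariance law to be preserved concerns left
  translates; all generators share one \<open>H\<close>.\<close>

definition shift_mean :: "'g set \<Rightarrow> ('d \<Rightarrow> 'g::group_add \<Rightarrow> 'a) \<Rightarrow> 'd \<Rightarrow> 'g \<Rightarrow> 'a" where
  "shift_mean H \<Phi> k g = mean H (\<lambda>h. \<Phi> k (g + h))"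

text \<open>Uniformity in both \<open>p\<close> and \<open>q\<close> is asked for since the group
  need not be commutative: \<open>p\<close> serves to compare averages at different points,
  \<open>q\<close> absorbs further right shifts.\<close>

definition translate_net :: "real \<Rightarrow> 'g set \<Rightarrow> ('d \<Rightarrow> 'g::group_add \<Rightarrow> 'a) \<Rightarrow> bool" where
  "translate_net e H \<Phi> \<longleftrightarrow> finite H \<and> H \<noteq> {} \<and>
    (\<forall>a. \<exists>h\<in>H. \<forall>k p q. cnorm A (\<Phi> k (p + a + q) \<ominus> \<Phi> k (p + h + q)) \<le> e)"

text \<open>A further right shift is merged into \<open>q\<close>, so one net serves all iterated
  averages.\<close>

lemma translate_net_shift_mean:
  assumes "translate_net e H \<Phi>" "\<And>k g. \<Phi> k g \<in> carrier A" "finite K" "K \<noteq> {}"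
  shows "translate_net e H (shift_mean K \<Phi>)"
  unfolding translate_net_def
proof (intro conjI allI)
  fix a
  obtain h where h: "h \<in> H" "\<And>k p q. cnorm A (\<Phi> k (p + a + q) \<ominus> \<Phi> k (p + h + q)) \<le> e"
    using assms(1) unfolding translate_net_def by meson
  have "cnorm A (shift_mean K \<Phi> k (p + a + q) \<ominus> shift_mean K \<Phi> k (p + h + q)) \<le> e" for k p q
  proof -
    have "cnorm A (mean K (\<lambda>l. \<Phi> k (p + a + (q + l)) \<ominus> \<Phi> k (p + h + (q + l)))) \<le> (\<Sum>l\<in>K. e) / card K"
      using assms(2,3) h(2) by (intro norm_mean_le) auto
    then show ?thesis
      using assms by (simp add: shift_mean_def mean_minus add.assoc)
  qed
  then show "\<exists>h\<in>H. \<forall>k p q. cnorm A (shift_mean K \<Phi> k (p + a + q) \<ominus> shift_mean K \<Phi> k (p + h + q)) \<le> e"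
    using h(1) by blast
qed (use assms(1) in \<open>auto simp: translate_net_def\<close>)

text \<open>Averaging over an \<open>e\<close>-net contracts the oscillation, because each summand of one average is
  \<open>e\<close>-close to some summand of the other.\<close>

lemma oscillation_shift_mean:
  assumes net: "translate_net e H \<Phi>" and c: "\<And>k g. \<Phi> k g \<in> carrier A"
    and osc: "\<And>k g g'. cnorm A (\<Phi> k g \<ominus> \<Phi> k g') \<le> D"
  shows "cnorm A (shift_mean H \<Phi> k g \<ominus> shift_mean H \<Phi> k g') \<le> e + (1 - 1 / card H) * (D - e)"
proof -
  have H: "finite H" "H \<noteq> {}" using net by (auto simp: translate_net_def)
  then have cH: "card H > 0" by auto
  define y where "y = shift_mean H \<Phi> k g'"
  have y: "y \<in> carrier A" using c by (simp add: y_def shift_mean_def)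
  have "cnorm A (\<Phi> k (g + h) \<ominus> y) \<le> e + (1 - 1 / card H) * (D - e)" for h
  proof -
    \<comment> \<open>Approximating \<open>- g' + g + h\<close> with \<open>p = g'\<close> makes the
      value at \<open>g' + h'\<close> close to the value at \<open>g + h\<close>.\<close>
    obtain h' where h': "h' \<in> H" "\<And>k p q. cnorm A (\<Phi> k (p + (- g' + g + h) + q) \<ominus> \<Phi> k (p + h' + q)) \<le> e"
      using net unfolding translate_net_def by meson
    have close: "cnorm A (\<Phi> k (g' + h') \<ominus> \<Phi> k (g + h)) \<le> e"
      using h'(2)[of k g' 0] c by (simp add: norm_minus_commute flip: add.assoc)
    have "cnorm A (y \<ominus> \<Phi> k (g + h)) \<le> (\<Sum>l\<in>H. if l = h' then e else D) / card H"
      unfolding y_def shift_mean_def using H c close osc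
      by (intro norm_mean_minus_le) auto
    \<comment> \<open>Exactly one summand enjoys the good bound \<open>e\<close>; the others only
      the old bound \<open>D\<close>.\<close>
    also have "(\<Sum>l\<in>H. if l = h' then e else D) = e + (card H - 1) * D"
      using H h'(1) cH by (simp add: sum.remove[of H h'] of_nat_diff)
    also have "\<dots> / card H = e + (1 - 1 / card H) * (D - e)"
      using cH by (simp add: field_simps of_nat_diff)
    finally show ?thesis using c y by (simp add: norm_minus_commute)
  qed
  then show ?thesis
    unfolding y_def[symmetric] shift_mean_def[of H \<Phi> k g] using H c y
    by (intro norm_mean_minus_le_const) auto
qed

text \<open>A tube lemma argument: the difference of the values at \<open>p + a + q\<close> and
  \<open>p + q\<close> vanishes for \<open>a = 0\<close>, so compactness in \<open>p\<close> and
  \<open>q\<close> gives a neighbourhood \<open>V\<close> of 0 that is good for all of them.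
  Finitely many left translates of \<open>V\<close> then cover the group.\<close>

lemma translate_net_exists:
  fixes F :: "'d::finite \<Rightarrow> 'g::topological_group_add \<Rightarrow> 'a"
  assumes comp: "compact (UNIV :: 'g set)" and "e > 0"
    and cont: "\<And>k. continuous_map euclidean (norm_topology A) (F k)"
  shows "\<exists>H. translate_net e H F"
proof -
  have Fc: "F k g \<in> carrier A" for k g
    using cont[of k] by (simp add: continuous_map_norm_topology_iff)
  define \<psi> where "\<psi> k z = cnorm A (F k (fst z) \<ominus> F k (snd z))" for k and z :: "'g \<times> 'g"
  have \<psi>: "continuous_on UNIV (\<psi> k)" for k
    unfolding continuous_on_def
  proof (intro ballI tendstoI)
    fix z :: "'g \<times> 'g" and e :: real assume "e > 0"
    then obtain U V where U: "open U" "fst z \<in> U" "\<forall>y\<in>U. cnorm A (F k y \<ominus> F k (fst z)) < e/2"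
      and V: "open V" "snd z \<in> V" "\<forall>y\<in>V. cnorm A (F k y \<ominus> F k (snd z)) < e/2"
      using cont[of k] unfolding continuous_map_norm_topology_iff by (meson half_gt_zero)
    have "dist (\<psi> k y) (\<psi> k z) < e" if "y \<in> U \<times> V" for y
    proof -
      have 1: "cnorm A (F k (fst y) \<ominus> F k (fst z)) < e/2" "cnorm A (F k (snd y) \<ominus> F k (snd z)) < e/2"
        using U(3) V(3) that by auto
      have "\<psi> k y \<le> cnorm A (F k (fst y) \<ominus> F k (fst z)) + (\<psi> k z + cnorm A (F k (snd y) \<ominus> F k (snd z)))"
        unfolding \<psi>_def norm_minus_commute[OF Fc Fc, of k "snd y" k "snd z"]
        by (intro order_trans[OF norm_triangle_minus[of _ "F k (fst z)"]] add_left_mono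
            order_trans[OF norm_triangle_minus[of _ "F k (snd z)"]] order_refl Fc)
      moreover have "\<psi> k z \<le> cnorm A (F k (fst y) \<ominus> F k (fst z)) + (\<psi> k y + cnorm A (F k (snd y) \<ominus> F k (snd z)))"
        unfolding \<psi>_def norm_minus_commute[OF Fc Fc, of k "fst y" k "fst z"]
        by (intro order_trans[OF norm_triangle_minus[of _ "F k (fst y)"]] add_left_mono
            order_trans[OF norm_triangle_minus[of _ "F k (snd y)"]] order_refl Fc)
      ultimately show ?thesis using 1 by (simp add: dist_real_def abs_if)
    qed
    moreover have "\<forall>\<^sub>F y in at z. y \<in> U \<times> V"
      using U V by (intro eventually_at_in_open' open_Times) (auto simp: mem_Times_iff)
    ultimately show "\<forall>\<^sub>F y in at z within UNIV. dist (\<psi> k y) (\<psi> k z) < e"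
      by (auto elim: eventually_mono)
  qed
  define W where "W = (\<Inter>k. {z :: 'g \<times> 'g \<times> 'g. \<psi> k (fst (snd z) + fst z + snd (snd z), fst (snd z) + snd (snd z)) < e})"
  have "open W"
    unfolding W_def
  proof (intro open_INT ballI finite open_Collect_less continuous_on_const)
    fix k
    show "continuous_on UNIV (\<lambda>z :: 'g \<times> 'g \<times> 'g. \<psi> k (fst (snd z) + fst z + snd (snd z), fst (snd z) + snd (snd z)))"
      by (rule continuous_on_compose2[OF \<psi>]) (auto intro!: continuous_intros)
  qed
  moreover have "{0} \<times> UNIV \<subseteq> W"
    using Fc \<open>e > 0\<close> by (auto simp: W_def \<psi>_def a_minus_def r_neg)
  moreover have "compact (UNIV :: ('g \<times> 'g) set)"
    using compact_Times[OF comp comp] by simp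
  ultimately obtain V where V: "0 \<in> V" "open V" "V \<times> UNIV \<subseteq> W"
    using Elementary_Topology.tube_lemma[of UNIV W 0] by blast
  define U where "U h = {a :: 'g. - h + a \<in> V}" for h
  have "open (U h)" for h
  proof -
    have "U h = (\<lambda>a. - h + a) -` V" by (auto simp: U_def)
    then show ?thesis using V(2) by (auto intro!: open_vimage continuous_intros)
  qed
  moreover have "UNIV \<subseteq> (\<Union>h. U h)" using V(1) by (auto simp: U_def intro!: exI[of _ "_ :: 'g"])
  ultimately obtain H where H: "finite H" "UNIV \<subseteq> (\<Union>h\<in>H. U h)"
    using compactE_image[OF comp, of UNIV U] by auto
  have "translate_net e H F"
    unfolding translate_net_def
  proof (intro conjI allI)
    show "H \<noteq> {}" using H(2) by auto
    fix a
    obtain h where h: "h \<in> H" "- h + a \<in> V" using H(2) by (auto simp: U_def)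
    have "cnorm A (F k (p + a + q) \<ominus> F k (p + h + q)) \<le> e" for k p q
    proof -
      \<comment> \<open>The left parameter is taken to be \<open>p + h\<close>, so that
        \<open>p + h + (- h + a) + q\<close> is \<open>p + a + q\<close>.\<close>
      have "(- h + a, p + h, q) \<in> W" using V(3) h(2) by auto
      then have "\<psi> k (p + h + (- h + a) + q, p + h + q) < e" by (auto simp: W_def)
      moreover have "p + h + (- h + a) + q = p + a + q" by (simp add: add.assoc)
      ultimately show ?thesis by (simp add: \<psi>_def)
    qed
    then show "\<exists>h\<in>H. \<forall>k p q. cnorm A (F k (p + a + q) \<ominus> F k (p + h + q)) \<le> e"
      using h(1) by blast
  qed (rule H)
  then show ?thesis by blast
qed

text \<open>A net of precision 1 compares arbitrary values with those at finitely many
  points.\<close>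

lemma oscillation_bounded:
  fixes \<Phi> :: "'d::finite \<Rightarrow> 'g::group_add \<Rightarrow> 'a"
  assumes net: "translate_net 1 H \<Phi>" and c: "\<And>k g. \<Phi> k g \<in> carrier A"
  shows "\<exists>D. \<forall>k g g'. cnorm A (\<Phi> k g \<ominus> \<Phi> k g') \<le> D"
proof -
  define D where "D = (\<Sum>(k,h,h')\<in>UNIV \<times> H \<times> H. cnorm A (\<Phi> k h \<ominus> \<Phi> k h'))"
  have H: "finite H" using net by (simp add: translate_net_def)
  have D: "cnorm A (\<Phi> k h \<ominus> \<Phi> k h') \<le> D" if "h \<in> H" "h' \<in> H" for k h h'
    unfolding D_def using that H c
    by (intro order_trans[OF _ member_le_sum[of "(k,h,h')"]]) (auto simp: norm_ge_0)
  have "cnorm A (\<Phi> k g \<ominus> \<Phi> k g') \<le> 1 + D + 1" for k g g'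
  proof -
    obtain h where h: "h \<in> H" "\<And>k p q. cnorm A (\<Phi> k (p + g + q) \<ominus> \<Phi> k (p + h + q)) \<le> 1"
      using net unfolding translate_net_def by meson
    obtain h' where h': "h' \<in> H" "\<And>k p q. cnorm A (\<Phi> k (p + g' + q) \<ominus> \<Phi> k (p + h' + q)) \<le> 1"
      using net unfolding translate_net_def by meson
    show ?thesis
      using h(2)[of k 0 0] h'(2)[of k 0 0] D[OF h(1) h'(1), of k]
        norm_triangle_minus[of "\<Phi> k g" "\<Phi> k h" "\<Phi> k g'"]
        norm_triangle_minus[of "\<Phi> k h" "\<Phi> k h'" "\<Phi> k g'"]
        norm_minus_commute[of "\<Phi> k h'" "\<Phi> k g'"] c by simp
  qed
  then show ?thesis by blast
qed

text \<open>With one net of precision \<open>e/2\<close>, each averaging multiplies the excess of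
  the oscillation over \<open>e/2\<close> by a fixed factor below 1. The averages remain within
  \<open>D\<close> of all values of \<open>\<Phi>\<close> since they are convex combinations of such
  values; this controls the total displacement when the construction is repeated with smaller
  \<open>e\<close>.\<close>

lemma small_oscillation_mean:
  fixes \<Phi> :: "'d::finite \<Rightarrow> 'g::group_add \<Rightarrow> 'a"
  assumes net: "\<And>e. e > 0 \<Longrightarrow> \<exists>H. translate_net e H \<Phi>"
    and c: "\<And>k g. \<Phi> k g \<in> carrier A"
    and osc: "\<And>k g g'. cnorm A (\<Phi> k g \<ominus> \<Phi> k g') \<le> D"
    and "e > 0"
  shows "\<exists>H m. finite H \<and> H \<noteq> {} \<and>
    (\<forall>k g g'. cnorm A ((shift_mean H ^^ m) \<Phi> k g \<ominus> (shift_mean H ^^ m) \<Phi> k g') \<le> e) \<and>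
    (\<forall>k g g'. cnorm A ((shift_mean H ^^ m) \<Phi> k g \<ominus> \<Phi> k g') \<le> D)"
proof -
  obtain H where H: "translate_net (e/2) H \<Phi>" using net[of "e/2"] \<open>e > 0\<close> by auto
  have fH: "finite H" "H \<noteq> {}" using H by (auto simp: translate_net_def)
  then have cH: "card H > 0" by auto
  let ?S = "\<lambda>m. (shift_mean H ^^ m) \<Phi>" and ?r = "1 - 1 / real (card H)"
  have Sc: "?S m k g \<in> carrier A" for m k g
    by (induction m arbitrary: k g) (simp_all add: c shift_mean_def)
  have SH: "translate_net (e/2) H (?S m)" for m
    by (induction m) (simp_all add: H translate_net_shift_mean Sc fH)
  have So: "cnorm A (?S m k g \<ominus> ?S m k g') \<le> e/2 + ?r^m * (D - e/2)" for m k g g'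
  proof (induction m arbitrary: k g g')
    case (Suc m)
    show ?case
      using oscillation_shift_mean[OF SH Sc Suc, of k g g'] by (simp add: mult.assoc)
  qed (use osc in simp)
  have SD: "cnorm A (?S m k g \<ominus> \<Phi> k g') \<le> D" for m k g g'
  proof (induction m arbitrary: k g g')
    case (Suc m)
    then show ?case
      unfolding funpow.simps comp_def shift_mean_def[of H "?S m"] using fH Sc c
      by (intro norm_mean_minus_le_const) auto
  qed (use osc in simp)
  have lim: "(\<lambda>m. e/2 + ?r^m * (D - e/2)) \<longlonglongrightarrow> e/2 + 0 * (D - e/2)"
    using cH by (intro tendsto_intros LIMSEQ_power_zero) (auto simp: field_simps abs_if)
  have "\<forall>\<^sub>F m in sequentially. e/2 + ?r^m * (D - e/2) < e"
    by (rule order_tendstoD(2)[OF lim]) (use \<open>e > 0\<close> in simp)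
  then obtain m where m: "e/2 + ?r^m * (D - e/2) < e"
    by (auto simp: eventually_sequentially)
  have "cnorm A (?S m k g \<ominus> ?S m k g') \<le> e" for k g g'
    using So[of m k g g'] m by linarith
  then show ?thesis using fH SD by (intro exI[of _ H] exI[of _ m] conjI allI)
qed

text \<open>Oscillations and successive displacements both decay geometrically, so the averages
  converge to functions constant on the group. The property \<open>P\<close> carries whatever the
  averages must retain; it need not pass to limits, hence the approximating sequence is returned as
  well.\<close>

lemma invariant_mean_limit:
  fixes F :: "'d::finite \<Rightarrow> 'g::topological_group_add \<Rightarrow> 'a"
  assumes comp: "compact (UNIV :: 'g set)"
    and cont: "\<And>k. continuous_map euclidean (norm_topology A) (F k)"
    and PF: "P F"
    and Pc: "\<And>\<Phi> k g. P \<Phi> \<Longrightarrow> \<Phi> k g \<in> carrier A"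
    and Pmean: "\<And>\<Phi> H. P \<Phi> \<Longrightarrow> finite H \<Longrightarrow> H \<noteq> {} \<Longrightarrow> P (shift_mean H \<Phi>)"
  shows "\<exists>c \<Phi>. (\<forall>k. c k \<in> carrier A) \<and> (\<forall>n. P (\<Phi> n)) \<and>
    (\<forall>k g. (\<lambda>n. cnorm A (\<Phi> n k g \<ominus> c k)) \<longlonglongrightarrow> 0)"
proof -
  \<comment> \<open>The existence of nets for all precisions joins the invariant, so that the
    averaging can be restarted from each average.\<close>
  define G where "G \<Phi> \<longleftrightarrow> P \<Phi> \<and> (\<forall>e>0. \<exists>H. translate_net e H \<Phi>)" for \<Phi> :: "'d \<Rightarrow> 'g \<Rightarrow> 'a"
  have GF: "G F" using PF translate_net_exists[of _ F, OF comp _ cont] by (simp add: G_def)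
  have Gmean: "G (shift_mean H \<Phi>)" if G: "G \<Phi>" and H: "finite H" "H \<noteq> {}" for \<Phi> H
    unfolding G_def
  proof (intro conjI allI impI)
    have P: "P \<Phi>" using G by (simp add: G_def)
    then show "P (shift_mean H \<Phi>)" using H by (intro Pmean)
    fix e :: real assume "e > 0"
    then obtain K where "translate_net e K \<Phi>" using G by (auto simp: G_def)
    then have "translate_net e K (shift_mean H \<Phi>)"
      using Pc[OF P] H by (intro translate_net_shift_mean) auto
    then show "\<exists>K. translate_net e K (shift_mean H \<Phi>)" by blast
  qed
  have Gpow: "G ((shift_mean H ^^ m) \<Phi>)" if "G \<Phi>" "finite H" "H \<noteq> {}" for \<Phi> H m
    by (induction m) (simp_all add: that Gmean)
  have Gc: "\<Phi> k g \<in> carrier A" if "G \<Phi>" for \<Phi> k g using that Pc by (simp add: G_def)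
  have improve: "\<exists>\<Psi>. G \<Psi> \<and> (\<forall>k g g'. cnorm A (\<Psi> k g \<ominus> \<Psi> k g') \<le> e) \<and>
      (\<forall>k g g'. cnorm A (\<Psi> k g \<ominus> \<Phi> k g') \<le> D)"
    if G: "G \<Phi>" and osc: "\<forall>k g g'. cnorm A (\<Phi> k g \<ominus> \<Phi> k g') \<le> D" and e: "e > 0" for \<Phi> e D
  proof -
    have "\<exists>H m. finite H \<and> H \<noteq> {} \<and>
      (\<forall>k g g'. cnorm A ((shift_mean H ^^ m) \<Phi> k g \<ominus> (shift_mean H ^^ m) \<Phi> k g') \<le> e) \<and>
      (\<forall>k g g'. cnorm A ((shift_mean H ^^ m) \<Phi> k g \<ominus> \<Phi> k g') \<le> D)"
      using G osc e Gc by (intro small_oscillation_mean) (auto simp: G_def)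
    then obtain H m where "finite H" "H \<noteq> {}"
      "\<forall>k g g'. cnorm A ((shift_mean H ^^ m) \<Phi> k g \<ominus> (shift_mean H ^^ m) \<Phi> k g') \<le> e"
      "\<forall>k g g'. cnorm A ((shift_mean H ^^ m) \<Phi> k g \<ominus> \<Phi> k g') \<le> D"
      by (elim exE conjE)
    then show ?thesis
      using Gpow[OF G] by (intro exI[of _ "(shift_mean H ^^ m) \<Phi>"] conjI)
  qed
  obtain H where "translate_net 1 H F" using GF unfolding G_def by (meson zero_less_one)
  then obtain D where D: "\<forall>k g g'. cnorm A (F k g \<ominus> F k g') \<le> D"
    using oscillation_bounded[of H F] Gc[OF GF] by blast
  have "\<exists>\<Phi>. \<forall>n. (G (\<Phi> n) \<and> (\<forall>k g g'. cnorm A (\<Phi> n k g \<ominus> \<Phi> n k g') \<le> (1/2)^n)) \<and>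
      (\<forall>k g g'. cnorm A (\<Phi> (Suc n) k g \<ominus> \<Phi> n k g') \<le> (1/2)^n)"
  proof (rule dependent_nat_choice)
    show "\<exists>\<Psi>. G \<Psi> \<and> (\<forall>k g g'. cnorm A (\<Psi> k g \<ominus> \<Psi> k g') \<le> (1/2)^0)"
      using improve[OF GF D, of 1] by auto
    fix \<Phi> n assume "G \<Phi> \<and> (\<forall>k g g'. cnorm A (\<Phi> k g \<ominus> \<Phi> k g') \<le> (1/2)^n)"
    then show "\<exists>\<Psi>. (G \<Psi> \<and> (\<forall>k g g'. cnorm A (\<Psi> k g \<ominus> \<Psi> k g') \<le> (1/2)^Suc n)) \<and>
        (\<forall>k g g'. cnorm A (\<Psi> k g \<ominus> \<Phi> k g') \<le> (1/2)^n)"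
      using improve[of \<Phi> "(1/2)^n" "(1/2)^Suc n"] by auto
  qed
  then obtain \<Phi> where \<Phi>: "\<And>n. G (\<Phi> n)" "\<And>n k g g'. cnorm A (\<Phi> n k g \<ominus> \<Phi> n k g') \<le> (1/2)^n"
      "\<And>n k g g'. cnorm A (\<Phi> (Suc n) k g \<ominus> \<Phi> n k g') \<le> (1/2)^n"
    by blast
  note c = Gc[OF \<Phi>(1)]
  have "\<forall>k. \<exists>x\<in>carrier A. (\<lambda>n. cnorm A (\<Phi> n k 0 \<ominus> x)) \<longlonglongrightarrow> 0"
    using \<Phi>(3) c by (intro allI geometric_limit) auto
  then obtain x where x: "\<And>k. x k \<in> carrier A" "\<And>k. (\<lambda>n. cnorm A (\<Phi> n k 0 \<ominus> x k)) \<longlonglongrightarrow> 0"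
    by metis
  have "(\<lambda>n. cnorm A (\<Phi> n k g \<ominus> x k)) \<longlonglongrightarrow> 0" for k g
  \<comment> \<open>Convergence is arranged at the neutral element only; the vanishing oscillation
    carries it to every \<open>g\<close>.\<close>
  proof (rule tendsto_sandwich[where f = "\<lambda>_. 0" and h = "\<lambda>n. (1/2)^n + cnorm A (\<Phi> n k 0 \<ominus> x k)"])
    show "\<forall>\<^sub>F n in sequentially. cnorm A (\<Phi> n k g \<ominus> x k) \<le> (1/2)^n + cnorm A (\<Phi> n k 0 \<ominus> x k)"
      using norm_triangle_minus[OF c c x(1)] \<Phi>(2) by (intro always_eventually allI) (meson add_right_mono order_trans)
    have "(\<lambda>n. (1/2::real)^n + cnorm A (\<Phi> n k 0 \<ominus> x k)) \<longlonglongrightarrow> 0 + 0"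
      using x(2) by (intro tendsto_add LIMSEQ_power_zero) auto
    then show "(\<lambda>n. (1/2::real)^n + cnorm A (\<Phi> n k 0 \<ominus> x k)) \<longlonglongrightarrow> 0" by simp
  qed (use c x in \<open>auto simp: norm_ge_0\<close>)
  moreover have "P (\<Phi> n)" for n using \<Phi>(1) by (simp add: G_def)
  ultimately show ?thesis using x(1) by blast
qed

end

section \<open>Orthogonality of the generators\<close>

context unital_cstar_algebra
begin

lemma add_self_eq_smult: "x \<in> carrier A \<Longrightarrow> x \<oplus> x = 2 \<odot> x"
  using smult_left_distrib[of x 1 1] by (simp add: one_smult)

text \<open>The identity (1+w)^4 - (1-w)^4 = 8 (w + w^3) bounds \<open>w\<close> plus its cube when
  \<open>\<one> \<oplus> w\<close> and \<open>\<one> \<ominus> w\<close> are contractions.\<close>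

lemma fourth_power_diff:
  assumes w: "w \<in> carrier A"
  defines "u \<equiv> (\<one> \<oplus> w) \<otimes> (\<one> \<oplus> w)" and "v \<equiv> (\<one> \<ominus> w) \<otimes> (\<one> \<ominus> w)"
  shows "u \<otimes> u \<ominus> v \<otimes> v = 8 \<odot> (w \<oplus> w \<otimes> w \<otimes> w)"
proof -
  define p where "p = \<one> \<oplus> w \<otimes> w"
  define q where "q = w \<oplus> w"
  have c: "p \<in> carrier A" "q \<in> carrier A" using w by (simp_all add: p_def q_def)
  have comm: "q \<otimes> p = p \<otimes> q" using w by (simp add: p_def q_def noncomm_simps)
  have "u = p \<oplus> q" "v = p \<ominus> q"
    using w by (simp_all add: u_def v_def p_def q_def noncomm_simps)
  then have "u \<otimes> u \<ominus> v \<otimes> v = (p \<otimes> q \<oplus> p \<otimes> q) \<oplus> (p \<otimes> q \<oplus> p \<otimes> q)"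
    using c comm by (simp add: noncomm_simps)
  also have "\<dots> = 4 \<odot> (p \<otimes> q)"
    using c by (simp add: add_self_eq_smult smult_smult)
  also have "p \<otimes> q = 2 \<odot> (w \<oplus> w \<otimes> w \<otimes> w)"
    using w by (simp add: p_def q_def add_self_eq_smult smult_mult_right l_distr)
  finally show ?thesis using w by (simp add: smult_smult)
qed

lemma norm_fourth_power_diff:
  assumes w: "w \<in> carrier A" and "cnorm A (\<one> \<oplus> w) \<le> 1" "cnorm A (\<one> \<ominus> w) \<le> 1"
  shows "cnorm A (w \<oplus> w \<otimes> w \<otimes> w) \<le> 1/4"
proof -
  have sq: "cnorm A (z \<otimes> z) \<le> 1" if "z \<in> carrier A" "cnorm A z \<le> 1" for z
    using cnorm_mult[of z z] that mult_le_one[of "cnorm A z" "cnorm A z"] norm_ge_0[of z] by simp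
  have "cnorm A (8 \<odot> (w \<oplus> w \<otimes> w \<otimes> w)) \<le> 1 + 1"
    unfolding fourth_power_diff[OF w, symmetric] using assms
    by (intro order_trans[OF norm_minus add_mono] sq) auto
  then show ?thesis using w by (simp add: cnorm_smult)
qed

text \<open>The fourth power identity is used for \<open>y\<close> and for
  \<open>\<i> \<odot> y\<close>; the cubes enter with opposite signs and cancel in the sum. That
  \<open>\<one> \<oplus> \<i> \<odot> y\<close> is a contraction follows from the C*-identity, since
  \<open>\<one> \<oplus> y \<otimes> y\<close> is the mean of the squares of
  \<open>\<one> \<oplus> y\<close> and \<open>\<one> \<ominus> y\<close>.\<close>

lemma norm_le_quarter:
  assumes y: "y \<in> carrier A" "star A y = y" and n: "cnorm A (\<one> \<oplus> y) \<le> 1" "cnorm A (\<one> \<ominus> y) \<le> 1"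
  shows "cnorm A y \<le> 1/4"
proof -
  let ?w = "\<i> \<odot> y"
  have sq: "cnorm A (z \<otimes> z) \<le> 1" if "z \<in> carrier A" "cnorm A z \<le> 1" for z
    using cnorm_mult[of z z] that mult_le_one[of "cnorm A z" "cnorm A z"] norm_ge_0[of z] by simp
  have w: "?w \<in> carrier A" using y by simp
  have "(\<one> \<oplus> y) \<otimes> (\<one> \<oplus> y) \<oplus> (\<one> \<ominus> y) \<otimes> (\<one> \<ominus> y) = (\<one> \<oplus> y \<otimes> y) \<oplus> (\<one> \<oplus> y \<otimes> y)"
    using y by (simp add: noncomm_simps)
  also have "\<dots> = 2 \<odot> (\<one> \<oplus> y \<otimes> y)" using y by (simp add: add_self_eq_smult)
  finally have "cnorm A (2 \<odot> (\<one> \<oplus> y \<otimes> y)) \<le> 1 + 1"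
    using y n norm_add[of "(\<one> \<oplus> y) \<otimes> (\<one> \<oplus> y)" "(\<one> \<ominus> y) \<otimes> (\<one> \<ominus> y)"]
      sq[of "\<one> \<oplus> y"] sq[of "\<one> \<ominus> y"] by simp
  then have yy: "cnorm A (\<one> \<oplus> y \<otimes> y) \<le> 1" using y by (simp add: cnorm_smult)
  have sw: "star A (\<one> \<oplus> ?w) = \<one> \<ominus> ?w"
    using y by (simp add: star_simps uminus_smult a_minus_def)
  have "(\<one> \<ominus> ?w) \<otimes> (\<one> \<oplus> ?w) = \<one> \<ominus> ?w \<otimes> ?w"
    using w by (simp add: noncomm_simps del: smult_closed)
  also have "?w \<otimes> ?w = \<ominus> (y \<otimes> y)"
    using y by (simp add: smult_mult_left smult_mult_right smult_smult uminus_eq_smult)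
  finally have "cnorm A (\<one> \<oplus> ?w) \<le> 1"
    using cstar_identity[of "\<one> \<oplus> ?w"] yy y w norm_ge_0[of "\<one> \<oplus> ?w"]
    by (simp add: sw a_minus_def power_le_one_iff abs_le_square_iff[of _ 1, simplified, symmetric])
  moreover from this have "cnorm A (\<one> \<ominus> ?w) \<le> 1"
    using norm_star[of "\<one> \<oplus> ?w"] w by (simp add: sw)
  ultimately have 1: "cnorm A (?w \<oplus> ?w \<otimes> ?w \<otimes> ?w) \<le> 1/4"
    using w by (intro norm_fourth_power_diff)
  have "?w \<oplus> ?w \<otimes> ?w \<otimes> ?w = \<i> \<odot> (y \<ominus> y \<otimes> y \<otimes> y)"
    using y by (simp add: smult_mult_left smult_mult_right smult_smult smult_minus a_minus_def
        smult_right_distrib smult_uminus uminus_smult one_smult l_minus)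
  with 1 have 1: "cnorm A (y \<ominus> y \<otimes> y \<otimes> y) \<le> 1/4"
    using y by (simp add: cnorm_smult)
  have 2: "cnorm A (y \<oplus> y \<otimes> y \<otimes> y) \<le> 1/4"
    using y n by (intro norm_fourth_power_diff)
  have "(y \<ominus> y \<otimes> y \<otimes> y) \<oplus> (y \<oplus> y \<otimes> y \<otimes> y) = y \<oplus> y"
    using y(1) by (simp add: noncomm_simps)
  then have "cnorm A (2 \<odot> y) \<le> 1/4 + 1/4"
    using norm_add[of "y \<ominus> y \<otimes> y \<otimes> y" "y \<oplus> y \<otimes> y \<otimes> y"] 1 2 y by (simp add: add_self_eq_smult)
  then show ?thesis using y by (simp add: cnorm_smult)
qed

text \<open>With \<open>x\<^sup>2 (1 + y) = 1\<close> and \<open>j = y x\<^sup>2\<close> one has \<open>1 + 2y = (1 + y)\<^sup>2 (1 - j\<^sup>2)\<close>.\<close>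

lemma norm_one_plus_double:
  assumes y: "y \<in> carrier A" "star A y = y" "cnorm A y \<le> 1/5" and n: "cnorm A (\<one> \<oplus> y) \<le> 1"
  shows "cnorm A (\<one> \<oplus> 2 \<odot> y) \<le> 1"
proof -
  define a where "a = \<one> \<oplus> y"
  have a: "a \<in> carrier A" "star A a = a" using y by (simp_all add: a_def star_simps)
  have "a \<ominus> \<one> = y" using y by (simp add: a_def noncomm_simps)
  then obtain x where x: "x \<in> carrier A" "star A x = x" "cnorm A (x \<ominus> \<one>) \<le> 1/5" "x \<otimes> x \<otimes> a = \<one>"
    and bicomm: "\<And>z. z \<in> carrier A \<Longrightarrow> z \<otimes> a = a \<otimes> z \<Longrightarrow> z \<otimes> x = x \<otimes> z"
    using inverse_sqrt_self_adjoint[OF a] y(3) by auto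
  have ya: "y \<otimes> a = a \<otimes> y" using y by (simp add: a_def noncomm_simps)
  have yx: "y \<otimes> x = x \<otimes> y" using bicomm[OF y(1) ya] .
  define s where "s = x \<otimes> x"
  have s: "s \<in> carrier A" "star A s = s" "s \<otimes> a = \<one>" "y \<otimes> s = s \<otimes> y"
    using x y(1) yx by (simp_all add: s_def star_mult) (metis m_assoc)
  have as: "a \<otimes> s = \<one>"
    using s a y by (simp add: a_def l_distr r_distr)
  define j where "j = y \<otimes> s"
  have j: "j \<in> carrier A" "star A j = j" using s y by (simp_all add: j_def star_mult)
  \<comment> \<open>From 6/5 for \<open>x\<close> one gets 36/25 for its square and 36/125 for
    \<open>j\<close>, which is small enough for \<open>norm_one_minus_square\<close>.\<close>
  have "cnorm A x \<le> 6/5" using norm_le_near_one[OF x(1,3)] by simp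
  then have "cnorm A s \<le> 6/5 * (6/5)"
    unfolding s_def using x norm_ge_0 by (intro order_trans[OF cnorm_mult mult_mono]) auto
  then have "cnorm A j \<le> 1/5 * (6/5 * (6/5))"
    unfolding j_def using s y norm_ge_0 by (intro order_trans[OF cnorm_mult mult_mono]) auto
  then have "(cnorm A j)\<^sup>2 \<le> (1/5 * (6/5 * (6/5)))\<^sup>2"
    using j norm_ge_0 by (intro power_mono) auto
  then have "(cnorm A j)\<^sup>2 \<le> 1/5" by (simp add: power2_eq_square)
  then have nj: "cnorm A (\<one> \<ominus> j \<otimes> j) \<le> 1"
    using j by (intro norm_one_minus_square)
  have aj: "a \<otimes> j = y"
    using as ya s y a unfolding j_def by (metis m_assoc r_one)
  have "a \<otimes> (a \<otimes> (j \<otimes> j)) = a \<otimes> (y \<otimes> j)"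
    using a j aj by (metis m_assoc)
  also have "\<dots> = y \<otimes> y"
    using a j y ya aj by (metis m_assoc)
  finally have "a \<otimes> (a \<otimes> (\<one> \<ominus> j \<otimes> j)) = a \<otimes> a \<ominus> y \<otimes> y"
    using a j y by (simp add: a_minus_def r_distr r_minus)
  also have "\<dots> = \<one> \<oplus> (y \<oplus> y)"
    using y by (simp add: a_def noncomm_simps)
  finally have "cnorm A (\<one> \<oplus> 2 \<odot> y) = cnorm A (a \<otimes> (a \<otimes> (\<one> \<ominus> j \<otimes> j)))"
    using y by (simp add: add_self_eq_smult)
  also have "\<dots> \<le> cnorm A a * (cnorm A a * cnorm A (\<one> \<ominus> j \<otimes> j))"
    using a j norm_ge_0 by (intro order_trans[OF cnorm_mult] mult_left_mono cnorm_mult) auto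
  also have "\<dots> \<le> 1 * (1 * 1)"
    using n nj a j norm_ge_0 by (intro mult_mono) (auto simp: a_def)
  finally show ?thesis by simp
qed

text \<open>The element is a convex combination of \<open>\<one>\<close> and
  \<open>\<one> \<oplus> y\<close>.\<close>

lemma norm_one_plus_scale:
  assumes "y \<in> carrier A" "cnorm A (\<one> \<oplus> y) \<le> 1" "0 \<le> t" "t \<le> 1"
  shows "cnorm A (\<one> \<oplus> complex_of_real t \<odot> y) \<le> 1"
proof -
  have "\<one> = complex_of_real (1 - t) \<odot> \<one> \<oplus> complex_of_real t \<odot> \<one>"
    using smult_left_distrib[of \<one> "complex_of_real (1 - t)" "complex_of_real t"] by (simp add: one_smult)
  then have "\<one> \<oplus> complex_of_real t \<odot> y = complex_of_real (1 - t) \<odot> \<one> \<oplus> (complex_of_real t \<odot> \<one> \<oplus> complex_of_real t \<odot> y)"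
    using assms(1) by (metis a_assoc one_closed smult_closed iso_tuple_UNIV_I ring_of_type_algebra_simps(1))
  also have "\<dots> = complex_of_real (1 - t) \<odot> \<one> \<oplus> complex_of_real t \<odot> (\<one> \<oplus> y)"
    using assms(1) by (simp add: smult_right_distrib)
  finally have "cnorm A (\<one> \<oplus> complex_of_real t \<odot> y) \<le> (1 - t) * cnorm A \<one> + t * cnorm A (\<one> \<oplus> y)"
    using norm_add[of "complex_of_real (1 - t) \<odot> \<one>" "complex_of_real t \<odot> (\<one> \<oplus> y)"] assms
    by (simp add: cnorm_smult del: of_real_diff)
  also have "\<dots> \<le> (1 - t) * 1 + t * 1"
    using assms norm_one_le by (intro add_mono mult_left_mono) auto
  finally show ?thesis by simp
qed

text \<open>Shrinking \<open>y\<close> by 4/5 turns its automatic bound 1/4 into 1/5, after which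
  doubling is permitted. The net effect is the factor 8/5 > 1, so all (8/5)^n y satisfy the same
  hypotheses and hence the same bound 1/4, which forces \<open>y\<close> to vanish.\<close>

lemma one_extreme:
  assumes y: "y \<in> carrier A" "star A y = y" and n: "cnorm A (\<one> \<oplus> y) \<le> 1" "cnorm A (\<one> \<ominus> y) \<le> 1"
  shows "y = \<zero>"
proof -
  define c :: "nat \<Rightarrow> complex" where "c n = of_real ((8/5)^n)" for n
  have step: "cnorm A (\<one> \<oplus> (8/5) \<odot> z) \<le> 1"
    if z: "z \<in> carrier A" "star A z = z" "cnorm A (\<one> \<oplus> z) \<le> 1" "cnorm A (\<one> \<ominus> z) \<le> 1" for z
  proof -
    have "cnorm A (\<one> \<oplus> complex_of_real (4/5) \<odot> z) \<le> 1"
      using z by (intro norm_one_plus_scale) auto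
    moreover have "cnorm A ((4/5) \<odot> z) \<le> 1/5"
      using norm_le_quarter[OF z] z by (simp add: cnorm_smult norm_divide)
    ultimately have "cnorm A (\<one> \<oplus> 2 \<odot> ((4/5) \<odot> z)) \<le> 1"
      using z by (intro norm_one_plus_double) (simp_all add: star_smult)
    then show ?thesis using z by (simp add: smult_smult)
  qed
  have pos: "cnorm A (\<one> \<oplus> c n \<odot> y) \<le> 1 \<and> cnorm A (\<one> \<ominus> c n \<odot> y) \<le> 1" for n
  proof (induction n)
    case (Suc n)
    let ?z = "c n \<odot> y"
    have z: "?z \<in> carrier A" "star A ?z = ?z" using y by (simp_all add: star_smult c_def)
    have "cnorm A (\<one> \<oplus> (8/5) \<odot> ?z) \<le> 1" "cnorm A (\<one> \<oplus> (8/5) \<odot> (\<ominus> ?z)) \<le> 1"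
      using Suc z by (auto intro!: step simp: star_uminus a_minus_def)
    then show ?case
      using y by (simp add: c_def smult_smult smult_uminus a_minus_def)
  qed (use y n in \<open>simp add: c_def one_smult\<close>)
  have "(8/5)^n * cnorm A y \<le> 1/4" for n
  proof -
    have "cnorm A (c n \<odot> y) \<le> 1/4"
      using pos[of n] y by (intro norm_le_quarter) (auto simp: star_smult c_def)
    then show ?thesis using y by (simp add: c_def cnorm_smult norm_power)
  qed
  moreover have "\<exists>n. 1/4 < (8/5::real)^n * cnorm A y" if "cnorm A y > 0"
  proof -
    obtain n where "1/4 / cnorm A y < (8/5::real)^n"
      using real_arch_pow[of "8/5" "1/4 / cnorm A y"] by auto
    then show ?thesis using that by (auto simp: field_simps)
  qed
  ultimately have "cnorm A y = 0"
    using norm_ge_0[OF y(1)] by (metis linorder_not_le order_le_less)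
  then show ?thesis using y by (simp add: norm_eq_0)
qed

text \<open>The elements \<open>h l = s\<^sub>k\<^sup>* s\<^sub>l s\<^sub>l\<^sup>* s\<^sub>k\<close> sum to \<open>1 = h k\<close>, and each \<open>1 - 2 h l\<close> is a contraction.
  So the unit is a mean of contractions, which forces \<open>h j = 0\<close> for \<open>j \<noteq> k\<close>.\<close>

lemma cuntz_orthogonal:
  fixes s :: "'d::finite \<Rightarrow> 'a"
  assumes s: "cuntz_relations A s" and jk: "j \<noteq> k"
  shows "star A (s j) \<otimes> s k = \<zero>"
proof -
  have sc [simp]: "s l \<in> carrier A" and ss: "star A (s l) \<otimes> s l = \<one>" for l
    using s by (simp_all add: cuntz_relations_def)
  have sum1: "(\<Oplus>l\<in>UNIV. s l \<otimes> star A (s l)) = \<one>" using s by (simp add: cuntz_relations_def)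
  have sst [simp]: "star A (s l) \<in> carrier A" for l by (simp add: star_closed)
  define h where "h l = star A (s k) \<otimes> (s l \<otimes> star A (s l)) \<otimes> s k" for l
  have h: "h l \<in> carrier A" "star A (h l) = h l" for l
    by (simp_all add: h_def star_simps m_assoc)
  have "h k = (star A (s k) \<otimes> s k) \<otimes> (star A (s k) \<otimes> s k)"
    by (simp only: h_def m_assoc sc sst m_closed)
  then have hk: "h k = \<one>" by (simp add: ss)
  have "(\<Oplus>l\<in>UNIV. h l) = star A (s k) \<otimes> (\<Oplus>l\<in>UNIV. s l \<otimes> star A (s l)) \<otimes> s k"
    by (simp add: h_def finsum_rdistr finsum_ldistr)
  also have "\<dots> = \<one>" by (simp add: sum1 ss)
  finally have hsum: "(\<Oplus>l\<in>UNIV. h l) = \<one>" .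
  \<comment> \<open>The element \<open>p\<close> is a projection, so
    \<open>\<one> \<ominus> 2 \<odot> p\<close> is a self-adjoint unitary; compressing it by the
    isometry \<open>s k\<close> keeps it a contraction.\<close>
  have hn: "cnorm A (\<one> \<ominus> 2 \<odot> h l) \<le> 1" for l
  proof -
    define p where "p = s l \<otimes> star A (s l)"
    have p: "p \<in> carrier A" "star A p = p" by (simp_all add: p_def star_simps)
    have pp: "p \<otimes> p = p"
      unfolding p_def using ss[of l] by (metis m_assoc r_one sc sst m_closed l_one)
    have "(\<one> \<ominus> 2 \<odot> p) \<otimes> (\<one> \<ominus> 2 \<odot> p) = \<one>"
      using p pp by (simp add: noncomm_simps flip: add_self_eq_smult)
    then have "cnorm A (\<one> \<ominus> 2 \<odot> p) \<le> 1"
      using p by (intro norm_isometry_le_one) (simp_all add: star_simps)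
    moreover have "\<one> \<ominus> 2 \<odot> h l = star A (s k) \<otimes> ((\<one> \<ominus> 2 \<odot> p) \<otimes> s k)"
    proof -
      have "star A (s k) \<otimes> ((\<one> \<ominus> 2 \<odot> p) \<otimes> s k) = star A (s k) \<otimes> s k \<ominus> 2 \<odot> (star A (s k) \<otimes> (p \<otimes> s k))"
        using p(1) by (simp add: a_minus_def l_distr r_distr l_minus r_minus smult_mult_left smult_mult_right)
      then show ?thesis using p(1) by (simp add: ss h_def m_assoc flip: p_def)
    qed
    moreover have "cnorm A (star A (s k)) \<le> 1" "cnorm A (s k) \<le> 1"
      using norm_isometry_le_one[of "s k"] by (simp_all add: ss norm_star)
    ultimately show ?thesis
      using p norm_ge_0
        order_trans[OF cnorm_mult[of "star A (s k)" "(\<one> \<ominus> 2 \<odot> p) \<otimes> s k"]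
          mult_mono[OF _ order_trans[OF cnorm_mult[of "\<one> \<ominus> 2 \<odot> p" "s k"] mult_mono[of _ 1 _ 1]], of _ 1]]
      by simp
  qed
  \<comment> \<open>The mean is taken over all indices but \<open>j\<close>. Index \<open>k\<close>
    stays, with \<open>h' k = \<zero>\<close> contributing the contraction \<open>\<one>\<close>;
    this keeps \<open>L\<close> nonempty even when there are only two generators.\<close>
  define L where "L = (UNIV - {j} :: 'd set)"
  define h' where "h' l = (if l = k then \<zero> else h l)" for l
  have h': "h' l \<in> carrier A" for l using h by (simp add: h'_def)
  have kL: "k \<in> L" "finite L" using jk by (auto simp: L_def)
  have cL: "card L > 0" using kL by (auto simp: card_gt_0_iff)
  have split: "(\<Oplus>l\<in>UNIV. g l) = g k \<oplus> (g j \<oplus> (\<Oplus>l\<in>UNIV - {k, j}. g l))" if "\<And>l. g l \<in> carrier A" for g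
  proof -
    have "(UNIV :: 'd set) = insert k (insert j (UNIV - {k, j}))" by auto
    then have "(\<Oplus>l\<in>UNIV. g l) = (\<Oplus>l\<in>insert k (insert j (UNIV - {k, j})). g l)" by simp
    also have "\<dots> = g k \<oplus> (g j \<oplus> (\<Oplus>l\<in>UNIV - {k, j}. g l))"
      using jk that by (subst finsum_insert; simp add: finsum_insert Pi_iff)
    finally show ?thesis .
  qed
  let ?R = "\<Oplus>l\<in>UNIV - {k, j}. h l"
  have R: "?R \<in> carrier A" using h by (auto intro!: finsum_closed)
  have "\<one> \<oplus> (h j \<oplus> ?R) = \<one> \<oplus> \<zero>"
    using hsum split[of h] h by (simp add: hk)
  then have hR: "h j \<oplus> ?R = \<zero>" using R h add.l_cancel[of \<one> "h j \<oplus> ?R" \<zero>] by simp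
  have "(\<Oplus>l\<in>L. h' l) = (\<Oplus>l\<in>insert k (UNIV - {k, j}). h' l)"
    using jk by (intro finsum_cong') (auto simp: L_def h')
  also have "\<dots> = h' k \<oplus> (\<Oplus>l\<in>UNIV - {k, j}. h' l)"
    using h' by (subst finsum_insert) auto
  also have "(\<Oplus>l\<in>UNIV - {k, j}. h' l) = ?R"
    using h by (intro finsum_cong') (auto simp: h'_def)
  finally have L: "(\<Oplus>l\<in>L. h' l) = ?R" using R by (simp add: h'_def)
  define t where "t = 1 / real (card L)"
  have t: "0 < t" "t \<le> 1" using cL by (auto simp: t_def field_simps)
  have "mean L (\<lambda>l. \<one> \<ominus> 2 \<odot> h' l) = \<one> \<ominus> complex_of_real t \<odot> (2 \<odot> ?R)"
  proof -
    have "(\<Oplus>l\<in>L. 2 \<odot> h' l) = 2 \<odot> ?R"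
      using kL h' by (simp add: L flip: smult_finsum)
    then have "mean L (\<lambda>l. 2 \<odot> h' l) = complex_of_real t \<odot> (2 \<odot> ?R)"
      by (simp add: mean_def t_def)
    moreover have "mean L (\<lambda>l. \<one> \<ominus> 2 \<odot> h' l) = mean L (\<lambda>l. \<one>) \<ominus> mean L (\<lambda>l. 2 \<odot> h' l)"
      using kL h' by (subst mean_minus) auto
    moreover have "mean L (\<lambda>l. \<one>) = \<one>" using kL by (intro mean_const) auto
    ultimately show ?thesis by simp
  qed
  moreover have "cnorm A (mean L (\<lambda>l. \<one> \<ominus> 2 \<odot> h' l)) \<le> (\<Sum>l\<in>L. 1) / card L"
    using kL h' hn norm_one_le by (intro norm_mean_le) (auto simp: h'_def a_minus_def)
  \<comment> \<open>Since \<open>h k\<close> already exhausts the total \<open>\<one>\<close>, the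
    remaining terms cancel, and the mean becomes \<open>\<one>\<close> plus a positive multiple of
    \<open>h j\<close>. The matching contraction with a minus sign comes from \<open>hn\<close> and
    convexity, as \<open>one_extreme\<close> requires.\<close>
  moreover have "?R = \<ominus> h j" using hR R h by (metis add.inv_comm add.inv_equality minus_equality)
  ultimately have 1: "cnorm A (\<one> \<oplus> complex_of_real t \<odot> (2 \<odot> h j)) \<le> 1"
    using kL h by (simp add: smult_uminus a_minus_def split: if_splits)
  have "cnorm A (\<one> \<oplus> complex_of_real t \<odot> (\<ominus> (2 \<odot> h j))) \<le> 1"
    using hn[of j] h t by (intro norm_one_plus_scale) (auto simp: a_minus_def)
  then have 2: "cnorm A (\<one> \<ominus> complex_of_real t \<odot> (2 \<odot> h j)) \<le> 1"
    using h by (simp add: smult_uminus a_minus_def)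
  have "complex_of_real t \<odot> (2 \<odot> h j) = \<zero>"
    using h 1 2 by (intro one_extreme) (simp_all add: star_smult)
  then have "cnorm A (complex_of_real t \<odot> (2 \<odot> h j)) = 0" by simp
  then have "cnorm A (h j) = 0" using h t by (simp add: cnorm_smult)
  moreover have "h j = star A (star A (s j) \<otimes> s k) \<otimes> (star A (s j) \<otimes> s k)"
    by (simp add: h_def star_simps m_assoc)
  ultimately have "cnorm A (star A (s j) \<otimes> s k) = 0"
    using cstar_identity[of "star A (s j) \<otimes> s k"] by simp
  then show ?thesis by (simp add: norm_eq_0)
qed

end

section \<open>Rotation and perturbation of Cuntz families\<close>

lemma unitary_matrix_entries:
  fixes U :: "complex ^ 'd ^ 'd"
  assumes "unitary_matrix U"
  shows "(\<Sum>l\<in>UNIV. cnj (U $ l $ j) * U $ l $ k) = (if j = k then 1 else 0)"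
    and "(\<Sum>l\<in>UNIV. U $ j $ l * cnj (U $ k $ l)) = (if j = k then 1 else 0)"
proof -
  have "(map_matrix cnj (transpose U) ** U) $ j $ k = mat 1 $ j $ k"
    "(U ** map_matrix cnj (transpose U)) $ j $ k = mat 1 $ j $ k"
    using assms by (simp_all add: unitary_matrix_def)
  then show "(\<Sum>l\<in>UNIV. cnj (U $ l $ j) * U $ l $ k) = (if j = k then 1 else 0)"
    "(\<Sum>l\<in>UNIV. U $ j $ l * cnj (U $ k $ l)) = (if j = k then 1 else 0)"
    by (simp_all add: matrix_matrix_mult_def map_matrix_def transpose_def mat_def)
qed

lemma unitary_representation_zero:
  assumes "unitary_representation \<rho>"
  shows "\<rho> 0 = mat 1"
proof -
  let ?U = "map_matrix cnj (transpose (\<rho> 0))"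
  have u: "?U ** \<rho> 0 = mat 1" and m: "\<rho> 0 = \<rho> 0 ** \<rho> 0"
    using assms unfolding unitary_representation_def unitary_matrix_def by (blast, metis add.right_neutral)
  have "\<rho> 0 = (?U ** \<rho> 0) ** \<rho> 0" by (simp add: u)
  also have "\<dots> = ?U ** (\<rho> 0 ** \<rho> 0)" by (simp only: matrix_mul_assoc)
  also have "\<dots> = mat 1" by (simp flip: m add: u)
  finally show ?thesis .
qed

section \<open>Rows multiplied by unitary matrices\<close>

context unital_cstar_algebra
begin

lemma sum_smult:
  assumes "finite F" "x \<in> carrier A"
  shows "(\<Sum>i\<in>F. c i) \<odot> x = (\<Oplus>i\<in>F. c i \<odot> x)"
  using assms by (induction F) (simp_all add: smult_left_distrib Pi_iff)

lemma finsum_swap: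
  assumes "finite F" "finite H" "\<And>i j. i \<in> F \<Longrightarrow> j \<in> H \<Longrightarrow> f i j \<in> carrier A"
  shows "(\<Oplus>i\<in>F. \<Oplus>j\<in>H. f i j) = (\<Oplus>j\<in>H. \<Oplus>i\<in>F. f i j)"
  using assms
proof (induction F)
  case (insert i F)
  then have "(\<Oplus>i\<in>insert i F. \<Oplus>j\<in>H. f i j) = (\<Oplus>j\<in>H. f i j) \<oplus> (\<Oplus>j\<in>H. \<Oplus>i\<in>F. f i j)"
    by (subst finsum_insert) (auto intro!: finsum_closed)
  also have "\<dots> = (\<Oplus>j\<in>H. f i j \<oplus> (\<Oplus>i\<in>F. f i j))"
    using insert by (intro finsum_addf[symmetric]) (auto intro!: finsum_closed)
  also have "\<dots> = (\<Oplus>j\<in>H. \<Oplus>i\<in>insert i F. f i j)"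
    using insert by (intro finsum_cong') (auto simp: finsum_insert Pi_iff intro!: finsum_closed)
  finally show ?case .
qed (simp add: finsum_zero)

lemma finsum_delta_smult:
  fixes i :: "'i::finite"
  assumes "\<And>j. x j \<in> carrier A"
  shows "(\<Oplus>j\<in>UNIV. (if i = j then 1 else 0) \<odot> x j) = x i"
proof -
  have "(\<Oplus>j\<in>UNIV. (if i = j then 1 else 0) \<odot> x j) = (\<Oplus>j\<in>UNIV. if i = j then x j else \<zero>)"
    using assms by (intro finsum_cong') (auto simp: one_smult)
  also have "\<dots> = x i" using assms by (intro finsum_singleton) auto
  finally show ?thesis .
qed

lemma finsum_mult_finsum:
  fixes x :: "'i::finite \<Rightarrow> 'a" and y :: "'j::finite \<Rightarrow> 'a"
  assumes "\<And>i. x i \<in> carrier A" "\<And>j. y j \<in> carrier A"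
  shows "(\<Oplus>i\<in>UNIV. x i) \<otimes> (\<Oplus>j\<in>UNIV. y j) = (\<Oplus>i\<in>UNIV. \<Oplus>j\<in>UNIV. x i \<otimes> y j)"
proof -
  have y: "(\<Oplus>j\<in>UNIV. y j) \<in> carrier A" using assms by (auto intro!: finsum_closed)
  have "(\<Oplus>i\<in>UNIV. x i) \<otimes> (\<Oplus>j\<in>UNIV. y j) = (\<Oplus>i\<in>UNIV. x i \<otimes> (\<Oplus>j\<in>UNIV. y j))"
    using assms y by (intro finsum_ldistr) auto
  also have "\<dots> = (\<Oplus>i\<in>UNIV. \<Oplus>j\<in>UNIV. x i \<otimes> y j)"
    using assms by (intro finsum_cong') (auto simp: finsum_rdistr intro!: finsum_closed)
  finally show ?thesis .
qed

lemma star_finsum: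
  assumes "finite F" "\<And>i. i \<in> F \<Longrightarrow> x i \<in> carrier A"
  shows "star A (\<Oplus>i\<in>F. x i) = (\<Oplus>i\<in>F. star A (x i))"
  using assms
proof (induction F)
  case (insert i F)
  then have "(\<Oplus>i\<in>F. x i) \<in> carrier A" by (intro finsum_closed) auto
  moreover have "(\<Oplus>i\<in>insert i F. star A (x i)) = star A (x i) \<oplus> (\<Oplus>i\<in>F. star A (x i))"
    using insert by (subst finsum_insert) (auto simp: star_closed)
  ultimately show ?case
    using insert by (subst finsum_insert) (auto simp: star_add)
qed simp

definition row_mult :: "complex ^ 'd ^ 'd \<Rightarrow> ('d::finite \<Rightarrow> 'a) \<Rightarrow> 'd \<Rightarrow> 'a" where
  "row_mult U v k = (\<Oplus>j\<in>UNIV. (U $ j $ k) \<odot> v j)"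

lemma row_mult_closed [simp]: "(\<And>j. v j \<in> carrier A) \<Longrightarrow> row_mult U v k \<in> carrier A"
  by (auto simp: row_mult_def intro!: finsum_closed)

lemma row_mult_mat_1: "(\<And>j. v j \<in> carrier A) \<Longrightarrow> row_mult (mat 1) v k = v k"
  using finsum_delta_smult[of v k] by (simp add: row_mult_def mat_def eq_commute)

text \<open>A row is multiplied by matrices from the right, so the order reverses. An automorphism
  applied to a rotated row rotates the image of the row by the same matrix, and the two reversals
  make the quasifree maps compose like \<open>\<rho>\<close>.\<close>

lemma row_mult_row_mult:
  assumes v: "\<And>j. v j \<in> carrier A"
  shows "row_mult U (row_mult V v) k = row_mult (V ** U) v k"
proof -
  have "row_mult U (row_mult V v) k = (\<Oplus>j\<in>UNIV. \<Oplus>l\<in>UNIV. (U $ j $ k * V $ l $ j) \<odot> v l)"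
    using v by (simp add: row_mult_def smult_finsum smult_smult)
  also have "\<dots> = (\<Oplus>l\<in>UNIV. \<Oplus>j\<in>UNIV. (U $ j $ k * V $ l $ j) \<odot> v l)"
    using v by (intro finsum_swap) auto
  also have "\<dots> = row_mult (V ** U) v k"
    using v by (simp add: row_mult_def matrix_matrix_mult_def sum_smult mult.commute)
  finally show ?thesis .
qed

lemma mean_row_mult:
  assumes "finite H" "\<And>h j. h \<in> H \<Longrightarrow> x h j \<in> carrier A"
  shows "mean H (\<lambda>h. row_mult U (x h) k) = row_mult U (\<lambda>j. mean H (\<lambda>h. x h j)) k"
proof -
  let ?c = "1 / of_nat (card H) :: complex"
  have "mean H (\<lambda>h. row_mult U (x h) k) = (\<Oplus>h\<in>H. \<Oplus>j\<in>UNIV. (?c * U $ j $ k) \<odot> x h j)"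
    using assms unfolding mean_def row_mult_def
    by (subst smult_finsum) (auto simp: smult_finsum smult_smult intro!: finsum_closed finsum_cong')
  also have "\<dots> = (\<Oplus>j\<in>UNIV. \<Oplus>h\<in>H. (?c * U $ j $ k) \<odot> x h j)"
    using assms by (intro finsum_swap) auto
  also have "\<dots> = row_mult U (\<lambda>j. mean H (\<lambda>h. x h j)) k"
    using assms unfolding mean_def row_mult_def
    by (intro finsum_cong') (auto simp: smult_finsum smult_smult mult.commute intro!: finsum_closed finsum_cong')
  finally show ?thesis .
qed

lemma norm_row_mult_minus_le:
  assumes "\<And>j. v j \<in> carrier A" "\<And>j. w j \<in> carrier A"
  shows "cnorm A (row_mult U v k \<ominus> row_mult U w k) \<le> (\<Sum>j\<in>UNIV. cmod (U $ j $ k) * cnorm A (v j \<ominus> w j))"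
proof -
  have "row_mult U v k \<ominus> row_mult U w k = (\<Oplus>j\<in>UNIV. (U $ j $ k) \<odot> (v j \<ominus> w j))"
    using assms by (simp add: row_mult_def finsum_minus smult_minus)
  then show ?thesis
    using norm_finsum_le[of UNIV "\<lambda>j. (U $ j $ k) \<odot> (v j \<ominus> w j)"] assms by (simp add: cnorm_smult)
qed

lemma star_row_mult_mult_row_mult:
  assumes v: "\<And>j. v j \<in> carrier A"
  shows "star A (row_mult U v k) \<otimes> row_mult U v l =
    (\<Oplus>i\<in>UNIV. \<Oplus>j\<in>UNIV. (cnj (U $ i $ k) * U $ j $ l) \<odot> (star A (v i) \<otimes> v j))"
  using v by (simp add: row_mult_def star_finsum star_smult star_closed finsum_mult_finsum
      smult_mult_left smult_mult_right smult_smult mult.commute)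

lemma row_mult_mult_star_row_mult:
  assumes v: "\<And>j. v j \<in> carrier A"
  shows "row_mult U v k \<otimes> star A (row_mult U v l) =
    (\<Oplus>i\<in>UNIV. \<Oplus>j\<in>UNIV. (U $ i $ k * cnj (U $ j $ l)) \<odot> (v i \<otimes> star A (v j)))"
  using v by (simp add: row_mult_def star_finsum star_smult star_closed finsum_mult_finsum
      smult_mult_left smult_mult_right smult_smult mult.commute)

text \<open>The row times its adjoint does not see a unitary inserted in between. No relations on
  \<open>v\<close> enter, so the invariance holds for the approximate families as well.\<close>

lemma finsum_row_mult_star_row_mult:
  assumes U: "unitary_matrix U" and v: "\<And>j. v j \<in> carrier A"
  shows "(\<Oplus>k\<in>UNIV. row_mult U v k \<otimes> star A (row_mult U v k)) = (\<Oplus>k\<in>UNIV. v k \<otimes> star A (v k))"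
proof -
  let ?m = "\<lambda>i j. v i \<otimes> star A (v j)"
  have m: "?m i j \<in> carrier A" for i j using v by (simp add: star_closed)
  have "(\<Oplus>k\<in>UNIV. row_mult U v k \<otimes> star A (row_mult U v k)) =
      (\<Oplus>k\<in>UNIV. \<Oplus>i\<in>UNIV. \<Oplus>j\<in>UNIV. (U $ i $ k * cnj (U $ j $ k)) \<odot> ?m i j)"
    using v by (simp add: row_mult_mult_star_row_mult)
  also have "\<dots> = (\<Oplus>i\<in>UNIV. \<Oplus>k\<in>UNIV. \<Oplus>j\<in>UNIV. (U $ i $ k * cnj (U $ j $ k)) \<odot> ?m i j)"
    using m by (intro finsum_swap) (auto intro!: finsum_closed)
  also have "\<dots> = (\<Oplus>i\<in>UNIV. \<Oplus>j\<in>UNIV. \<Oplus>k\<in>UNIV. (U $ i $ k * cnj (U $ j $ k)) \<odot> ?m i j)"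
    using m by (intro finsum_cong' finsum_swap) (auto intro!: finsum_closed)
  also have "\<dots> = (\<Oplus>i\<in>UNIV. \<Oplus>j\<in>UNIV. (if i = j then 1 else 0) \<odot> ?m i j)"
    using m by (simp add: unitary_matrix_entries(2)[OF U] flip: sum_smult)
  also have "\<dots> = (\<Oplus>i\<in>UNIV. ?m i i)"
    using m by (simp add: finsum_delta_smult)
  finally show ?thesis .
qed

text \<open>In the isometry relation the rotation produces products of distinct generators, which
  disappear only by \<open>cuntz_orthogonal\<close>; afterwards the columns of \<open>U\<close>
  being unit vectors suffices.\<close>

lemma cuntz_relations_row_mult:
  assumes U: "unitary_matrix U" and s: "cuntz_relations A s"
  shows "cuntz_relations A (row_mult U s)"
  unfolding cuntz_relations_def
proof (intro conjI allI)
  have sc: "s j \<in> carrier A" for j using s by (simp add: cuntz_relations_def)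
  then show "row_mult U s j \<in> carrier A" for j by simp
  show "(\<Oplus>j\<in>UNIV. row_mult U s j \<otimes> star A (row_mult U s j)) = \<one>"
    using finsum_row_mult_star_row_mult[OF U sc] s by (simp add: cuntz_relations_def)
  fix k
  have orth: "star A (s i) \<otimes> s j = (if i = j then \<one> else \<zero>)" for i j
    using cuntz_orthogonal[OF s, of i j] s by (simp add: cuntz_relations_def)
  have "star A (row_mult U s k) \<otimes> row_mult U s k =
      (\<Oplus>i\<in>UNIV. \<Oplus>j\<in>UNIV. (if i = j then 1 else 0) \<odot> ((cnj (U $ i $ k) * U $ j $ k) \<odot> \<one>))"
    unfolding star_row_mult_mult_row_mult[OF sc] orth by (intro finsum_cong') (auto simp: one_smult intro!: finsum_closed finsum_cong')
  also have "\<dots> = (\<Oplus>i\<in>UNIV. (cnj (U $ i $ k) * U $ i $ k) \<odot> \<one>)"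
    by (simp add: finsum_delta_smult)
  also have "\<dots> = \<one>"
    by (simp add: unitary_matrix_entries(1)[OF U] one_smult flip: sum_smult)
  finally show "star A (row_mult U s k) \<otimes> row_mult U s k = \<one>" .
qed

text \<open>With \<open>v\<close> a row and \<open>a = v v\<^sup>*\<close>, the row \<open>b = a\<^sup>-\<^sup>1\<^sup>/\<^sup>2 v\<close> satisfies \<open>b b\<^sup>* = 1\<close> and
  \<open>v (1 - b\<^sup>* b) = 0\<close>. Hence \<open>1 - b\<^sup>* b = (1 - v\<^sup>* v) (1 - b\<^sup>* b)\<close>, which vanishes
  because \<open>1 - v\<^sup>* v\<close> is small.\<close>

lemma cuntz_perturbation:
  fixes v :: "'d::finite \<Rightarrow> 'a"
  assumes v: "\<And>j. v j \<in> carrier A"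
    and a1: "cnorm A ((\<Oplus>j\<in>UNIV. v j \<otimes> star A (v j)) \<ominus> \<one>) \<le> 1/5"
    and near: "\<And>j k. cnorm A ((if j = k then \<one> else \<zero>) \<ominus> star A (v j) \<otimes> v k) \<le> 1 / (2 * real CARD('d))"
  defines "a \<equiv> (\<Oplus>j\<in>UNIV. v j \<otimes> star A (v j))"
  shows "\<exists>x\<in>carrier A. star A x = x \<and> cnorm A (x \<ominus> \<one>) \<le> 1/5 \<and> x \<otimes> x \<otimes> a = \<one> \<and>
    (\<forall>z\<in>carrier A. z \<otimes> a = a \<otimes> z \<longrightarrow> z \<otimes> x = x \<otimes> z) \<and> cuntz_relations A (\<lambda>j. x \<otimes> v j)"
proof -
  have vs: "star A (v j) \<in> carrier A" for j using v by (simp add: star_closed)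
  have a: "a \<in> carrier A" using v vs by (auto simp: a_def intro!: finsum_closed)
  have sa: "star A a = a"
    using v vs by (simp add: a_def star_finsum star_mult star_star)
  obtain x where x: "x \<in> carrier A" "star A x = x" "cnorm A (x \<ominus> \<one>) \<le> 1/5" "x \<otimes> x \<otimes> a = \<one>"
    and bicomm: "\<And>z. z \<in> carrier A \<Longrightarrow> z \<otimes> a = a \<otimes> z \<Longrightarrow> z \<otimes> x = x \<otimes> z"
    using inverse_sqrt_self_adjoint[OF a sa] a1 by (auto simp: a_def)
  have ax: "a \<otimes> x = x \<otimes> a" using bicomm[OF a] by simp
  define b where "b j = x \<otimes> v j" for j
  have b: "b j \<in> carrier A" "star A (b j) \<in> carrier A" "star A (b j) = star A (v j) \<otimes> x" for j
    using v x by (simp_all add: b_def star_mult star_closed)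
  have bb: "(\<Oplus>j\<in>UNIV. b j \<otimes> star A (b j)) = \<one>"
  proof -
    have "(\<Oplus>j\<in>UNIV. b j \<otimes> star A (b j)) = (\<Oplus>j\<in>UNIV. x \<otimes> (v j \<otimes> star A (v j)) \<otimes> x)"
      using v vs x(1) by (intro finsum_cong') (simp_all add: b(3), simp add: b_def m_assoc)
    also have "\<dots> = x \<otimes> a \<otimes> x"
      using v vs x(1) by (simp add: a_def finsum_rdistr finsum_ldistr Pi_iff)
    also have "\<dots> = x \<otimes> x \<otimes> a" using x(1) a ax by (metis m_assoc)
    finally show ?thesis using x by simp
  qed
  define q where "q k l = (if k = l then \<one> else \<zero>) \<ominus> star A (b k) \<otimes> b l" for k l
  have q: "q k l \<in> carrier A" for k l using b by (simp add: q_def)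
  define w where "w j k = (if j = k then \<one> else \<zero>) \<ominus> star A (v j) \<otimes> v k" for j k
  have w: "w j k \<in> carrier A" for j k using v vs by (simp add: w_def)
  \<comment> \<open>The matrix \<open>q\<close> is the defect of \<open>b\<close> from having an
    initial projection equal to the identity. Multiplying \<open>v\<close> into it leaves
    \<open>v\<close> minus \<open>a\<close> times its inverse times \<open>v\<close>.\<close>
  have vq: "(\<Oplus>k\<in>UNIV. v k \<otimes> q k l) = \<zero>" for l
  proof -
    have "(\<Oplus>k\<in>UNIV. v k \<otimes> q k l) =
        (\<Oplus>k\<in>UNIV. (if l = k then 1 else 0) \<odot> v k \<ominus> v k \<otimes> star A (v k) \<otimes> (x \<otimes> (x \<otimes> v l)))"
    proof (intro finsum_cong')
      fix k
      have "v k \<otimes> (star A (b k) \<otimes> b l) = v k \<otimes> star A (v k) \<otimes> (x \<otimes> (x \<otimes> v l))"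
        unfolding b(3) using v vs x(1) by (simp add: b_def m_assoc)
      then show "v k \<otimes> q k l = (if l = k then 1 else 0) \<odot> v k \<ominus> v k \<otimes> star A (v k) \<otimes> (x \<otimes> (x \<otimes> v l))"
        using v b by (simp add: q_def a_minus_def r_distr r_minus one_smult)
    qed (use v vs x in auto)
    also have "\<dots> = (\<Oplus>k\<in>UNIV. (if l = k then 1 else 0) \<odot> v k) \<ominus> (\<Oplus>k\<in>UNIV. v k \<otimes> star A (v k) \<otimes> (x \<otimes> (x \<otimes> v l)))"
      using v vs x by (intro finsum_minus[symmetric]) auto
    also have "(\<Oplus>k\<in>UNIV. (if l = k then 1 else 0) \<odot> v k) = v l"
      using v by (rule finsum_delta_smult)
    also have "(\<Oplus>k\<in>UNIV. v k \<otimes> star A (v k) \<otimes> (x \<otimes> (x \<otimes> v l))) = a \<otimes> (x \<otimes> (x \<otimes> v l))"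
      using v vs x(1) by (simp add: a_def finsum_ldistr Pi_iff)
    also have "\<dots> = x \<otimes> x \<otimes> a \<otimes> v l"
      using v x(1) a ax by (metis m_assoc m_closed)
    also have "v l \<ominus> x \<otimes> x \<otimes> a \<otimes> v l = \<zero>"
      using x(4) v by (simp add: a_minus_def r_neg)
    finally show ?thesis .
  qed
  \<comment> \<open>By \<open>vq\<close>, the row \<open>v\<close> kills \<open>q\<close>, so
    \<open>q\<close> is unchanged when multiplied by the small matrix \<open>w\<close>.\<close>
  have qw: "q j l = (\<Oplus>k\<in>UNIV. w j k \<otimes> q k l)" for j l
  proof -
    have "(\<Oplus>k\<in>UNIV. w j k \<otimes> q k l) =
        (\<Oplus>k\<in>UNIV. (if j = k then 1 else 0) \<odot> q k l \<ominus> star A (v j) \<otimes> (v k \<otimes> q k l))"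
      using v vs q by (intro finsum_cong') (auto simp: w_def a_minus_def l_distr l_minus m_assoc one_smult)
    also have "\<dots> = (\<Oplus>k\<in>UNIV. (if j = k then 1 else 0) \<odot> q k l) \<ominus> (\<Oplus>k\<in>UNIV. star A (v j) \<otimes> (v k \<otimes> q k l))"
      using v vs q by (intro finsum_minus[symmetric]) auto
    also have "(\<Oplus>k\<in>UNIV. (if j = k then 1 else 0) \<odot> q k l) = q j l"
      using q by (rule finsum_delta_smult)
    also have "(\<Oplus>k\<in>UNIV. star A (v j) \<otimes> (v k \<otimes> q k l)) = star A (v j) \<otimes> \<zero>"
      using v vs q by (simp add: finsum_rdistr[symmetric] Pi_iff vq)
    finally show ?thesis using vs q by (simp add: a_minus_def)
  qed
  \<comment> \<open>The sum \<open>M\<close> of the norms in one column serves as a matrix norm: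
    with entries of \<open>w\<close> bounded by one half of the inverse number of generators,
    summing over the rows gives \<open>M \<le> M / 2\<close>.\<close>
  have q0: "q k l = \<zero>" for k l
  proof -
    define M where "M = (\<Sum>k\<in>UNIV. cnorm A (q k l))"
    have M0: "0 \<le> M" using q by (auto simp: M_def norm_ge_0 intro!: sum_nonneg)
    have le: "cnorm A (q j l) \<le> 1 / (2 * real CARD('d)) * M" for j
    proof -
      have "cnorm A (q j l) \<le> (\<Sum>k\<in>UNIV. cnorm A (w j k \<otimes> q k l))"
        using w q by (subst qw) (intro norm_finsum_le, auto)
      also have "\<dots> \<le> (\<Sum>k\<in>UNIV. 1 / (2 * real CARD('d)) * cnorm A (q k l))"
        using w q near norm_ge_0
        by (intro sum_mono order_trans[OF cnorm_mult mult_right_mono]) (auto simp: w_def)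
      also have "\<dots> = 1 / (2 * real CARD('d)) * M" by (simp add: M_def sum_distrib_left)
      finally show ?thesis .
    qed
    have "M \<le> (\<Sum>j\<in>(UNIV::'d set). 1 / (2 * real CARD('d)) * M)"
      unfolding M_def by (intro sum_mono) (use le in \<open>simp add: M_def\<close>)
    also have "\<dots> = M / 2" by simp
    finally have "M = 0" using M0 by simp
    then have "cnorm A (q k l) = 0"
      using q unfolding M_def by (subst (asm) sum_nonneg_eq_0_iff) (auto simp: norm_ge_0)
    then show ?thesis using q by (simp add: norm_eq_0)
  qed
  have "star A (b j) \<otimes> b j = \<one>" for j
    using q0[of j j] b by (simp add: q_def minus_eq_zero_iff)
  then have "cuntz_relations A b"
    using b bb by (simp add: cuntz_relations_def)
  then have "cuntz_relations A (\<lambda>j. x \<otimes> v j)" by (simp add: b_def[abs_def])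
  then show ?thesis using x bicomm by blast
qed

section \<open>Norm continuity expressed by limits, and its closure properties\<close>

definition norm_cont :: "('x::topological_space \<Rightarrow> 'a) \<Rightarrow> bool" where
  "norm_cont f \<longleftrightarrow> (\<forall>g. f g \<in> carrier A) \<and> (\<forall>g. ((\<lambda>h. cnorm A (f h \<ominus> f g)) \<longlongrightarrow> 0) (nhds g))"

lemma norm_cont_iff: "continuous_map euclidean (norm_topology A) f \<longleftrightarrow> norm_cont f"
proof (cases "\<forall>g. f g \<in> carrier A")
  case True
  then show ?thesis
    unfolding continuous_map_norm_topology_iff norm_cont_def tendsto_iff eventually_nhds
    by (simp add: norm_ge_0)
next
  case False
  then show ?thesis unfolding continuous_map_norm_topology_iff norm_cont_def by blast
qed

lemma norm_contI:
  assumes "\<And>g. f g \<in> carrier A"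
    and "\<And>g h. cnorm A (f h \<ominus> f g) \<le> b g h" "\<And>g. (b g \<longlongrightarrow> 0) (nhds g)"
  shows "norm_cont f"
  unfolding norm_cont_def
proof (intro conjI allI)
  fix g show "((\<lambda>h. cnorm A (f h \<ominus> f g)) \<longlongrightarrow> 0) (nhds g)"
    using assms norm_ge_0
    by (intro Lim_null_comparison[OF always_eventually assms(3)] allI) auto
qed fact

lemma norm_cont_closed: "norm_cont f \<Longrightarrow> f g \<in> carrier A"
  and norm_cont_tendsto: "norm_cont f \<Longrightarrow> ((\<lambda>h. cnorm A (f h \<ominus> f g)) \<longlongrightarrow> 0) (nhds g)"
  by (simp_all add: norm_cont_def)

lemma norm_cont_const: "x \<in> carrier A \<Longrightarrow> norm_cont (\<lambda>_. x)"
  by (simp add: norm_cont_def a_minus_def r_neg)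

lemma norm_cont_add:
  assumes f: "norm_cont f" and k: "norm_cont k"
  shows "norm_cont (\<lambda>g. f g \<oplus> k g)"
proof (rule norm_contI)
  note c = norm_cont_closed[OF f] norm_cont_closed[OF k]
  show "f g \<oplus> k g \<in> carrier A" for g using c by simp
  fix g h
  have "(f h \<oplus> k h) \<ominus> (f g \<oplus> k g) = (f h \<ominus> f g) \<oplus> (k h \<ominus> k g)"
    using c by (simp add: noncomm_simps)
  then show "cnorm A ((f h \<oplus> k h) \<ominus> (f g \<oplus> k g)) \<le> cnorm A (f h \<ominus> f g) + cnorm A (k h \<ominus> k g)"
    using norm_add[of "f h \<ominus> f g" "k h \<ominus> k g"] c by simp
next
  fix g
  show "((\<lambda>h. cnorm A (f h \<ominus> f g) + cnorm A (k h \<ominus> k g)) \<longlongrightarrow> 0) (nhds g)"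
    using tendsto_add[OF norm_cont_tendsto[OF f] norm_cont_tendsto[OF k]] by simp
qed

lemma norm_cont_mult:
  assumes f: "norm_cont f" and k: "norm_cont k"
  shows "norm_cont (\<lambda>g. f g \<otimes> k g)"
proof (rule norm_contI)
  note c = norm_cont_closed[OF f] norm_cont_closed[OF k]
  show "f g \<otimes> k g \<in> carrier A" for g using c by simp
  fix g h
  have "(f h \<otimes> k h) \<ominus> (f g \<otimes> k g) = (f h \<ominus> f g) \<otimes> k h \<oplus> f g \<otimes> (k h \<ominus> k g)"
    using c by (simp add: noncomm_simps)
  then have "cnorm A ((f h \<otimes> k h) \<ominus> (f g \<otimes> k g)) \<le> cnorm A ((f h \<ominus> f g) \<otimes> k h) + cnorm A (f g \<otimes> (k h \<ominus> k g))"
    using norm_add[of "(f h \<ominus> f g) \<otimes> k h" "f g \<otimes> (k h \<ominus> k g)"] c by simp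
  also have "\<dots> \<le> cnorm A (f h \<ominus> f g) * cnorm A (k h) + cnorm A (f g) * cnorm A (k h \<ominus> k g)"
    using c by (intro add_mono cnorm_mult) auto
  also have "\<dots> \<le> cnorm A (f h \<ominus> f g) * (cnorm A (k h \<ominus> k g) + cnorm A (k g)) + cnorm A (f g) * cnorm A (k h \<ominus> k g)"
    using c by (intro add_mono mult_left_mono norm_le_minus_add) (auto simp: norm_ge_0)
  finally show "cnorm A ((f h \<otimes> k h) \<ominus> (f g \<otimes> k g)) \<le>
    cnorm A (f h \<ominus> f g) * (cnorm A (k h \<ominus> k g) + cnorm A (k g)) + cnorm A (f g) * cnorm A (k h \<ominus> k g)" .
next
  fix g
  have "((\<lambda>h. cnorm A (f h \<ominus> f g) * (cnorm A (k h \<ominus> k g) + cnorm A (k g)) + cnorm A (f g) * cnorm A (k h \<ominus> k g))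
      \<longlongrightarrow> 0 * (0 + cnorm A (k g)) + cnorm A (f g) * 0) (nhds g)"
    by (intro tendsto_intros norm_cont_tendsto f k)
  then show "((\<lambda>h. cnorm A (f h \<ominus> f g) * (cnorm A (k h \<ominus> k g) + cnorm A (k g)) + cnorm A (f g) * cnorm A (k h \<ominus> k g))
      \<longlongrightarrow> 0) (nhds g)" by simp
qed

lemma norm_cont_smult:
  fixes c :: "'x::topological_space \<Rightarrow> complex"
  assumes c: "continuous_on UNIV c" and f: "norm_cont f"
  shows "norm_cont (\<lambda>g. c g \<odot> f g)"
proof -
  have "norm_cont (\<lambda>g. c g \<odot> \<one>)"
  proof (rule norm_contI)
    show "cnorm A (c h \<odot> \<one> \<ominus> c g \<odot> \<one>) \<le> cmod (c h - c g)" for g h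
      using mult_left_mono[OF norm_one_le, of "cmod (c h - c g)"]
      by (simp add: cnorm_smult flip: diff_smult)
    fix g
    have "(c \<longlongrightarrow> c g) (at g)" using c by (simp add: continuous_on_def)
    then have "(c \<longlongrightarrow> c g) (nhds g)" by (simp add: tendsto_at_iff_tendsto_nhds)
    then have "((\<lambda>h. c h - c g) \<longlongrightarrow> c g - c g) (nhds g)" by (intro tendsto_intros)
    then show "((\<lambda>h. cmod (c h - c g)) \<longlongrightarrow> 0) (nhds g)"
      by (simp add: tendsto_norm_zero)
  qed simp
  from norm_cont_mult[OF this f] show ?thesis
    using norm_cont_closed[OF f] by (simp add: smult_mult_left)
qed

lemma norm_cont_star:
  assumes f: "norm_cont f"
  shows "norm_cont (\<lambda>g. star A (f g))"
proof (rule norm_contI[OF _ _ norm_cont_tendsto[OF f]])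
  fix g h
  show "star A (f g) \<in> carrier A" using norm_cont_closed[OF f] by (simp add: star_closed)
  show "cnorm A (star A (f h) \<ominus> star A (f g)) \<le> cnorm A (f h \<ominus> f g)"
    using norm_star[of "f h \<ominus> f g"] norm_cont_closed[OF f] by (simp add: star_minus)
qed

lemma norm_cont_finsum:
  assumes "finite F" "\<And>i. i \<in> F \<Longrightarrow> norm_cont (f i)"
  shows "norm_cont (\<lambda>g. \<Oplus>i\<in>F. f i g)"
  using assms
proof (induction F)
  case (insert i F)
  then have "norm_cont (\<lambda>g. f i g \<oplus> (\<Oplus>i\<in>F. f i g))" by (intro norm_cont_add) auto
  moreover have "(\<Oplus>i\<in>insert i F. f i g) = f i g \<oplus> (\<Oplus>i\<in>F. f i g)" for g
    using insert.hyps insert.prems norm_cont_closed by (intro finsum_insert) auto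
  ultimately show ?case by simp
qed (simp add: norm_cont_const)

lemma norm_cont_row_mult:
  fixes U :: "'x::topological_space \<Rightarrow> complex ^ 'd ^ 'd::finite"
  assumes U: "continuous_on UNIV U" and v: "\<And>j. norm_cont (\<lambda>g. v g j)"
  shows "norm_cont (\<lambda>g. row_mult (U g) (v g) k)"
  unfolding row_mult_def using U v by (intro norm_cont_finsum norm_cont_smult) (auto intro!: continuous_intros)

end

context star_hom
begin

lemma hom_row_mult:
  assumes "\<And>j. v j \<in> carrier A"
  shows "f (A.row_mult U v k) = B.row_mult U (\<lambda>j. f (v j)) k"
  using assms by (simp add: A.row_mult_def B.row_mult_def hom_finsum hom_smult)

lemma hom_mean:
  assumes "finite H" "\<And>h. h \<in> H \<Longrightarrow> x h \<in> carrier A"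
  shows "f (A.mean H x) = B.mean H (\<lambda>h. f (x h))"
  using assms by (simp add: A.mean_def B.mean_def hom_finsum hom_smult A.finsum_closed Pi_iff)

end

section \<open>The quasifree action\<close>

lemma star_hom_compose:
  assumes "star_hom A B f" "star_hom B C g"
  shows "star_hom A C (\<lambda>x. g (f x))"
proof -
  interpret f: star_hom A B f by fact
  interpret g: star_hom B C g by fact
  show ?thesis
    using unital_star_hom_compose[OF f.A.unital_cstar_algebra_axioms f.star_hom g.star_hom]
    by (intro star_hom.intro star_hom_axioms.intro f.A.unital_cstar_algebra_axioms g.B.unital_cstar_algebra_axioms)
qed

lemma cuntz_hom_eqI:
  assumes A: "cuntz_algebra A s" and "star_hom A B f" "star_hom A B g"
    and "\<And>j. f (s j) = g (s j)" "x \<in> carrier A"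
  shows "f x = g x"
proof (rule star_hom_eqI[OF assms(2,3)])
  show "S = carrier A" if "unital_cstar_subalgebra S A" "range s \<subseteq> S" for S
    using A that unfolding cuntz_algebra_def by blast
  show "s j \<in> carrier A" for j
    using A unfolding cuntz_algebra_def cuntz_relations_def by blast
qed (use assms in auto)

lemma unital_G_algebra_star_hom:
  assumes "unital_G_algebra A \<alpha>"
  shows "star_hom A A (\<alpha> g)"
  using assms by (auto simp: unital_G_algebra_def cstar_aut_def intro!: star_hom.intro star_hom_axioms.intro)

text \<open>Each rotated family satisfies the Cuntz relations and so defines an endomorphism.
  Equality of homomorphisms may be tested on generators, which turns the group law of
  \<open>\<rho>\<close> into that of the endomorphisms and makes them invertible. Continuity spreads
  from the generators, because the points with continuous orbit form a closed subalgebra.\<close>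

lemma quasifree_action_exists:
  fixes A :: "'a cstar" and s :: "'d::finite \<Rightarrow> 'a"
    and \<rho> :: "'g::topological_group_add \<Rightarrow> complex ^ 'd ^ 'd"
  assumes \<rho>: "unitary_representation \<rho>" and A: "cuntz_algebra A s"
  shows "\<exists>\<beta>. unital_G_algebra A \<beta> \<and> (\<forall>g. \<beta> g \<in> extensional (carrier A)) \<and>
    (\<forall>g k. \<beta> g (s k) = (\<Oplus>\<^bsub>A\<^esub>j\<in>UNIV. (\<rho> g $ j $ k) \<odot>\<^bsub>A\<^esub> s j))"
proof -
  have Ac: "unital_cstar_algebra A" and s: "cuntz_relations A s"
    and gen: "\<And>S. unital_cstar_subalgebra S A \<Longrightarrow> range s \<subseteq> S \<Longrightarrow> S = carrier A"
    using A unfolding cuntz_algebra_def by blast+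
  interpret A: unital_cstar_algebra A by fact
  have sc [simp]: "s k \<in> carrier A" for k using s by (simp add: cuntz_relations_def)
  have U: "unitary_matrix (\<rho> g)" and mult: "\<rho> (g + h) = \<rho> g ** \<rho> h" for g h
    using \<rho> by (simp_all add: unitary_representation_def)
  have "\<forall>g. \<exists>f. star_hom A A f \<and> (\<forall>k. f (s k) = A.row_mult (\<rho> g) s k)"
    using cuntz_universal[OF A Ac A.cuntz_relations_row_mult[OF U s]] by blast
  then obtain f where f: "\<And>g. star_hom A A (f g)" and fs: "\<And>g k. f g (s k) = A.row_mult (\<rho> g) s k"
    by metis
  have fc [simp]: "f g x \<in> carrier A" if "x \<in> carrier A" for g x
    using star_hom.hom_closed[OF f] that .
  have f0: "f 0 x = x" if "x \<in> carrier A" for x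
  proof (rule cuntz_hom_eqI[OF A f _ _ that])
    show "star_hom A A (\<lambda>x. x)"
      by (intro star_hom.intro star_hom_axioms.intro Ac unital_star_hom_id)
  qed (simp add: fs unitary_representation_zero[OF \<rho>] A.row_mult_mat_1)
  have fadd: "f (g + h) x = f g (f h x)" if "x \<in> carrier A" for g h x
  proof (rule cuntz_hom_eqI[OF A f star_hom_compose[OF f f] _ that])
    fix k
    have "f g (f h (s k)) = A.row_mult (\<rho> h) (A.row_mult (\<rho> g) s) k"
      by (simp add: fs star_hom.hom_row_mult[OF f])
    then show "f (g + h) (s k) = f g (f h (s k))"
      by (simp add: fs mult A.row_mult_row_mult)
  qed
  \<comment> \<open>The maps from the universal property are arbitrary off the carrier; restriction
    gives the normal form required for uniqueness.\<close>
  define \<beta> where "\<beta> g = restrict (f g) (carrier A)" for g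
  have \<beta>: "\<beta> g x = f g x" if "x \<in> carrier A" for g x using that by (simp add: \<beta>_def)
  have hom: "\<beta> g \<in> unital_star_hom A A" for g
  proof -
    interpret star_hom A A "f g" by (rule f)
    show ?thesis
      by (rule unital_star_homI)
        (simp_all add: \<beta> hom_add hom_mult hom_smult hom_star A.star_closed)
  qed
  have bij: "bij_betw (\<beta> g) (carrier A) (carrier A)" for g
  proof (rule bij_betw_byWitness[of _ "f (- g)"])
    show "\<forall>x\<in>carrier A. f (- g) (\<beta> g x) = x"
      using fadd[of _ "- g" g] by (simp add: \<beta> f0)
    show "\<forall>x\<in>carrier A. \<beta> g (f (- g) x) = x"
      using fadd[of _ g "- g"] by (simp add: \<beta> f0)
  qed (auto simp: \<beta>)
  define S where "S = {x \<in> carrier A. A.norm_cont (\<lambda>g. f g x)}"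
  have hom_add: "f g (x \<oplus>\<^bsub>A\<^esub> y) = f g x \<oplus>\<^bsub>A\<^esub> f g y" and hom_mult: "f g (x \<otimes>\<^bsub>A\<^esub> y) = f g x \<otimes>\<^bsub>A\<^esub> f g y"
    if "x \<in> carrier A" "y \<in> carrier A" for g x y
    using that by (simp_all add: star_hom.hom_add[OF f] star_hom.hom_mult[OF f])
  have hom_smult: "f g (c \<odot>\<^bsub>A\<^esub> x) = c \<odot>\<^bsub>A\<^esub> f g x" and hom_star: "f g (star A x) = star A (f g x)"
    if "x \<in> carrier A" for g x c
    using that by (simp_all add: star_hom.hom_smult[OF f] star_hom.hom_star[OF f])
  note hom_simps = hom_add hom_mult hom_smult hom_star
  have S_smult: "c \<odot>\<^bsub>A\<^esub> x \<in> S" if "x \<in> S" for c x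
    using that A.norm_cont_smult[of "\<lambda>_. c" "\<lambda>g. f g x"] by (simp add: S_def hom_simps)
  have "unital_cstar_subalgebra S A"
    unfolding unital_cstar_subalgebra_def
  proof (intro conjI ballI allI)
    show "subring S A"
    proof (rule A.subringI)
      show "\<one>\<^bsub>A\<^esub> \<in> S" by (simp add: S_def star_hom.hom_one[OF f] A.norm_cont_const)
      show "\<ominus>\<^bsub>A\<^esub> x \<in> S" if "x \<in> S" for x
        using S_smult[OF that, of "-1"] that by (simp add: A.uminus_eq_smult S_def)
    qed (auto simp: S_def hom_simps intro: A.norm_cont_add A.norm_cont_mult)
    show "closedin (norm_topology A) S"
      unfolding A.closedin_iff
    proof (intro conjI ballI impI)
      fix x assume x: "x \<in> carrier A" and ap: "\<forall>e>0. \<exists>y\<in>S. cnorm A (x \<ominus>\<^bsub>A\<^esub> y) < e"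
      have "A.norm_cont (\<lambda>g. f g x)"
        unfolding A.norm_cont_def
      proof (intro conjI allI tendstoI)
        fix g and e :: real assume "e > 0"
        then obtain y where y: "y \<in> S" and xy: "cnorm A (x \<ominus>\<^bsub>A\<^esub> y) < e/3"
          using ap by (meson divide_pos_pos zero_less_numeral)
        have yc: "y \<in> carrier A" and ny: "A.norm_cont (\<lambda>g. f g y)" using y by (auto simp: S_def)
        have "\<forall>\<^sub>F h in nhds g. cnorm A (f h y \<ominus>\<^bsub>A\<^esub> f g y) < e/3"
          by (rule order_tendstoD(2)[OF A.norm_cont_tendsto[OF ny]]) (use \<open>e > 0\<close> in simp)
        then show "\<forall>\<^sub>F h in nhds g. dist (cnorm A (f h x \<ominus>\<^bsub>A\<^esub> f g x)) 0 < e"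
        proof eventually_elim
          \<comment> \<open>A three-term estimate whose outer terms are uniform in \<open>h\<close>,
            since every \<open>f h\<close> is contractive.\<close>
          case (elim h)
          have "cnorm A (f h x \<ominus>\<^bsub>A\<^esub> f g x) \<le> cnorm A (f h x \<ominus>\<^bsub>A\<^esub> f h y) + (cnorm A (f h y \<ominus>\<^bsub>A\<^esub> f g y) + cnorm A (f g y \<ominus>\<^bsub>A\<^esub> f g x))"
            using x yc by (intro order_trans[OF A.norm_triangle_minus[of _ "f h y"] add_left_mono] A.norm_triangle_minus) auto
          moreover have "cnorm A (f h x \<ominus>\<^bsub>A\<^esub> f h y) < e/3" "cnorm A (f g y \<ominus>\<^bsub>A\<^esub> f g x) < e/3"
            using star_hom.hom_dist[OF f x yc, of h] star_hom.hom_dist[OF f x yc, of g] xy x yc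
            by (simp_all add: A.norm_minus_commute[of "f g y"])
          ultimately show ?case using elim x A.norm_ge_0[of "f h x \<ominus>\<^bsub>A\<^esub> f g x"] by simp
        qed
      qed (use x in simp)
      then show "x \<in> S" using x by (simp add: S_def)
    qed (auto simp: S_def)
  qed (auto simp: S_smult, auto simp: S_def hom_simps A.star_closed intro: A.norm_cont_star)
  moreover have "s k \<in> S" for k
  proof -
    have "A.norm_cont (\<lambda>g. A.row_mult (\<rho> g) s k)"
      using \<rho> by (intro A.norm_cont_row_mult) (auto simp: unitary_representation_def A.norm_cont_const)
    then show ?thesis by (simp add: S_def fs)
  qed
  ultimately have "S = carrier A" by (intro gen) auto
  then have cont: "continuous_map euclidean (norm_topology A) (\<lambda>g. \<beta> g x)" if "x \<in> carrier A" for x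
    using that by (auto simp: A.norm_cont_iff \<beta> S_def)
  have "unital_G_algebra A \<beta>"
    using Ac hom bij cont by (auto simp: unital_G_algebra_def cstar_aut_def \<beta> f0 fadd)
  moreover have "\<beta> g \<in> extensional (carrier A)" for g by (simp add: \<beta>_def)
  ultimately show ?thesis
    by (intro exI[of _ \<beta>]) (simp add: \<beta> fs A.row_mult_def)
qed

text \<open>Existence alone does not unfold the definite description. Uniqueness combines agreement
  on the carrier, forced by the generators, with extensionality elsewhere.\<close>

lemma quasifree_action_props:
  fixes A :: "'a cstar" and s :: "'d::finite \<Rightarrow> 'a"
    and \<rho> :: "'g::topological_group_add \<Rightarrow> complex ^ 'd ^ 'd"
  assumes \<rho>: "unitary_representation \<rho>" and A: "cuntz_algebra A s"
  shows "unital_G_algebra A (quasifree_action A s \<rho>)"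
    and "quasifree_action A s \<rho> g (s k) = (\<Oplus>\<^bsub>A\<^esub>j\<in>UNIV. (\<rho> g $ j $ k) \<odot>\<^bsub>A\<^esub> s j)"
proof -
  let ?P = "\<lambda>\<beta>. unital_G_algebra A \<beta> \<and> (\<forall>g. \<beta> g \<in> extensional (carrier A)) \<and>
    (\<forall>g k. \<beta> g (s k) = (\<Oplus>\<^bsub>A\<^esub>j\<in>UNIV. (\<rho> g $ j $ k) \<odot>\<^bsub>A\<^esub> s j))"
  obtain \<beta> where \<beta>: "?P \<beta>" using quasifree_action_exists[OF \<rho> A] by blast
  note b = \<beta>[THEN conjunct1] \<beta>[THEN conjunct2, THEN conjunct1, rule_format]
    \<beta>[THEN conjunct2, THEN conjunct2, rule_format]
  have uniq: "\<beta>' = \<beta>" if \<beta>': "?P \<beta>'" for \<beta>'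
  proof
    fix g
    note b' = \<beta>'[THEN conjunct1] \<beta>'[THEN conjunct2, THEN conjunct1, rule_format]
      \<beta>'[THEN conjunct2, THEN conjunct2, rule_format]
    show "\<beta>' g = \<beta> g"
    proof (rule extensionalityI[OF b'(2) b(2)])
      fix x assume x: "x \<in> carrier A"
      show "\<beta>' g x = \<beta> g x"
        by (rule cuntz_hom_eqI[OF A unital_G_algebra_star_hom[OF b'(1)] unital_G_algebra_star_hom[OF b(1)] _ x])
          (simp only: b(3) b'(3))
    qed
  qed
  have P: "?P (quasifree_action A s \<rho>)"
    unfolding quasifree_action_def by (rule theI[of ?P, OF \<beta> uniq])
  show "unital_G_algebra A (quasifree_action A s \<rho>)"
    by (rule P[THEN conjunct1])
  show "quasifree_action A s \<rho> g (s k) = (\<Oplus>\<^bsub>A\<^esub>j\<in>UNIV. (\<rho> g $ j $ k) \<odot>\<^bsub>A\<^esub> s j)"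
    by (rule P[THEN conjunct2, THEN conjunct2, rule_format])
qed

section \<open>Increasing unions of ideals and maps between quotients\<close>

lemma (in unital_cstar_algebra) closed_ideal_closure_Union:
  assumes J: "\<And>n. closed_ideal (J n) A" and mono: "\<And>n. J n \<subseteq> J (Suc n)"
  shows "closed_ideal (norm_topology A closure_of (\<Union>n. J n)) A"
proof -
  have ideal: "ideal (J n) A" for n using J by (simp add: closed_ideal_def)
  have JA: "x \<in> carrier A" if "x \<in> J n" for x n
    using ideal.Icarr[OF ideal that] .
  then have sub: "(\<Union>n. J n) \<subseteq> carrier A" by auto
  let ?K = "norm_topology A closure_of (\<Union>n. J n)"
  have K: "x \<in> ?K \<longleftrightarrow> x \<in> carrier A \<and> (\<forall>e>0. \<exists>n. \<exists>y\<in>J n. cnorm A (x \<ominus> y) < e)" for x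
    by (simp add: closure_of_iff[OF sub])
  have Jmono: "J m \<subseteq> J n" if "m \<le> n" for m n
    by (rule lift_Suc_mono_le[of J, OF mono that])
  \<comment> \<open>The ideals are nested, so two elements of the union lie in a common
    ideal.\<close>
  have Jadd: "\<exists>k. x \<oplus> y \<in> J k" if "x \<in> J m" "y \<in> J n" for x y m n
  proof -
    have "x \<in> J (max m n)" "y \<in> J (max m n)"
      using that Jmono[of m "max m n"] Jmono[of n "max m n"] by auto
    then show ?thesis
      using additive_subgroup.a_closed[OF ideal.axioms(1)[OF ideal]] by blast
  qed
  have Kmult: "x \<otimes> z \<in> ?K" "z \<otimes> x \<in> ?K" if x: "x \<in> ?K" and z: "z \<in> carrier A" for x z
  proof -
    have xc: "x \<in> carrier A" using x K by blast
    have "\<exists>n. \<exists>y\<in>J n. cnorm A (x \<otimes> z \<ominus> y) < e" "\<exists>n. \<exists>y\<in>J n. cnorm A (z \<otimes> x \<ominus> y) < e" if e: "e > 0" for e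
    proof -
      have nz: "0 \<le> cnorm A z" using norm_ge_0 z by simp
      then have "e / (cnorm A z + 1) > 0" using e by simp
      then obtain n y where y: "y \<in> J n" "cnorm A (x \<ominus> y) < e / (cnorm A z + 1)"
        using x K by meson
      have yc: "y \<in> carrier A" using JA y by blast
      have lt: "cnorm A (x \<ominus> y) * cnorm A z < e"
      proof -
        have "cnorm A (x \<ominus> y) * cnorm A z \<le> cnorm A (x \<ominus> y) * (cnorm A z + 1)"
          using norm_ge_0[of "x \<ominus> y"] xc yc by (intro mult_left_mono) auto
        also have "\<dots> < e" using y(2) nz by (simp add: pos_less_divide_eq)
        finally show ?thesis .
      qed
      have "x \<otimes> z \<ominus> y \<otimes> z = (x \<ominus> y) \<otimes> z" "z \<otimes> x \<ominus> z \<otimes> y = z \<otimes> (x \<ominus> y)"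
        using xc yc z by (simp_all add: noncomm_simps)
      then have "cnorm A (x \<otimes> z \<ominus> y \<otimes> z) < e" "cnorm A (z \<otimes> x \<ominus> z \<otimes> y) < e"
        using cnorm_mult[of "x \<ominus> y" z] cnorm_mult[of z "x \<ominus> y"] xc yc z lt
        by (simp_all add: mult.commute)
      then show "\<exists>n. \<exists>y\<in>J n. cnorm A (x \<otimes> z \<ominus> y) < e" "\<exists>n. \<exists>y\<in>J n. cnorm A (z \<otimes> x \<ominus> y) < e"
        using ideal.I_l_closed[OF ideal y(1) z] ideal.I_r_closed[OF ideal y(1) z] by blast+
    qed
    then show "x \<otimes> z \<in> ?K" "z \<otimes> x \<in> ?K" using xc z K by blast+
  qed
  have Kadd: "x \<oplus> z \<in> ?K" if x: "x \<in> ?K" and z: "z \<in> ?K" for x z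
  proof -
    have c: "x \<in> carrier A" "z \<in> carrier A" using x z K by blast+
    have "\<exists>n. \<exists>y\<in>J n. cnorm A (x \<oplus> z \<ominus> y) < e" if "e > 0" for e
    proof -
      have "e/2 > 0" using that by simp
      then obtain m y n y' where y: "y \<in> J m" "cnorm A (x \<ominus> y) < e/2" "y' \<in> J n" "cnorm A (z \<ominus> y') < e/2"
        using x z K by meson
      have yc: "y \<in> carrier A" "y' \<in> carrier A" using JA y by blast+
      have "x \<oplus> z \<ominus> (y \<oplus> y') = (x \<ominus> y) \<oplus> (z \<ominus> y')"
        using c yc by (simp add: noncomm_simps)
      then have "cnorm A (x \<oplus> z \<ominus> (y \<oplus> y')) < e"
        using norm_add[of "x \<ominus> y" "z \<ominus> y'"] c yc y by simp
      then show ?thesis using Jadd y by blast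
    qed
    then show ?thesis using c K by blast
  qed
  have zeroK: "\<zero> \<in> ?K"
    unfolding K using additive_subgroup.zero_closed[OF ideal.axioms(1)[OF ideal[of 0]]]
    by (auto simp: a_minus_def intro!: exI[of _ 0] bexI[of _ \<zero>])
  have "ideal ?K A"
  proof (rule idealI[OF ring_axioms])
    show "subgroup ?K (add_monoid A)"
    proof (rule add.subgroupI)
      show "?K \<subseteq> carrier A" using K by blast
      show "?K \<noteq> {}" using zeroK by blast
      show "\<ominus> x \<in> ?K" if "x \<in> ?K" for x
        using Kmult(1)[OF that, of "\<ominus> \<one>"] that K[of x] by (simp add: r_minus)
    qed (rule Kadd)
  qed (use Kmult in auto)
  then show ?thesis by (simp add: closed_ideal_def)
qed

context cstar_ideal
begin

lemma image_coset:
  assumes f: "star_hom A A f" and fI: "f ` I = I" and x: "x \<in> carrier A"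
  shows "f ` (I +> x) = I +> f x"
proof -
  interpret f: star_hom A A f by fact
  have "f ` (I +> x) = (\<lambda>i. f i \<oplus> f x) ` I"
    using x I_carrier by (auto simp: a_r_coset_def' f.hom_add image_iff)
  also have "\<dots> = (\<lambda>i. i \<oplus> f x) ` (f ` I)" by (simp add: image_image)
  finally show ?thesis unfolding fI by (auto simp: a_r_coset_def')
qed

lemma star_hom_coset: "star_hom A Q (\<lambda>x. I +> x)"
  by (intro star_hom.intro star_hom_axioms.intro coset_star_hom unital_cstar_algebra_Q unital_cstar_algebra_axioms)

lemma star_hom_image:
  assumes f: "star_hom A A f" and fI: "f ` I = I"
  shows "star_hom Q Q (\<lambda>K. f ` K)"
proof -
  interpret f: star_hom A A f by fact
  have coset: "\<exists>x\<in>carrier A. K = I +> x" if "K \<in> carrier Q" for K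
    using that unfolding Q_carrier by blast
  have Qc: "I +> x \<in> carrier Q" if "x \<in> carrier A" for x
    using that unfolding Q_carrier by blast
  note simps = Qc Q_add Q_mult Q_one Q_smult Q_star image_coset[OF f fI]
    f.hom_add f.hom_mult f.hom_smult f.hom_star star_closed
  have "(\<lambda>K. f ` K) \<in> unital_star_hom Q Q"
  proof (rule unital_star_homI)
    fix K L c
    assume "K \<in> carrier Q"
    then obtain x where x: "x \<in> carrier A" "K = I +> x" using coset by blast
    show "f ` K \<in> carrier Q" "f ` (c \<odot>\<^bsub>Q\<^esub> K) = c \<odot>\<^bsub>Q\<^esub> f ` K" "f ` star Q K = star Q (f ` K)"
      by (simp_all only: x) (simp_all add: x(1) simps)
    assume "L \<in> carrier Q"
    then obtain y where y: "y \<in> carrier A" "L = I +> y" using coset by blast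
    show "f ` (K \<oplus>\<^bsub>Q\<^esub> L) = f ` K \<oplus>\<^bsub>Q\<^esub> f ` L" "f ` (K \<otimes>\<^bsub>Q\<^esub> L) = f ` K \<otimes>\<^bsub>Q\<^esub> f ` L"
      by (simp_all only: x y) (simp_all add: x(1) y(1) simps)
  qed (simp add: simps)
  then show ?thesis
    by (intro star_hom.intro star_hom_axioms.intro unital_cstar_algebra_Q)
qed

lemma set_add_coset:
  assumes K: "cstar_ideal A K" and sub: "I \<subseteq> K" and x: "x \<in> carrier A"
  shows "set_add A K (I +> x) = K +> x"
proof -
  interpret K: cstar_ideal A K by fact
  show ?thesis
  proof (intro equalityI subsetI)
    fix y assume "y \<in> set_add A K (I +> x)"
    then obtain k i where ki: "k \<in> K" "i \<in> I" "y = k \<oplus> (i \<oplus> x)"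
      by (auto simp: set_add_def' a_r_coset_def')
    then have "y = (k \<oplus> i) \<oplus> x" "k \<oplus> i \<in> K"
      using sub x K.I_carrier I_carrier by (auto simp: a_assoc intro!: K.a_closed)
    then show "y \<in> K +> x" by (auto simp: a_r_coset_def')
  next
    fix y assume "y \<in> K +> x"
    then show "y \<in> set_add A K (I +> x)"
      using coset_self[OF x] by (auto simp: set_add_def' a_r_coset_def' intro!: bexI)
  qed
qed

lemma star_hom_set_add:
  assumes K: "cstar_ideal A K" and sub: "I \<subseteq> K"
  shows "star_hom Q (cstar_quotient A K) (set_add A K)"
proof -
  interpret K: cstar_ideal A K by fact
  show ?thesis
    by (intro star_hom.intro star_hom_axioms.intro unital_cstar_algebra_Q K.unital_cstar_algebra_Q unital_star_homI)
      (auto simp: Q_carrier Q_add Q_mult Q_one Q_smult Q_star set_add_coset[OF K sub] star_closed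
        K.Q_carrier K.Q_add K.Q_mult K.Q_one K.Q_smult K.Q_star)
qed

lemma Q_norm_le_dist:
  assumes "x \<in> carrier A" "y \<in> I"
  shows "cnorm Q (I +> x) \<le> cnorm A (x \<ominus> y)"
proof (rule Q_norm_le[OF assms(1)])
  have y: "y \<in> carrier A" using assms(2) by (rule I_carrier)
  have "x \<ominus> y \<ominus> x = \<ominus> y" using assms(1) y by (simp add: noncomm_simps)
  then show "x \<ominus> y \<in> I +> x" using assms y I_uminus[of y] by (subst mem_coset_iff) simp_all
qed

end

section \<open>Equivariant semiprojectivity\<close>

text \<open>An arbitrary lift \<open>c0\<close> gives the functions \<open>F\<close>, whose Haar
  integral would be the invariant lift. All of them take values in the prescribed cosets, as
  \<open>t\<close> is equivariant in the quotient. Averages obey the same transformation law as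
  \<open>F\<close>; once they become constant in \<open>g\<close>, that law says precisely that the
  constants are equivariant.\<close>

lemma equivariant_lift:
  fixes C :: "'c cstar" and \<gamma> :: "'g::topological_group_add \<Rightarrow> 'c \<Rightarrow> 'c"
    and \<rho> :: "'g \<Rightarrow> complex ^ 'd ^ 'd::finite"
  assumes comp: "compact (UNIV :: 'g set)" and G: "unital_G_algebra C \<gamma>"
    and \<rho>: "unitary_representation \<rho>" and I: "cstar_ideal C I" and inv: "\<And>g. \<gamma> g ` I = I"
    and t: "\<And>k. t k \<in> carrier (cstar_quotient C I)"
    and eq: "\<And>g k. \<gamma> g ` t k = unital_cstar_algebra.row_mult (cstar_quotient C I) (\<rho> g) t k"
  shows "\<exists>c. (\<forall>k. c k \<in> carrier C \<and> I +>\<^bsub>C\<^esub> c k = t k) \<and>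
    (\<forall>g k. \<gamma> g (c k) = unital_cstar_algebra.row_mult C (\<rho> g) c k)"
proof -
  interpret I: cstar_ideal C I by fact
  interpret q: star_hom C I.Q "\<lambda>x. I +>\<^bsub>C\<^esub> x" by (rule I.star_hom_coset)
  note hom = unital_G_algebra_star_hom[OF G]
  have \<gamma>c [simp]: "\<gamma> g x \<in> carrier C" if "x \<in> carrier C" for g x
    using star_hom.hom_closed[OF hom that] .
  have \<gamma>add: "\<gamma> (g + h) x = \<gamma> g (\<gamma> h x)" if "x \<in> carrier C" for g h x
    using G that by (simp add: unital_G_algebra_def)
  have \<rho>mult: "\<rho> (g + h) = \<rho> g ** \<rho> h" for g h
    using \<rho> by (simp add: unitary_representation_def)
  have \<rho>inv: "\<rho> g ** \<rho> (- g) = mat 1" "\<rho> (- g) ** \<rho> g = mat 1" for g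
    using \<rho>mult[of g "- g"] \<rho>mult[of "- g" g] unitary_representation_zero[OF \<rho>] by simp_all
  have "\<forall>k. \<exists>x\<in>carrier C. t k = I +>\<^bsub>C\<^esub> x"
    using t by (auto simp: I.Q_carrier)
  then obtain c0 where c0 [simp]: "\<And>k. c0 k \<in> carrier C" and tc0: "\<And>k. t k = I +>\<^bsub>C\<^esub> c0 k"
    by metis
  define F where "F k g = I.row_mult (\<rho> (- g)) (\<lambda>j. \<gamma> g (c0 j)) k" for k g
  \<comment> \<open>Membership in the coset and the left transformation law, the two properties that
    right averaging preserves.\<close>
  define P where "P \<Phi> \<longleftrightarrow> (\<forall>k g. \<Phi> k g \<in> carrier C \<and> I +>\<^bsub>C\<^esub> \<Phi> k g = t k) \<and>
    (\<forall>k g h. \<Phi> k (g + h) = I.row_mult (\<rho> (- g)) (\<lambda>j. \<gamma> g (\<Phi> j h)) k)" for \<Phi> :: "'d \<Rightarrow> 'g \<Rightarrow> 'c"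
  have PF: "P F"
    unfolding P_def
  proof (intro conjI allI)
    fix k g h
    show "F k g \<in> carrier C" by (simp add: F_def)
    have "I +>\<^bsub>C\<^esub> \<gamma> g (c0 j) = q.B.row_mult (\<rho> g) t j" for j
      using I.image_coset[OF hom inv c0[of j]] eq[of g j] by (simp add: tc0)
    then have "I +>\<^bsub>C\<^esub> F k g = q.B.row_mult (\<rho> (- g)) (q.B.row_mult (\<rho> g) t) k"
      by (simp add: F_def q.hom_row_mult)
    then show "I +>\<^bsub>C\<^esub> F k g = t k"
      using t by (simp add: q.B.row_mult_row_mult \<rho>inv q.B.row_mult_mat_1)
    have "I.row_mult (\<rho> (- g)) (\<lambda>j. \<gamma> g (F j h)) k =
        I.row_mult (\<rho> (- g)) (I.row_mult (\<rho> (- h)) (\<lambda>j. \<gamma> g (\<gamma> h (c0 j)))) k"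
      by (simp add: F_def star_hom.hom_row_mult[OF hom])
    then show "F k (g + h) = I.row_mult (\<rho> (- g)) (\<lambda>j. \<gamma> g (F j h)) k"
      using \<rho>mult[of "- h" "- g"] by (simp add: F_def I.row_mult_row_mult \<gamma>add minus_add)
  qed
  have Pmean: "P (I.shift_mean H \<Phi>)" if P\<Phi>: "P \<Phi>" and H: "finite H" "H \<noteq> {}" for \<Phi> H
    unfolding P_def
  proof (intro conjI allI)
    have \<Phi>: "\<Phi> k g \<in> carrier C" "I +>\<^bsub>C\<^esub> \<Phi> k g = t k"
      "\<Phi> k (g + h) = I.row_mult (\<rho> (- g)) (\<lambda>j. \<gamma> g (\<Phi> j h)) k" for k g h
      using P\<Phi> unfolding P_def by blast+
    fix k g h
    show "I.shift_mean H \<Phi> k g \<in> carrier C" using \<Phi>(1) by (simp add: I.shift_mean_def)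
    show "I +>\<^bsub>C\<^esub> I.shift_mean H \<Phi> k g = t k"
      using H \<Phi>(1) t by (simp add: I.shift_mean_def q.hom_mean \<Phi>(2) q.B.mean_const)
    have "I.shift_mean H \<Phi> k (g + h) = I.mean H (\<lambda>l. I.row_mult (\<rho> (- g)) (\<lambda>j. \<gamma> g (\<Phi> j (h + l))) k)"
      by (simp add: I.shift_mean_def add.assoc \<Phi>(3)[of k g])
    also have "\<dots> = I.row_mult (\<rho> (- g)) (\<lambda>j. I.mean H (\<lambda>l. \<gamma> g (\<Phi> j (h + l)))) k"
      using H \<Phi>(1) by (intro I.mean_row_mult) auto
    also have "\<dots> = I.row_mult (\<rho> (- g)) (\<lambda>j. \<gamma> g (I.shift_mean H \<Phi> j h)) k"
      using H \<Phi>(1) by (simp add: I.shift_mean_def star_hom.hom_mean[OF hom])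
    finally show "I.shift_mean H \<Phi> k (g + h) = I.row_mult (\<rho> (- g)) (\<lambda>j. \<gamma> g (I.shift_mean H \<Phi> j h)) k" .
  qed
  have cont: "continuous_map euclidean (norm_topology C) (F k)" for k
  proof -
    have "continuous_on UNIV (\<lambda>g. \<rho> (- g))"
      by (rule continuous_on_compose2[of UNIV \<rho>])
        (use \<rho> in \<open>auto simp: unitary_representation_def intro!: continuous_intros\<close>)
    moreover have "I.norm_cont (\<lambda>g. \<gamma> g (c0 j))" for j
      using G by (simp add: unital_G_algebra_def flip: I.norm_cont_iff)
    ultimately have "I.norm_cont (\<lambda>g. I.row_mult (\<rho> (- g)) (\<lambda>j. \<gamma> g (c0 j)) k)"
      by (intro I.norm_cont_row_mult)
    then show ?thesis by (simp add: I.norm_cont_iff F_def[abs_def])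
  qed
  have "\<exists>c \<Phi>. (\<forall>k. c k \<in> carrier C) \<and> (\<forall>n. P (\<Phi> n)) \<and>
    (\<forall>k g. (\<lambda>n. cnorm C (\<Phi> n k g \<ominus>\<^bsub>C\<^esub> c k)) \<longlonglongrightarrow> 0)"
    by (rule I.invariant_mean_limit[OF comp cont PF _ Pmean]) (auto simp: P_def)
  then obtain c \<Phi> where c [simp]: "\<And>k. c k \<in> carrier C" and P\<Phi>: "\<And>n. P (\<Phi> n)"
    and lim: "\<And>k g. (\<lambda>n. cnorm C (\<Phi> n k g \<ominus>\<^bsub>C\<^esub> c k)) \<longlonglongrightarrow> 0"
    by blast
  have \<Phi>: "\<Phi> n k g \<in> carrier C" "I +>\<^bsub>C\<^esub> \<Phi> n k g = t k"
    "\<Phi> n k (g + h) = I.row_mult (\<rho> (- g)) (\<lambda>j. \<gamma> g (\<Phi> n j h)) k" for n k g h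
    using P\<Phi> unfolding P_def by blast+
  have ct: "I +>\<^bsub>C\<^esub> c k = t k" for k
  proof -
    have "cnorm I.Q (t k \<ominus>\<^bsub>I.Q\<^esub> (I +>\<^bsub>C\<^esub> c k)) \<le> 0"
    proof (rule LIMSEQ_le_const[OF lim[of k 0]], intro exI allI impI)
      show "cnorm I.Q (t k \<ominus>\<^bsub>I.Q\<^esub> (I +>\<^bsub>C\<^esub> c k)) \<le> cnorm C (\<Phi> n k 0 \<ominus>\<^bsub>C\<^esub> c k)" for n
        using q.hom_dist[of "\<Phi> n k 0" "c k"] \<Phi>(1) by (simp add: \<Phi>(2))
    qed
    then show ?thesis
      using t q.B.norm_ge_0[of "t k \<ominus>\<^bsub>I.Q\<^esub> (I +>\<^bsub>C\<^esub> c k)"]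
      by (metis c q.hom_closed q.B.minus_closed q.B.minus_eq_zero_iff q.B.norm_eq_0 order_antisym)
  qed
  \<comment> \<open>The law in \<open>P\<close> with \<open>h = 0\<close> passes to the limit: on
    the left the values at \<open>g\<close> converge, on the right those at 0, and both limits are
    \<open>c\<close>.\<close>
  have c_inv: "c k = I.row_mult (\<rho> (- g)) (\<lambda>j. \<gamma> g (c j)) k" for g k
  proof -
    let ?l = "I.row_mult (\<rho> (- g)) (\<lambda>j. \<gamma> g (c j)) k"
    define b where "b n = cnorm C (\<Phi> n k g \<ominus>\<^bsub>C\<^esub> c k) +
      (\<Sum>j\<in>UNIV. cmod (\<rho> (- g) $ j $ k) * cnorm C (\<Phi> n j 0 \<ominus>\<^bsub>C\<^esub> c j))" for n
    have "b \<longlonglongrightarrow> 0 + (\<Sum>j\<in>UNIV. cmod (\<rho> (- g) $ j $ k) * 0)"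
      unfolding b_def by (intro tendsto_intros lim)
    then have b0: "b \<longlonglongrightarrow> 0" by simp
    have "cnorm C (c k \<ominus>\<^bsub>C\<^esub> ?l) \<le> b n" for n
    proof -
      have "cnorm C (\<Phi> n k g \<ominus>\<^bsub>C\<^esub> ?l) \<le>
          (\<Sum>j\<in>UNIV. cmod (\<rho> (- g) $ j $ k) * cnorm C (\<gamma> g (\<Phi> n j 0) \<ominus>\<^bsub>C\<^esub> \<gamma> g (c j)))"
        using I.norm_row_mult_minus_le[of "\<lambda>j. \<gamma> g (\<Phi> n j 0)" "\<lambda>j. \<gamma> g (c j)" "\<rho> (- g)" k] \<Phi>(1) \<Phi>(3)[of n k g 0]
        by simp
      also have "\<dots> \<le> (\<Sum>j\<in>UNIV. cmod (\<rho> (- g) $ j $ k) * cnorm C (\<Phi> n j 0 \<ominus>\<^bsub>C\<^esub> c j))"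
        using \<Phi>(1) by (intro sum_mono mult_left_mono star_hom.hom_dist[OF hom]) auto
      finally show ?thesis
        using I.norm_triangle_minus[of "c k" "\<Phi> n k g" ?l] \<Phi>(1)
          I.norm_minus_commute[of "c k" "\<Phi> n k g"] by (simp add: b_def)
    qed
    then have "cnorm C (c k \<ominus>\<^bsub>C\<^esub> ?l) \<le> 0"
      by (intro LIMSEQ_le_const[OF b0]) auto
    then have "cnorm C (c k \<ominus>\<^bsub>C\<^esub> ?l) = 0"
      using I.norm_ge_0[of "c k \<ominus>\<^bsub>C\<^esub> ?l"] by simp
    then show ?thesis by (simp add: I.norm_eq_0 I.minus_eq_zero_iff)
  qed
  have "\<gamma> g (c k) = I.row_mult (\<rho> g) c k" for g k
  proof -
    have "c = I.row_mult (\<rho> (- g)) (\<lambda>j. \<gamma> g (c j))" by (rule ext) (rule c_inv)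
    then have "I.row_mult (\<rho> g) c k = I.row_mult (\<rho> g) (I.row_mult (\<rho> (- g)) (\<lambda>j. \<gamma> g (c j))) k"
      by (rule arg_cong[of _ _ "\<lambda>u. I.row_mult (\<rho> g) u k"])
    then show ?thesis by (simp add: I.row_mult_row_mult \<rho>inv I.row_mult_mat_1)
  qed
  then show ?thesis using ct by (intro exI[of _ c]) auto
qed

theorem corollary3p12:
  fixes A :: "'a cstar"
    and s :: "'d::finite \<Rightarrow> 'a"
    and \<rho> :: "'g::topological_group_add \<Rightarrow> complex ^ 'd ^ 'd"
  assumes "compact (UNIV :: 'g set)"
    and "unitary_representation \<rho>"
    and "cuntz_algebra A s"
  shows "equivariantly_semiprojective TYPE('c) A (quasifree_action A s \<rho>)"
  unfolding equivariantly_semiprojective_def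
proof (intro conjI allI impI, goal_cases)
  case 1
  show ?case using assms by (intro quasifree_action_props)
next
  case (2 C \<gamma> J K \<phi>)
  let ?\<alpha> = "quasifree_action A s \<rho>"
  note comp = assms(1) and \<rho> = assms(2) and A = assms(3)
  note \<alpha> = quasifree_action_props[OF \<rho> A]
  have G: "unital_G_algebra C \<gamma>" and J: "\<And>n. invariant_ideal (J n) C \<gamma>"
    and mono: "\<And>n. J n \<subseteq> J (Suc n)" and K: "K = norm_topology C closure_of (\<Union>n. J n)"
    and \<phi>: "\<phi> \<in> equivariant_hom A ?\<alpha> (cstar_quotient C K) (quotient_action \<gamma>)"
    using 2 by blast+
  have Ac: "unital_cstar_algebra A" and s: "cuntz_relations A s"
    using A unfolding cuntz_algebra_def by blast+
  interpret A: unital_cstar_algebra A by fact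
  have Cc: "unital_cstar_algebra C" using G by (simp add: unital_G_algebra_def)
  interpret C: unital_cstar_algebra C by fact
  have sc [simp]: "s k \<in> carrier A" for k using s by (simp add: cuntz_relations_def)
  note hom = unital_G_algebra_star_hom[OF G]
  have \<gamma>c [simp]: "\<gamma> g x \<in> carrier C" if "x \<in> carrier C" for g x
    using star_hom.hom_closed[OF hom that] .
  \<comment> \<open>Inclusion for every group element, applied to the inverse, gives the equality
    needed to map cosets onto cosets.\<close>
  have surj: "\<gamma> g ` L = L" if "\<And>g. \<gamma> g ` L \<subseteq> L" "L \<subseteq> carrier C" for g L
  proof
    show "L \<subseteq> \<gamma> g ` L"
    proof
      fix x assume x: "x \<in> L"
      then have "\<gamma> g (\<gamma> (- g) x) = x"
        using G that(2) unfolding unital_G_algebra_def by (metis add.right_inverse subsetD)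
      moreover have "\<gamma> (- g) x \<in> L" using that(1) x by blast
      ultimately show "x \<in> \<gamma> g ` L" by (metis imageI)
    qed
  qed (rule that)
  have J_ideal: "cstar_ideal C (J n)" for n
    using J[of n] Cc by (simp add: invariant_ideal_def cstar_ideal_def cstar_ideal_axioms_def)
  have JC: "J n \<subseteq> carrier C" for n
    using cstar_ideal.I_carrier[OF J_ideal] by blast
  have Jinv: "\<gamma> g ` J n = J n" for g n
    using J[of n] JC by (intro surj) (auto simp: invariant_ideal_def)
  have K_ideal: "cstar_ideal C K"
    using C.closed_ideal_closure_Union[of J] J mono Cc
    by (simp add: K invariant_ideal_def cstar_ideal_def cstar_ideal_axioms_def)
  interpret K: cstar_ideal C K by fact
  have UJ: "(\<Union>n. J n) \<subseteq> carrier C" using JC by blast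
  have mem_K: "x \<in> K \<longleftrightarrow> x \<in> carrier C \<and> (\<forall>e>0. \<exists>n. \<exists>y\<in>J n. cnorm C (x \<ominus>\<^bsub>C\<^esub> y) < e)" for x
    unfolding K C.closure_of_iff[OF UJ] by simp
  have JK: "J n \<subseteq> K" for n
    using UJ unfolding K by (metis UN_upper closure_of_subset order_trans UNIV_I C.topspace_mtopology norm_topology_def)
  have Kinv: "\<gamma> g ` K = K" for g
  proof (rule surj)
    fix g
    interpret g: star_hom C C "\<gamma> g" by (rule hom)
    show "\<gamma> g ` K \<subseteq> K"
    proof
      fix y assume "y \<in> \<gamma> g ` K"
      then obtain x where x: "x \<in> K" "y = \<gamma> g x" by blast
      have "\<exists>n. \<exists>z\<in>J n. cnorm C (\<gamma> g x \<ominus>\<^bsub>C\<^esub> z) < e" if e: "e > 0" for e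
      proof -
        obtain n z where z: "z \<in> J n" "cnorm C (x \<ominus>\<^bsub>C\<^esub> z) < e"
          using x(1) e mem_K by meson
        then have "cnorm C (\<gamma> g x \<ominus>\<^bsub>C\<^esub> \<gamma> g z) < e"
          using g.hom_dist[of x z] x JC K.I_carrier by fastforce
        moreover have "\<gamma> g z \<in> J n" using Jinv z by blast
        ultimately show ?thesis by blast
      qed
      then show "y \<in> K" using x K.I_carrier mem_K[of y] by simp
    qed
  qed (use K.I_carrier in blast)
  have \<phi>_hom: "star_hom A K.Q \<phi>" and \<phi>_eq: "\<phi> (?\<alpha> g x) = \<gamma> g ` \<phi> x" if "x \<in> carrier A" for g x
    using \<phi> that Ac K.unital_cstar_algebra_Q
    by (auto simp: equivariant_hom_def quotient_action_def intro!: star_hom.intro star_hom_axioms.intro)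
  interpret \<phi>: star_hom A K.Q \<phi> by (rule \<phi>_hom[OF A.one_closed])
  have \<alpha>s: "?\<alpha> g (s k) = A.row_mult (\<rho> g) s k" for g k by (simp add: \<alpha>(2) A.row_mult_def)
  have "\<exists>c. (\<forall>k. c k \<in> carrier C \<and> K +>\<^bsub>C\<^esub> c k = \<phi> (s k)) \<and> (\<forall>g k. \<gamma> g (c k) = C.row_mult (\<rho> g) c k)"
  proof (rule equivariant_lift[OF comp G \<rho> K_ideal Kinv])
    show "\<gamma> g ` \<phi> (s k) = \<phi>.B.row_mult (\<rho> g) (\<lambda>k. \<phi> (s k)) k" for g k
      using \<phi>_eq[of "s k" g] by (simp add: \<alpha>s \<phi>.hom_row_mult)
  qed simp
  then obtain c where c [simp]: "\<And>k. c k \<in> carrier C" and cK: "\<And>k. K +>\<^bsub>C\<^esub> c k = \<phi> (s k)"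
    and c\<gamma>: "\<And>g k. \<gamma> g (c k) = C.row_mult (\<rho> g) c k" by blast
  have cs [simp]: "star C (c k) \<in> carrier C" for k by (simp add: C.star_closed)
  interpret \<pi>: star_hom C K.Q "\<lambda>x. K +>\<^bsub>C\<^esub> x" by (rule K.star_hom_coset)
  define a where "a = (\<Oplus>\<^bsub>C\<^esub>j\<in>UNIV. c j \<otimes>\<^bsub>C\<^esub> star C (c j))"
  \<comment> \<open>\<open>w\<close> and \<open>a\<close> minus the unit measure how far the lifts
    are from a Cuntz family; both vanish modulo \<open>K\<close>, for \<open>w\<close> off the
    diagonal thanks to the orthogonality in \<open>A\<close>.\<close>
  define w where "w j k = (if j = k then \<one>\<^bsub>C\<^esub> else \<zero>\<^bsub>C\<^esub>) \<ominus>\<^bsub>C\<^esub> star C (c j) \<otimes>\<^bsub>C\<^esub> c k" for j k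
  have ac: "a \<in> carrier C" and wc: "w j k \<in> carrier C" for j k
    by (auto simp: a_def w_def intro!: C.finsum_closed)
  have \<pi>s: "K +>\<^bsub>C\<^esub> star C (c j) = \<phi> (star A (s j))" for j
    by (simp add: \<pi>.hom_star \<phi>.hom_star cK)
  have \<pi>a: "K +>\<^bsub>C\<^esub> a = \<one>\<^bsub>K.Q\<^esub>"
  proof -
    have "K +>\<^bsub>C\<^esub> a = \<phi> (\<Oplus>\<^bsub>A\<^esub>j\<in>UNIV. s j \<otimes>\<^bsub>A\<^esub> star A (s j))"
      by (simp add: a_def \<pi>.hom_finsum \<phi>.hom_finsum \<pi>.hom_mult \<phi>.hom_mult \<pi>s cK A.star_closed)
    then show ?thesis using s by (simp add: cuntz_relations_def)
  qed
  then have aK: "a \<ominus>\<^bsub>C\<^esub> \<one>\<^bsub>C\<^esub> \<in> K"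
    using ac K.coset_eq_iff[of a "\<one>\<^bsub>C\<^esub>"] by simp
  have wK: "w j k \<in> K" for j k
  proof -
    have "star A (s j) \<otimes>\<^bsub>A\<^esub> s k = (if j = k then \<one>\<^bsub>A\<^esub> else \<zero>\<^bsub>A\<^esub>)"
      using A.cuntz_orthogonal[OF s, of j k] s by (simp add: cuntz_relations_def)
    then have "K +>\<^bsub>C\<^esub> (star C (c j) \<otimes>\<^bsub>C\<^esub> c k) = \<phi> (if j = k then \<one>\<^bsub>A\<^esub> else \<zero>\<^bsub>A\<^esub>)"
      by (simp add: \<pi>.hom_mult \<pi>s cK A.star_closed flip: \<phi>.hom_mult)
    then have "K +>\<^bsub>C\<^esub> (if j = k then \<one>\<^bsub>C\<^esub> else \<zero>\<^bsub>C\<^esub>) = K +>\<^bsub>C\<^esub> (star C (c j) \<otimes>\<^bsub>C\<^esub> c k)"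
      by (simp split: if_splits)
    then show ?thesis
      by (subst (asm) K.coset_eq_iff) (auto simp: w_def)
  qed
  have Jmono: "J m \<subseteq> J n" if "m \<le> n" for m n
    by (rule lift_Suc_mono_le[of J, OF mono that])
  \<comment> \<open>The quotient norm modulo \<open>J n\<close> is bounded by the distance to any
    element of \<open>J n\<close>, and elements of \<open>K\<close> are approximated from the union
    of the nested ideals.\<close>
  have small: "\<forall>\<^sub>F n in sequentially. cnorm (cstar_quotient C (J n)) (J n +>\<^bsub>C\<^esub> x) \<le> e"
    if x: "x \<in> K" and e: "e > 0" for x e
  proof -
    obtain m y where y: "y \<in> J m" "cnorm C (x \<ominus>\<^bsub>C\<^esub> y) < e" using x e mem_K by meson
    have "cnorm (cstar_quotient C (J n)) (J n +>\<^bsub>C\<^esub> x) \<le> e" if "n \<ge> m" for n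
      using cstar_ideal.Q_norm_le_dist[OF J_ideal, of x y n] K.I_carrier[OF x] y Jmono[OF that] by force
    then show ?thesis by (auto simp: eventually_sequentially)
  qed
  have "\<forall>\<^sub>F n in sequentially. (\<forall>j\<in>UNIV. \<forall>k\<in>UNIV.
      cnorm (cstar_quotient C (J n)) (J n +>\<^bsub>C\<^esub> w j k) \<le> 1 / (2 * real CARD('d))) \<and>
      cnorm (cstar_quotient C (J n)) (J n +>\<^bsub>C\<^esub> (a \<ominus>\<^bsub>C\<^esub> \<one>\<^bsub>C\<^esub>)) \<le> 1/5"
    by (intro eventually_conj eventually_ball_finite ballI small wK aK finite_class.finite_UNIV) auto
  \<comment> \<open>Finitely many errors are made small at once; the thresholds are those of
    \<open>cuntz_perturbation\<close>.\<close>
  then obtain n where wn: "\<And>j k. cnorm (cstar_quotient C (J n)) (J n +>\<^bsub>C\<^esub> w j k) \<le> 1 / (2 * real CARD('d))"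
    and an: "cnorm (cstar_quotient C (J n)) (J n +>\<^bsub>C\<^esub> (a \<ominus>\<^bsub>C\<^esub> \<one>\<^bsub>C\<^esub>)) \<le> 1/5"
    unfolding eventually_sequentially by blast
  interpret J: cstar_ideal C "J n" by (rule J_ideal)
  interpret p: star_hom C J.Q "\<lambda>x. J n +>\<^bsub>C\<^esub> x" by (rule J.star_hom_coset)
  define v where "v k = J n +>\<^bsub>C\<^esub> c k" for k
  have v [simp]: "v k \<in> carrier J.Q" for k by (simp add: v_def)
  define b where "b = (\<Oplus>\<^bsub>J.Q\<^esub>j\<in>UNIV. v j \<otimes>\<^bsub>J.Q\<^esub> star J.Q (v j))"
  have pa: "J n +>\<^bsub>C\<^esub> a = b"
    by (simp add: a_def b_def v_def p.hom_finsum p.hom_mult p.hom_star)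
  have bc: "b \<in> carrier J.Q" using ac by (simp flip: pa)
  have b1: "cnorm J.Q (b \<ominus>\<^bsub>J.Q\<^esub> \<one>\<^bsub>J.Q\<^esub>) \<le> 1/5"
    using an ac by (simp add: p.hom_minus pa)
  have vv: "cnorm J.Q ((if j = k then \<one>\<^bsub>J.Q\<^esub> else \<zero>\<^bsub>J.Q\<^esub>) \<ominus>\<^bsub>J.Q\<^esub> star J.Q (v j) \<otimes>\<^bsub>J.Q\<^esub> v k) \<le> 1 / (2 * real CARD('d))" for j k
  proof -
    have "J n +>\<^bsub>C\<^esub> w j k = (if j = k then \<one>\<^bsub>J.Q\<^esub> else \<zero>\<^bsub>J.Q\<^esub>) \<ominus>\<^bsub>J.Q\<^esub> star J.Q (v j) \<otimes>\<^bsub>J.Q\<^esub> v k"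
      unfolding w_def by (subst p.hom_minus) (auto simp: v_def p.hom_mult p.hom_star)
    then show ?thesis using wn[of j k] by simp
  qed
  obtain x where x: "x \<in> carrier J.Q" "cnorm J.Q (x \<ominus>\<^bsub>J.Q\<^esub> \<one>\<^bsub>J.Q\<^esub>) \<le> 1/5"
      "x \<otimes>\<^bsub>J.Q\<^esub> x \<otimes>\<^bsub>J.Q\<^esub> b = \<one>\<^bsub>J.Q\<^esub>"
    and bicomm': "\<forall>z\<in>carrier J.Q. z \<otimes>\<^bsub>J.Q\<^esub> b = b \<otimes>\<^bsub>J.Q\<^esub> z \<longrightarrow> z \<otimes>\<^bsub>J.Q\<^esub> x = x \<otimes>\<^bsub>J.Q\<^esub> z"
    and rel: "cuntz_relations J.Q (\<lambda>j. x \<otimes>\<^bsub>J.Q\<^esub> v j)"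
    using p.B.cuntz_perturbation[of v, OF v b1[unfolded b_def] vv, folded b_def]
    by (elim bexE conjE)
  note bicomm = bicomm'[rule_format]
  obtain \<psi> where \<psi>: "star_hom A J.Q \<psi>" and \<psi>s: "\<And>j. \<psi> (s j) = x \<otimes>\<^bsub>J.Q\<^esub> v j"
    using cuntz_universal[OF A J.unital_cstar_algebra_Q rel] by blast
  interpret \<psi>: star_hom A J.Q \<psi> by (rule \<psi>)
  have equi: "\<psi> (?\<alpha> g y) = \<gamma> g ` \<psi> y" if y: "y \<in> carrier A" for g y
  proof -
    have \<sigma>_hom: "star_hom J.Q J.Q ((`) (\<gamma> g))"
      using J.star_hom_image[OF hom Jinv] by simp
    interpret \<sigma>: star_hom J.Q J.Q "(`) (\<gamma> g)" by (rule \<sigma>_hom)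
    have \<sigma>v: "\<gamma> g ` v k = p.B.row_mult (\<rho> g) v k" for k
      using J.image_coset[OF hom Jinv c[of k]] by (simp add: v_def[abs_def] c\<gamma> p.hom_row_mult)
    have "\<gamma> g ` b = (\<Oplus>\<^bsub>J.Q\<^esub>j\<in>UNIV. p.B.row_mult (\<rho> g) v j \<otimes>\<^bsub>J.Q\<^esub> star J.Q (p.B.row_mult (\<rho> g) v j))"
      by (simp add: b_def \<sigma>.hom_finsum \<sigma>.hom_mult \<sigma>.hom_star \<sigma>v p.B.star_closed)
    also have "\<dots> = b"
      using \<rho> by (simp add: b_def p.B.finsum_row_mult_star_row_mult unitary_representation_def)
    finally have \<sigma>b: "\<gamma> g ` b = b" .
    have "b \<otimes>\<^bsub>J.Q\<^esub> x = x \<otimes>\<^bsub>J.Q\<^esub> b" using bicomm[OF bc] by simp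
    then have "\<gamma> g ` x \<otimes>\<^bsub>J.Q\<^esub> b = b \<otimes>\<^bsub>J.Q\<^esub> \<gamma> g ` x"
      using \<sigma>.hom_mult[of x b] \<sigma>.hom_mult[of b x] x(1) bc by (simp add: \<sigma>b)
    \<comment> \<open>As \<open>b\<close> is invariant, the image of \<open>x\<close> commutes with
      \<open>b\<close>, hence with \<open>x\<close>, which lies in the bicommutant of
      \<open>b\<close>. Uniqueness of inverse square roots now makes \<open>x\<close> invariant, so
      multiplying by it does not disturb the rotation law of \<open>v\<close>.\<close>
    then have comm: "\<gamma> g ` x \<otimes>\<^bsub>J.Q\<^esub> x = x \<otimes>\<^bsub>J.Q\<^esub> \<gamma> g ` x"
      by (rule bicomm[OF \<sigma>.hom_closed[OF x(1)]])
    have near: "cnorm J.Q (\<gamma> g ` x \<ominus>\<^bsub>J.Q\<^esub> \<one>\<^bsub>J.Q\<^esub>) \<le> 1/5"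
      using \<sigma>.hom_dist[of x "\<one>\<^bsub>J.Q\<^esub>"] x by simp
    have sq: "\<gamma> g ` x \<otimes>\<^bsub>J.Q\<^esub> \<gamma> g ` x \<otimes>\<^bsub>J.Q\<^esub> b = \<one>\<^bsub>J.Q\<^esub>"
      using arg_cong[OF x(3), of "(`) (\<gamma> g)"] x(1) bc by (simp add: \<sigma>.hom_mult \<sigma>b)
    have \<sigma>x: "\<gamma> g ` x = x"
      by (rule p.B.inverse_sqrt_unique[OF bc \<sigma>.hom_closed[OF x(1)] x(1) b1 near x(2) sq x(3) comm])
    show ?thesis
    proof (rule cuntz_hom_eqI[OF A star_hom_compose[OF unital_G_algebra_star_hom[OF \<alpha>(1)] \<psi>]
          star_hom_compose[OF \<psi> \<sigma>_hom] _ y])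
      fix k
      have "\<psi> (?\<alpha> g (s k)) = p.B.row_mult (\<rho> g) (\<lambda>j. x \<otimes>\<^bsub>J.Q\<^esub> v j) k"
        by (simp add: \<alpha>s \<psi>.hom_row_mult \<psi>s)
      also have "\<dots> = x \<otimes>\<^bsub>J.Q\<^esub> p.B.row_mult (\<rho> g) v k"
        using x(1) by (simp add: p.B.row_mult_def p.B.finsum_rdistr p.B.smult_mult_right Pi_iff)
      finally show "\<psi> (?\<alpha> g (s k)) = \<gamma> g ` \<psi> (s k)"
        using x(1) by (simp add: \<psi>s \<sigma>.hom_mult \<sigma>x \<sigma>v)
    qed
  qed
  have lift: "set_add C K (\<psi> y) = \<phi> y" if y: "y \<in> carrier A" for y
  proof -
    have \<tau>_hom: "star_hom J.Q K.Q (set_add C K)" by (rule J.star_hom_set_add[OF K_ideal JK])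
    interpret \<tau>: star_hom J.Q K.Q "set_add C K" by (rule \<tau>_hom)
    have \<tau>: "set_add C K (J n +>\<^bsub>C\<^esub> z) = K +>\<^bsub>C\<^esub> z" if "z \<in> carrier C" for z
      by (rule J.set_add_coset[OF K_ideal JK that])
    have \<tau>b: "set_add C K b = \<one>\<^bsub>K.Q\<^esub>" using \<tau>[OF ac] by (simp add: pa \<pi>a)
    \<comment> \<open>In the limit quotient the lifts satisfy the relations exactly, so
      \<open>b\<close> becomes the unit, and its only commuting inverse square root near the unit is
      the unit. The correction by \<open>x\<close> is therefore invisible there.\<close>
    have "set_add C K x = \<one>\<^bsub>K.Q\<^esub>"
    proof (rule \<phi>.B.inverse_sqrt_unique[of "\<one>\<^bsub>K.Q\<^esub>"])
      show "cnorm K.Q (set_add C K x \<ominus>\<^bsub>K.Q\<^esub> \<one>\<^bsub>K.Q\<^esub>) \<le> 1/5"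
        using \<tau>.hom_dist[of x "\<one>\<^bsub>J.Q\<^esub>"] x by simp
      show "set_add C K x \<otimes>\<^bsub>K.Q\<^esub> set_add C K x \<otimes>\<^bsub>K.Q\<^esub> \<one>\<^bsub>K.Q\<^esub> = \<one>\<^bsub>K.Q\<^esub>"
        using arg_cong[OF x(3), of "set_add C K"] x(1) bc by (simp add: \<tau>.hom_mult \<tau>b)
    qed (use x in \<open>simp_all add: a_minus_def \<phi>.B.r_neg\<close>)
    then have "set_add C K (\<psi> (s k)) = \<phi> (s k)" for k
      using x(1) \<tau>[OF c[of k]] by (simp add: \<psi>s \<tau>.hom_mult v_def cK)
    then show ?thesis
      by (intro cuntz_hom_eqI[OF A star_hom_compose[OF \<psi> \<tau>_hom] \<phi>.star_hom_axioms _ y])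
  qed
  show ?case
  proof (intro exI[of _ n] bexI[of _ \<psi>] ballI lift)
    show "\<psi> \<in> equivariant_hom A ?\<alpha> (cstar_quotient C (J n)) (quotient_action \<gamma>)"
      using \<psi>.star_hom equi by (simp add: equivariant_hom_def quotient_action_def)
  qed
qed

end
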